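(* Let $0<\rho<1$ and let $0\le\delta\le\sqrt{\tfrac{1-\rho}{1+\rho}}$ be arbitrary. Set $\varphi=\rho+\delta\sqrt{1-\rho^2}$. Then there exist explicit one-way common randomness schemes for $\mathsf{DSBS}(\rho)$ and for $\mathsf{BGS}(\rho)$ using $\mathsf{poly}(k)$ samples such that: (1) the min-entropy of Alice's output key is at least $k-o(k)$; (2) the agreement probability is at least $2^{-\delta^2 k}$, up to factors polynomial in $k$; and (3) the communication is $O((1-\varphi^2)\cdot k)$ bits.
   Context: For $-1\le\rho\le 1$, $(X,Y)\sim\mathsf{DSBS}(\rho)$ means $X,Y$ are each uniform on $\{\pm1\}$ with $\mathbb{E}[XY]=\rho$; $(X,Y)\sim\mathsf{BGS}(\rho)$ means $X,Y$ are each standard normal, jointly Gaussian, with correlation $\rho$. A one-way common randomness scheme for a source $\mu$ generating $k$-bit keys: Alice receives $X^n$ and Bob receives $Y^n$, where $(X_i,Y_i)$, $i=1,\dots,n$, are i.i.d. samples from $\mu$; Alice sends one message to Bob and outputs $K_A\in\{0,1\}^k$ (a function of $X^n$); Bob outputs $K_B\in\{0,1\}^k$ (a function of $Y^n$ and the message). The agreement probability is $\Pr[K_A=K_B]$; the number of samples is $n$. *)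

theory Defs
  imports "HOL-Probability.Probability" "HOL-Library.Landau_Symbols"
begin

text \<open>Sources are probability measures on the Borel sets of the plane, so that both sources are
  treated by the same notion of scheme.\<close>

definition DSBS :: "real \<Rightarrow> (real \<times> real) measure" where
  "DSBS \<rho> = distr (measure_pmf (map_pmf (\<lambda>(x, b). (x, if b then x else - x))
     (pair_pmf (pmf_of_set {-1, 1}) (bernoulli_pmf ((1 + \<rho>) / 2))))) borel id"

definition BGS :: "real \<Rightarrow> (real \<times> real) measure" where
  "BGS \<rho> = distr (std_normal_distribution \<Otimes>\<^sub>M std_normal_distribution) borel
     (\<lambda>(u, v). (u, \<rho> * u + sqrt (1 - \<rho>\<^sup>2) * v))"

lemma DSBS_source:
  assumes "-1 \<le> \<rho>" "\<rho> \<le> 1"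
  shows "prob_space (DSBS \<rho>)" and "sets (DSBS \<rho>) = sets borel"
    and "distr (DSBS \<rho>) borel fst = distr (measure_pmf (pmf_of_set {-1, 1})) borel id"
    and "distr (DSBS \<rho>) borel snd = distr (measure_pmf (pmf_of_set {-1, 1})) borel id"
    and "(\<integral>p. fst p * snd p \<partial>DSBS \<rho>) = \<rho>"
proof -
  define p where "p = (1 + \<rho>) / 2"
  have p: "0 \<le> p" "p \<le> 1" using assms by (auto simp: p_def)
  define U :: "real pmf" where "U = pmf_of_set {-1, 1}"
  define Q where "Q = map_pmf (\<lambda>(x, b). (x, if b then x else - x)) (pair_pmf U (bernoulli_pmf p))"
  have D: "DSBS \<rho> = distr (measure_pmf Q) borel id"
    by (simp add: DSBS_def Q_def U_def p_def)
  show "prob_space (DSBS \<rho>)"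
    unfolding D by (rule measure_pmf.prob_space_distr) simp
  show "sets (DSBS \<rho>) = sets borel"
    by (simp add: D)
  have "map_pmf fst Q = map_pmf fst (pair_pmf U (bernoulli_pmf p))"
    unfolding Q_def map_pmf_comp by (rule map_pmf_cong) auto
  then have fst_Q: "map_pmf fst Q = U"
    by (simp add: map_fst_pair_pmf)
  have neg: "map_pmf uminus U = U"
    unfolding U_def by (subst map_pmf_of_set_inj) (auto simp: insert_commute)
  have "map_pmf snd Q = bind_pmf (bernoulli_pmf p) (\<lambda>b. map_pmf (\<lambda>x. if b then x else - x) U)"
    unfolding Q_def pair_pmf_def map_pmf_def
    by (subst bind_commute_pmf) (simp add: bind_assoc_pmf bind_return_pmf)
  also have "\<dots> = bind_pmf (bernoulli_pmf p) (\<lambda>_. U)"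
    by (rule bind_pmf_cong[OF refl]) (case_tac x, simp_all add: neg map_pmf_ident)
  finally have snd_Q: "map_pmf snd Q = U"
    by simp
  have marg: "distr (DSBS \<rho>) borel f = distr (measure_pmf (map_pmf f Q)) borel id"
    if [measurable]: "f \<in> borel_measurable borel" for f :: "real \<times> real \<Rightarrow> real"
    unfolding D by (simp add: distr_distr map_pmf_rep_eq comp_def id_def)
  show "distr (DSBS \<rho>) borel fst = distr (measure_pmf (pmf_of_set {-1, 1})) borel id"
    by (subst marg) (simp_all add: fst_Q U_def borel_measurable_continuous_onI continuous_on_fst)
  show "distr (DSBS \<rho>) borel snd = distr (measure_pmf (pmf_of_set {-1, 1})) borel id"
    by (subst marg) (simp_all add: snd_Q U_def borel_measurable_continuous_onI continuous_on_snd)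
  have "(\<integral>z. fst z * snd z \<partial>DSBS \<rho>) = measure_pmf.expectation Q (\<lambda>z. fst z * snd z)"
    unfolding D by (subst integral_distr)
      (auto intro!: borel_measurable_continuous_onI continuous_intros)
  also have "\<dots> = measure_pmf.expectation (pair_pmf U (bernoulli_pmf p))
      (\<lambda>z. fst z * (if snd z then fst z else - fst z))"
    unfolding Q_def by (simp add: case_prod_beta)
  also have "\<dots> = (\<Sum>z\<in>{-1, 1} \<times> UNIV. pmf (pair_pmf U (bernoulli_pmf p)) z *
      (fst z * (if snd z then fst z else - fst z)))"
    by (subst integral_measure_pmf[of "{-1, 1} \<times> UNIV"]) (auto simp: U_def)
  also have "\<dots> = 2 * p - 1"
    using p by (simp add: sum.cartesian_product[symmetric] UNIV_bool pmf_pair U_def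
        algebra_simps add_divide_distrib flip: sum.cartesian_product')
  also have "\<dots> = \<rho>"
    by (simp add: p_def field_simps)
  finally show "(\<integral>p. fst p * snd p \<partial>DSBS \<rho>) = \<rho>" .
qed

lemma BGS_source:
  assumes "-1 \<le> \<rho>" "\<rho> \<le> 1"
  shows "prob_space (BGS \<rho>)" and "sets (BGS \<rho>) = sets borel"
    and "distributed (BGS \<rho>) lborel fst std_normal_density"
    and "distributed (BGS \<rho>) lborel snd std_normal_density"
    and "\<And>a b. 0 < a\<^sup>2 + 2 * \<rho> * a * b + b\<^sup>2 \<Longrightarrow>
      distributed (BGS \<rho>) lborel (\<lambda>p. a * fst p + b * snd p)
        (normal_density 0 (sqrt (a\<^sup>2 + 2 * \<rho> * a * b + b\<^sup>2)))"
    and "(\<integral>p. fst p * snd p \<partial>BGS \<rho>) = \<rho>"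
proof -
  define N where "N = density lborel (\<lambda>x. ennreal (std_normal_density x))"
  define r where "r = sqrt (1 - \<rho>\<^sup>2)"
  have r: "\<rho>\<^sup>2 + r\<^sup>2 = 1"
    using assms by (simp add: r_def abs_square_le_1 abs_le_iff)
  interpret N: prob_space N
    unfolding N_def by (rule prob_space_normal_density) simp
  interpret NN: pair_prob_space N N ..
  have sN [measurable_cong]: "sets N = sets borel"
    by (simp add: N_def)
  have dN: "distr N lborel (\<lambda>x. x) = density lborel (\<lambda>x. ennreal (std_normal_density x))"
    unfolding N_def by (rule distr_id2) simp
  define g where "g = (\<lambda>z. (fst z, \<rho> * fst z + r * snd z :: real))"
  have B: "BGS \<rho> = distr (N \<Otimes>\<^sub>M N) borel g"
    by (simp add: BGS_def N_def g_def r_def case_prod_beta')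
  have g [measurable]: "g \<in> N \<Otimes>\<^sub>M N \<rightarrow>\<^sub>M borel"
    unfolding g_def by measurable
  show P: "prob_space (BGS \<rho>)"
    unfolding B by (rule NN.prob_space_distr) simp
  show "sets (BGS \<rho>) = sets borel"
    by (simp add: B)
  have d1: "distributed (N \<Otimes>\<^sub>M N) lborel fst std_normal_density"
  proof -
    have "distr (N \<Otimes>\<^sub>M N) lborel fst = distr (distr (N \<Otimes>\<^sub>M N) N fst) lborel (\<lambda>x. x)"
      by (subst distr_distr) (auto simp: comp_def)
    also have "distr (N \<Otimes>\<^sub>M N) N fst = N"
      by (simp add: N.distr_pair_fst)
    finally show ?thesis
      by (simp add: distributed_def dN)
  qed
  have d2: "distributed (N \<Otimes>\<^sub>M N) lborel snd std_normal_density"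
  proof -
    have "distr (N \<Otimes>\<^sub>M N) lborel snd = distr (distr (N \<Otimes>\<^sub>M N) N snd) lborel (\<lambda>x. x)"
      by (subst distr_distr) (auto simp: comp_def)
    also have "distr (N \<Otimes>\<^sub>M N) N snd = distr (distr (N \<Otimes>\<^sub>M N) (N \<Otimes>\<^sub>M N) (\<lambda>(x, y). (y, x))) N fst"
      by (subst distr_distr) (auto simp: comp_def case_prod_beta)
    also have "\<dots> = N"
      by (subst NN.distr_pair_swap[symmetric]) (simp add: N.distr_pair_fst)
    finally show ?thesis
      by (simp add: distributed_def dN)
  qed
  have ind: "NN.indep_var borel fst borel snd"
  proof -
    have "distr (N \<Otimes>\<^sub>M N) borel fst = N" "distr (N \<Otimes>\<^sub>M N) borel snd = N"
      using d1 d2 by (simp_all add: distributed_def N_def cong: distr_cong)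
    moreover have "distr (N \<Otimes>\<^sub>M N) (borel \<Otimes>\<^sub>M borel) (\<lambda>z. (fst z, snd z)) = N \<Otimes>\<^sub>M N"
      by (simp add: distr_id2 sN cong: sets_pair_measure_cong)
    ultimately show ?thesis
      by (simp add: NN.indep_var_distribution_eq)
  qed
  have lin: "distributed (N \<Otimes>\<^sub>M N) lborel (\<lambda>z. c * fst z + d * snd z) (normal_density 0 (sqrt (c\<^sup>2 + d\<^sup>2)))"
    if "0 < c\<^sup>2 + d\<^sup>2" for c d
  proof -
    have c: "distributed (N \<Otimes>\<^sub>M N) lborel (\<lambda>z. c * fst z) (normal_density 0 \<bar>c\<bar>)" if "c \<noteq> 0" for c
      using NN.normal_density_affine[OF d1, of c 0] that by simp
    have d: "distributed (N \<Otimes>\<^sub>M N) lborel (\<lambda>z. d * snd z) (normal_density 0 \<bar>d\<bar>)" if "d \<noteq> 0" for d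
      using NN.normal_density_affine[OF d2, of d 0] that by simp
    have "NN.indep_var borel ((\<lambda>x. c * x) \<circ> fst) borel ((\<lambda>x. d * x) \<circ> snd)"
      by (rule NN.indep_var_compose[OF ind]) auto
    then have i: "NN.indep_var borel (\<lambda>z. c * fst z) borel (\<lambda>z. d * snd z)"
      by (simp add: comp_def)
    show ?thesis
    proof (cases "c = 0 \<or> d = 0")
      case True
      then show ?thesis using that c d by auto
    next
      case False
      then show ?thesis
        using NN.add_indep_normal[OF i _ _ c d] by simp
    qed
  qed
  have push: "distributed (BGS \<rho>) lborel f h"
    if "distributed (N \<Otimes>\<^sub>M N) lborel (\<lambda>z. f (g z)) h" and [measurable]: "f \<in> borel_measurable borel" for f h
    using that unfolding distributed_def B by (simp add: distr_distr comp_def)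
  show comb: "distributed (BGS \<rho>) lborel (\<lambda>p. a * fst p + b * snd p)
        (normal_density 0 (sqrt (a\<^sup>2 + 2 * \<rho> * a * b + b\<^sup>2)))"
    if "0 < a\<^sup>2 + 2 * \<rho> * a * b + b\<^sup>2" for a b
  proof (rule push)
    have e: "(a + b * \<rho>)\<^sup>2 + (b * r)\<^sup>2 = a\<^sup>2 + 2 * \<rho> * a * b + b\<^sup>2"
    proof -
      have "(a + b * \<rho>)\<^sup>2 + (b * r)\<^sup>2 = a\<^sup>2 + 2 * \<rho> * a * b + b\<^sup>2 * (\<rho>\<^sup>2 + r\<^sup>2)"
        by (simp add: power2_eq_square algebra_simps)
      then show ?thesis by (simp add: r)
    qed
    show "distributed (N \<Otimes>\<^sub>M N) lborel (\<lambda>z. a * fst (g z) + b * snd (g z))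
        (normal_density 0 (sqrt (a\<^sup>2 + 2 * \<rho> * a * b + b\<^sup>2)))"
      using lin[of "a + b * \<rho>" "b * r"] that unfolding e by (simp add: g_def algebra_simps)
  qed (intro borel_measurable_continuous_onI continuous_intros)
  show F: "distributed (BGS \<rho>) lborel fst std_normal_density"
    using comb[of 1 0] by simp
  show S: "distributed (BGS \<rho>) lborel snd std_normal_density"
    using comb[of 0 1] by simp
  interpret G: prob_space "BGS \<rho>" by (rule P)
  have mom: "integrable (BGS \<rho>) (\<lambda>p. (X p)\<^sup>2) \<and> (\<integral>p. (X p)\<^sup>2 \<partial>BGS \<rho>) = \<sigma>\<^sup>2"
    if X: "distributed (BGS \<rho>) lborel X (normal_density 0 \<sigma>)" and "0 < \<sigma>" for X \<sigma>
  proof -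
    have "has_bochner_integral lborel (\<lambda>x. normal_density 0 \<sigma> x * x\<^sup>2) (\<sigma>\<^sup>2)"
      using normal_moment_even[OF \<open>0 < \<sigma>\<close>, of 0 1] by (simp add: power2_eq_square)
    then show ?thesis
      using distributed_integrable[OF X, of "\<lambda>x. x\<^sup>2"] distributed_integral[OF X, of "\<lambda>x. x\<^sup>2"]
      by (simp add: has_bochner_integral_iff)
  qed
  define s :: real where "s = (if \<rho> > -1 then 1 else -1)"
  have s: "s * s = 1" "0 < 2 + 2 * \<rho> * s"
    using assms by (auto simp: s_def)
  have c: "distributed (BGS \<rho>) lborel (\<lambda>p. fst p + s * snd p) (normal_density 0 (sqrt (2 + 2 * \<rho> * s)))"
    using comb[of 1 s] s by (simp add: power2_eq_square)
  note m = mom[OF c] mom[OF F] mom[OF S]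
  have "(\<integral>p. fst p * snd p \<partial>BGS \<rho>) =
      (\<integral>p. s / 2 * ((fst p + s * snd p)\<^sup>2 - (fst p)\<^sup>2 - (snd p)\<^sup>2) \<partial>BGS \<rho>)"
  proof (rule Bochner_Integration.integral_cong[OF refl])
    fix p :: "real \<times> real"
    have "s / 2 * ((fst p + s * snd p)\<^sup>2 - (fst p)\<^sup>2 - (snd p)\<^sup>2) =
        (s * s) * (fst p * snd p) + s / 2 * ((s * s) - 1) * (snd p)\<^sup>2"
      by (simp add: power2_eq_square field_simps)
    then show "fst p * snd p = s / 2 * ((fst p + s * snd p)\<^sup>2 - (fst p)\<^sup>2 - (snd p)\<^sup>2)"
      by (simp add: s)
  qed
  also have "\<dots> = s / 2 * ((2 + 2 * \<rho> * s) - 1 - 1)"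
    using m s by (simp add: Bochner_Integration.integral_diff)
  also have "\<dots> = (s * s) * \<rho>"
    by simp
  finally show "(\<integral>p. fst p * snd p \<partial>BGS \<rho>) = \<rho>"
    by (simp add: s)
qed

record cr_scheme =
  num_samples :: nat
  msg_len :: nat
  alice_msg :: "(nat \<Rightarrow> real) \<Rightarrow> bool list"
  alice_key :: "(nat \<Rightarrow> real) \<Rightarrow> bool list"
  bob_key :: "(nat \<Rightarrow> real) \<Rightarrow> bool list \<Rightarrow> bool list"

definition one_way_scheme :: "nat \<Rightarrow> cr_scheme \<Rightarrow> bool" where
  "one_way_scheme k S \<longleftrightarrow>
     alice_msg S \<in> Pi\<^sub>M {..<num_samples S} (\<lambda>_. borel) \<rightarrow>\<^sub>M count_space {m. length m = msg_len S} \<and>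
     alice_key S \<in> Pi\<^sub>M {..<num_samples S} (\<lambda>_. borel) \<rightarrow>\<^sub>M count_space {K. length K = k} \<and>
     (\<forall>m. length m = msg_len S \<longrightarrow>
       (\<lambda>y. bob_key S y m) \<in> Pi\<^sub>M {..<num_samples S} (\<lambda>_. borel) \<rightarrow>\<^sub>M count_space {K. length K = k})"

definition iid_samples :: "(real \<times> real) measure \<Rightarrow> nat \<Rightarrow> (nat \<Rightarrow> real \<times> real) measure" where
  "iid_samples \<mu> n = Pi\<^sub>M {..<n} (\<lambda>_. \<mu>)"

definition alice_input :: "nat \<Rightarrow> (nat \<Rightarrow> real \<times> real) \<Rightarrow> nat \<Rightarrow> real" where
  "alice_input n \<omega> = (\<lambda>i\<in>{..<n}. fst (\<omega> i))"

definition bob_input :: "nat \<Rightarrow> (nat \<Rightarrow> real \<times> real) \<Rightarrow> nat \<Rightarrow> real" where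
  "bob_input n \<omega> = (\<lambda>i\<in>{..<n}. snd (\<omega> i))"

definition min_entropy :: "'w measure \<Rightarrow> ('w \<Rightarrow> 'v) \<Rightarrow> real" where
  "min_entropy M V = - log 2 (SUP v. measure M {\<omega> \<in> space M. V \<omega> = v})"

definition key_min_entropy :: "(real \<times> real) measure \<Rightarrow> cr_scheme \<Rightarrow> real" where
  "key_min_entropy \<mu> S =
     min_entropy (iid_samples \<mu> (num_samples S)) (\<lambda>\<omega>. alice_key S (alice_input (num_samples S) \<omega>))"

definition agreement_prob :: "(real \<times> real) measure \<Rightarrow> cr_scheme \<Rightarrow> real" where
  "agreement_prob \<mu> S = (let n = num_samples S; P = iid_samples \<mu> n in
     measure P {\<omega> \<in> space P. alice_key S (alice_input n \<omega>) =
       bob_key S (bob_input n \<omega>) (alice_msg S (alice_input n \<omega>))})"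

text \<open>A family of schemes is explicit if it is given by formulas: all its components are
  elementary recursive functions over the reals, i.e. they arise from the key length, the received
  data and the fixed parameters (here the numbers in \<open>A\<close>) by arithmetic operations, rounding, the
  functions sqrt, exp and ln, case distinctions, and bounded sums and products. The same formulas
  must serve for all key lengths. Except for the numbers in \<open>A\<close> there are no real constants, as a
  single real constant could encode the tables of arbitrary schemes for all key lengths.\<close>

inductive elementary :: "real set \<Rightarrow> (real list \<Rightarrow> real) \<Rightarrow> bool" for A :: "real set" where
  param: "a \<in> A \<Longrightarrow> elementary A (\<lambda>xs. a)"
| nat_const: "elementary A (\<lambda>xs. real n)"
| num_args: "elementary A (\<lambda>xs. real (length xs))"
| arg: "elementary A f \<Longrightarrow>
    elementary A (\<lambda>xs. if nat \<lfloor>f xs\<rfloor> < length xs then xs ! nat \<lfloor>f xs\<rfloor> else 0)"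
| add: "elementary A f \<Longrightarrow> elementary A g \<Longrightarrow> elementary A (\<lambda>xs. f xs + g xs)"
| diff: "elementary A f \<Longrightarrow> elementary A g \<Longrightarrow> elementary A (\<lambda>xs. f xs - g xs)"
| mult: "elementary A f \<Longrightarrow> elementary A g \<Longrightarrow> elementary A (\<lambda>xs. f xs * g xs)"
| divide: "elementary A f \<Longrightarrow> elementary A g \<Longrightarrow> elementary A (\<lambda>xs. f xs / g xs)"
| floor: "elementary A f \<Longrightarrow> elementary A (\<lambda>xs. of_int \<lfloor>f xs\<rfloor>)"
| sqrt: "elementary A f \<Longrightarrow> elementary A (\<lambda>xs. sqrt (f xs))"
| exp: "elementary A f \<Longrightarrow> elementary A (\<lambda>xs. exp (f xs))"
| ln: "elementary A f \<Longrightarrow> elementary A (\<lambda>xs. ln (f xs))"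
| cond: "elementary A f \<Longrightarrow> elementary A g \<Longrightarrow> elementary A h \<Longrightarrow>
    elementary A (\<lambda>xs. if 0 \<le> f xs then g xs else h xs)"
| sum: "elementary A f \<Longrightarrow> elementary A g \<Longrightarrow>
    elementary A (\<lambda>xs. \<Sum>i<nat \<lfloor>f xs\<rfloor>. g (real i # xs))"
| prod: "elementary A f \<Longrightarrow> elementary A g \<Longrightarrow>
    elementary A (\<lambda>xs. \<Prod>i<nat \<lfloor>f xs\<rfloor>. g (real i # xs))"

text \<open>Bit strings are computed bitwise: the index of the bit is the first argument, followed by
  the key length and the data known to the party.\<close>

definition explicit_family :: "real set \<Rightarrow> (nat \<Rightarrow> cr_scheme) \<Rightarrow> bool" where
  "explicit_family A S \<longleftrightarrow>
     (\<exists>f. elementary A f \<and> (\<forall>k. real (num_samples (S k)) = f [real k])) \<and>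
     (\<exists>f. elementary A f \<and> (\<forall>k. real (msg_len (S k)) = f [real k])) \<and>
     (\<exists>f. elementary A f \<and> (\<forall>k x. \<forall>i<msg_len (S k).
        of_bool (alice_msg (S k) x ! i) = f (real i # real k # map x [0..<num_samples (S k)]))) \<and>
     (\<exists>f. elementary A f \<and> (\<forall>k x. \<forall>i<k.
        of_bool (alice_key (S k) x ! i) = f (real i # real k # map x [0..<num_samples (S k)]))) \<and>
     (\<exists>f. elementary A f \<and> (\<forall>k y m. length m = msg_len (S k) \<longrightarrow> (\<forall>i<k.
        of_bool (bob_key (S k) y m ! i) =
          f (real i # real k # map y [0..<num_samples (S k)] @ map of_bool m))))"

end

theory Submission
  imports Defs "HOL-Computational_Algebra.Primes" "HOL-Computational_Algebra.Polynomial"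
    "HOL-Library.Log_Nat" "HOL-Library.More_List" "HOL-Probability.Hoeffding"
    "HOL-Combinatorics.Multiset_Permutations" "HOL-Real_Asymp.Real_Asymp"
begin

text \<open>Every codeword \<open>c < 2 ^ k\<close> owns a set of \<open>p\<close> sample positions, with \<open>p\<close> a prime of
  polynomial size; reading the bits of \<open>c\<close> as a polynomial over the field with \<open>p\<close> elements makes
  any two of these sets overlap in at most \<open>k\<close> positions. Alice outputs the unique codeword on whose
  positions her samples sum to at least \<open>s\<close>, where \<open>s\<close> is chosen such that a fixed codeword does so
  with probability about \<open>2 powr (- k)\<close>, and sends a prefix of it (if there is no unique codeword,
  she falls back on the signs of \<open>k\<close> fresh samples). Bob looks for a codeword with this prefix on
  whose positions his samples sum to at least \<open>\<phi> s\<close>. As \<open>\<phi> - \<rho>\<close> is \<open>\<delta>\<close> conditional standard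
  deviations of Bob's sample, both thresholds are passed for the same codeword with probability
  \<open>2 powr (- (1 + \<delta>\<^sup>2) k)\<close> up to polynomial factors: for the Gaussian source by independence of the
  two components, for the binary source by the method of types. Since the samples on a small overlap
  contribute little to the sums, the other codewords behave independently, and Chernoff bounds show
  that with probability at least one half none of them interferes. Summing over the \<open>2 ^ k\<close>
  codewords gives agreement probability \<open>2 powr (- \<delta>\<^sup>2 k)\<close> up to polynomial factors.\<close>

section \<open>Primes of polynomial size\<close>

text \<open>Induction on \<open>m\<close>, reading the identity \<open>1 / (Suc m * (n choose Suc m)) =
  1 / (m * ((n - 1) choose m)) - 1 / (m * (n choose m))\<close> as a statement about multiples.\<close>

lemma mult_binomial_dvd_Lcm:
  fixes m n :: nat
  assumes "1 \<le> m" "m \<le> n"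
  shows "m * (n choose m) dvd Lcm {1..n}"
  using assms
proof (induction m arbitrary: n rule: dec_induct)
  case base
  then show ?case by (simp add: dvd_Lcm)
next
  case (step m)
  obtain e where n_eq: "n = m + e"
    using step.prems by (metis Suc_leD le_iff_add)
  define L x C where "L = Lcm {1..n}" and "x = (n - 1) choose m" and "C = n choose m"
  have absorb_comp: "(m + e) * x = e * C"
    using binomial_absorb_comp[of n m] by (simp add: n_eq x_def C_def)
  have succ: "Suc m * (n choose Suc m) = e * C"
    using binomial_absorption[of m n] absorb_comp by (simp add: n_eq x_def)
  have "m * x dvd Lcm {1..n - 1}"
    unfolding x_def by (rule step.IH) (use step.prems in simp)
  also have "Lcm {1..n - 1} dvd L"
    unfolding L_def by (rule Lcm_subset) auto
  finally obtain a where L_eq_x: "L = m * x * a" ..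
  have "m * C dvd L"
    unfolding L_def C_def by (rule step.IH) (use step.prems in simp)
  then obtain b where L_eq_C: "L = m * C * b" ..
  have "int m * (int (e * C) * (int a - int b)) = int (e * C * m * a) - int (e * (m * C * b))"
    by (simp add: algebra_simps)
  also have "\<dots> = int ((m + e) * L) - int (e * L)"
    unfolding absorb_comp[symmetric] L_eq_C[symmetric] by (simp add: L_eq_x algebra_simps)
  also have "\<dots> = int m * int L"
    by (simp add: algebra_simps)
  finally have "int L = int (Suc m * (n choose Suc m)) * (int a - int b)"
    using step.hyps by (simp only: succ) simp
  then have "int (Suc m * (n choose Suc m)) dvd int L" ..
  then show ?case by (simp only: L_def of_nat_dvd_iff)
qed

lemma multiplicity_le_floorlog:
  fixes j n q :: nat
  assumes "1 < q" "0 < j" "j \<le> n"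
  shows "multiplicity q j \<le> floorlog q n - 1"
proof -
  have "q ^ multiplicity q j \<le> j"
    using assms by (intro dvd_imp_le multiplicity_dvd)
  also have "j < q ^ floorlog q n"
    using floorlog_bounds[of n q] assms by simp
  finally show ?thesis using assms by simp
qed

lemma Lcm_atLeastAtMost_le: "Lcm {1..n} \<le> n ^ card {q :: nat. prime q \<and> q \<le> n}"
proof (cases "n = 0")
  case False
  define Q where "Q = {q. prime q \<and> q \<le> n}"
  define D where "D = (\<Prod>q\<in>Q. q ^ (floorlog q n - 1))"
  have finite_Q: "finite Q" by (simp add: Q_def)
  have Q_gt_1: "1 < q" if "q \<in> Q" for q
    using that prime_gt_1_nat by (auto simp: Q_def)
  have D_nonzero: "D \<noteq> 0"
    using finite_Q Q_gt_1 by (auto simp: D_def)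
  have "j dvd D" if j_bounds: "0 < j" "j \<le> n" for j
  proof (rule multiplicity_le_imp_dvd)
    fix q :: nat assume prime_q: "prime q"
    show "multiplicity q j \<le> multiplicity q D"
    proof (cases "q \<in> Q")
      case True
      have "q ^ multiplicity q j dvd q ^ (floorlog q n - 1)"
        using Q_gt_1[OF True] j_bounds by (intro le_imp_power_dvd multiplicity_le_floorlog)
      also have "\<dots> dvd D"
        unfolding D_def using finite_Q True by (rule dvd_prodI)
      finally show ?thesis
        using D_nonzero prime_q by (intro multiplicity_geI) auto
    next
      case False
      then have "\<not> q dvd j"
        using prime_q j_bounds by (auto simp: Q_def dest: dvd_imp_le)
      then show ?thesis by (simp add: not_dvd_imp_multiplicity_0)
    qed
  qed (use j_bounds in simp)
  then have "Lcm {1..n} \<le> D"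
    using D_nonzero by (intro dvd_imp_le Lcm_least) auto
  also have "D \<le> (\<Prod>q\<in>Q. n)"
    unfolding D_def by (rule prod_mono) (use floorlog_bounds[of n] Q_gt_1 False in auto)
  finally show ?thesis by (simp add: Q_def)
next
  case True
  then have "{q :: nat. prime q \<and> q \<le> n} = {}"
    by (auto dest: prime_gt_0_nat)
  then show ?thesis
    using True by (simp only: card.empty power_0) simp
qed

lemma binomial_le_power_card_primes:
  assumes "1 \<le> m" "m \<le> n"
  shows "n choose m \<le> n ^ card {q :: nat. prime q \<and> q \<le> n}"
proof -
  have "n choose m \<le> m * (n choose m)"
    using assms by simp
  also have "\<dots> \<le> Lcm {1..n}"
    using mult_binomial_dvd_Lcm[OF assms] by (rule dvd_imp_le) (auto intro!: Nat.gr0I)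
  also have "\<dots> \<le> n ^ card {q. prime q \<and> q \<le> n}"
    by (rule Lcm_atLeastAtMost_le)
  finally show ?thesis .
qed

lemma exists_prime_le_cube:
  fixes N :: nat
  assumes "4 \<le> N"
  shows "\<exists>p. prime p \<and> N < p \<and> p \<le> 2 * N ^ 3"
proof (rule ccontr)
  assume no_prime: "\<not> ?thesis"
  define n where "n = N ^ 3"
  have n_pos: "0 < n" using assms by (simp add: n_def)
  have "{q. prime q \<and> q \<le> 2 * n} \<subseteq> {1..N}"
    using no_prime by (auto simp: n_def prime_gt_0_nat Suc_le_eq) (meson not_le)
  then have "card {q. prime q \<and> q \<le> 2 * n} \<le> N"
    using card_mono[of "{1..N}"] by simp
  then have "(2 * n) ^ card {q. prime q \<and> q \<le> 2 * n} \<le> (2 * n) ^ N"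
    using n_pos by (intro power_increasing) auto
  then have "(2 * n) choose n \<le> (2 * n) ^ N"
    using binomial_le_power_card_primes[of n "2 * n"] n_pos by linarith
  then have "real ((2 * n) choose n) \<le> real (2 * n) ^ N"
    by (metis of_nat_le_iff of_nat_power)
  then have "4 ^ n / (2 * real n) \<le> real (2 * n) ^ N"
    using central_binomial_lower_bound[OF n_pos] by linarith
  then have "4 ^ n \<le> real (2 * n) ^ Suc N" using n_pos by (simp add: field_simps)
  also have "\<dots> \<le> (2 ^ (3 * N + 1)) ^ Suc N"
  proof (rule power_mono)
    have "real N ^ 3 \<le> (2 ^ N) ^ 3" using of_nat_less_two_power[of N]
      by (intro power_mono) (auto intro: less_imp_le)
    then show "real (2 * n) \<le> 2 ^ (3 * N + 1)"
      by (simp add: n_def power_mult[symmetric] mult.commute)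
  qed simp
  also have "\<dots> = 2 ^ ((3 * N + 1) * Suc N)"
    by (simp only: power_mult)
  finally have "(2::real) ^ (2 * n) \<le> 2 ^ ((3 * N + 1) * Suc N)"
    by (simp add: power_mult del: power_Suc)
  then have "2 * n \<le> (3 * N + 1) * Suc N"
    by (rule power_le_imp_le_exp[rotated]) simp
  moreover have "4 * (4 * N) \<le> N * (N * N)" using assms
    by (intro mult_le_mono) auto
  moreover have "4 * (N * N) \<le> N * (N * N)" "4 * N \<le> N * N" using assms by simp_all
  ultimately show False using assms by (simp add: n_def power3_eq_cube algebra_simps)
qed

definition least_prime_above :: "nat \<Rightarrow> nat" where
  "least_prime_above N = (LEAST p. prime p \<and> N < p)"

lemma least_prime_above:
  assumes "4 \<le> N"
  shows "prime (least_prime_above N)" "N < least_prime_above N" "least_prime_above N \<le> 2 * N ^ 3"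
proof -
  obtain p where prime_bounds: "prime p \<and> N < p" "p \<le> 2 * N ^ 3"
    using exists_prime_le_cube[OF assms] by blast
  show "prime (least_prime_above N)" "N < least_prime_above N"
    using LeastI[of "\<lambda>p. prime p \<and> N < p", OF prime_bounds(1)]
    by (simp_all add: least_prime_above_def)
  show "least_prime_above N \<le> 2 * N ^ 3"
    using Least_le[of "\<lambda>p. prime p \<and> N < p", OF prime_bounds(1)] prime_bounds(2)
    by (simp add: least_prime_above_def)
qed

section \<open>Codewords with nearly disjoint supports\<close>

lemma card_roots_mod_prime:
  fixes P :: "int poly" and p :: nat
  assumes prime_p: "prime p" and "\<exists>i. \<not> int p dvd coeff P i"
  shows "card {a. a < p \<and> int p dvd poly P (int a)} \<le> degree P"
  using assms(2)
proof (induction "degree P" arbitrary: P)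
  case 0
  then obtain c where P_const: "P = [:c:]" by (metis degree_eq_zeroE)
  obtain i where "\<not> int p dvd coeff P i" using 0 by blast
  then have "\<not> int p dvd c" by (cases i) (auto simp: P_const)
  then show ?case by (simp add: P_const)
next
  case (Suc n)
  let ?roots = "\<lambda>P. {a. a < p \<and> int p dvd poly P (int a)}"
  show ?case
  proof (cases "?roots P = {}")
    case False
    then obtain a where root_a: "a < p" "int p dvd poly P (int a)" by blast
    define Q where "Q = synthetic_div P (int a)"
    have P_eq: "P = [:- int a, 1:] * Q + [:poly P (int a):]"
      using synthetic_div_correct'[of "int a" P] by (simp add: Q_def)
    have "\<exists>i. \<not> int p dvd coeff Q i"
    proof (rule ccontr)
      assume "\<not> ?thesis"
      then have "int p dvd coeff P i" for i
        by (subst P_eq, cases i) (use root_a in auto)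
      then show False using Suc.prems by blast
    qed
    then have card_Q: "card (?roots Q) \<le> n"
      using Suc.hyps(1)[of Q] Suc.hyps(2)[symmetric] by (simp add: Q_def degree_synthetic_div)
    have "?roots P \<subseteq> insert a (?roots Q)"
    proof (rule subsetI, rule ccontr)
      fix b assume root_b: "b \<in> ?roots P" "b \<notin> insert a (?roots Q)"
      have "poly P (int b) = (int b - int a) * poly Q (int b) + poly P (int a)"
        by (subst P_eq) (simp add: algebra_simps)
      then have "int p dvd (int b - int a) * poly Q (int b)"
        using root_a root_b by (auto simp: dvd_add_left_iff)
      then have "int p dvd int b - int a"
        using root_b prime_p prime_dvd_mult_iff[of "int p"] by auto
      then have "b = a"
        using root_a root_b by (simp flip: mod_eq_dvd_iff)
      then show False using root_b by simp
    qed
    then have "card (?roots P) \<le> card (insert a (?roots Q))"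
      by (intro card_mono) auto
    also have "\<dots> \<le> Suc n" using card_Q by (simp add: card_insert_if)
    finally show ?thesis using Suc.hyps by simp
  qed (simp only: card.empty)
qed

text \<open>The codeword \<open>c\<close>, read as a polynomial whose coefficients are its bits, picks one point in
  each of the \<open>p\<close> blocks of length \<open>p\<close>.\<close>

definition code_point :: "nat \<Rightarrow> nat \<Rightarrow> nat \<Rightarrow> nat \<Rightarrow> nat" where
  "code_point k p c a = a * p + (\<Sum>t<k. of_bool (bit c t) * a ^ t) mod p"

definition code_support :: "nat \<Rightarrow> nat \<Rightarrow> nat \<Rightarrow> nat set" where
  "code_support k p c = code_point k p c ` {..<p}"

lemma code_point_div_mod:
  assumes "0 < p"
  shows "code_point k p c a div p = a"
    and "code_point k p c a mod p = (\<Sum>t<k. of_bool (bit c t) * a ^ t) mod p"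
  using assms by (simp_all add: code_point_def)

lemma inj_on_code_point: "inj_on (code_point k p c) {..<p}"
proof (cases "p = 0")
  case False
  then show ?thesis
    by (intro inj_onI) (metis code_point_div_mod(1) neq0_conv)
qed simp

lemma code_point_less:
  assumes "a < p"
  shows "code_point k p c a < p\<^sup>2"
proof -
  have "code_point k p c a < Suc a * p"
    using assms by (simp add: code_point_def)
  also have "\<dots> \<le> p * p"
    using assms by (intro mult_le_mono) auto
  finally show ?thesis by (simp add: power2_eq_square)
qed

lemma code_support_subset: "code_support k p c \<subseteq> {..<p\<^sup>2}"
  by (auto simp: code_support_def code_point_less)

lemma finite_code_support [simp]: "finite (code_support k p c)"
  by (simp add: code_support_def)

lemma card_code_support [simp]: "card (code_support k p c) = p"
  by (simp add: code_support_def card_image inj_on_code_point)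

lemma bit_less_two_power_imp_less:
  fixes c :: nat
  assumes "c < 2 ^ k" "bit c t"
  shows "t < k"
proof -
  have "take_bit k c = c" using assms(1) by (simp add: take_bit_nat_eq_self)
  then show ?thesis using assms(2) by (metis bit_take_bit_iff)
qed

lemma codeword_eqI:
  fixes c d :: nat
  assumes "c < 2 ^ k" "d < 2 ^ k" "\<And>l. l < k \<Longrightarrow> bit c l = bit d l"
  shows "c = d"
proof (rule bit_eqI)
  fix l show "bit c l = bit d l"
    using assms bit_less_two_power_imp_less[of c k l] bit_less_two_power_imp_less[of d k l] by blast
qed

lemma card_code_support_Int:
  assumes prime_p: "prime p" and c_less: "c < 2 ^ k" and d_less: "d < 2 ^ k" and "c \<noteq> d"
  shows "card (code_support k p c \<inter> code_support k p d) \<le> k"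
proof -
  define b :: "nat \<Rightarrow> int" where "b t = of_bool (bit c t) - of_bool (bit d t)" for t
  define P where "P = (\<Sum>t<k. monom (b t) t)"
  let ?roots = "{a. a < p \<and> int p dvd poly P (int a)}"
  have p_gt_1: "1 < p" using prime_p by (rule prime_gt_1_nat)
  have coeff_P: "coeff P t = (if t < k then b t else 0)" for t
    by (simp add: P_def coeff_sum)
  have poly_P: "poly P (int a) =
      int (\<Sum>t<k. of_bool (bit c t) * a ^ t) - int (\<Sum>t<k. of_bool (bit d t) * a ^ t)" for a
    by (simp add: P_def poly_sum poly_monom b_def left_diff_distrib sum_subtractf)
  obtain t where "t < k" and bit_neq: "bit c t \<noteq> bit d t"
    using codeword_eqI[OF c_less d_less] \<open>c \<noteq> d\<close> by blast
  moreover have "\<not> int p dvd b t"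
    using bit_neq p_gt_1 by (auto simp: b_def)
  ultimately have "card ?roots \<le> degree P"
    using coeff_P by (intro card_roots_mod_prime[OF prime_p]) (metis)
  also have "degree P \<le> k" by (rule degree_le) (simp add: coeff_P)
  finally have card_roots: "card ?roots \<le> k" .
  have "code_support k p c \<inter> code_support k p d \<subseteq> code_point k p c ` ?roots"
  proof
    fix x assume "x \<in> code_support k p c \<inter> code_support k p d"
    then obtain a a' where points: "a < p" "x = code_point k p c a" "x = code_point k p d a'"
      by (auto simp: code_support_def)
    have p_pos: "0 < p" using p_gt_1 by simp
    have "a' = a"
      using points(2,3) code_point_div_mod(1)[OF p_pos] by metis
    then have "(\<Sum>t<k. of_bool (bit c t) * a ^ t) mod p = (\<Sum>t<k. of_bool (bit d t) * a ^ t) mod p"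
      using points(2,3) code_point_div_mod(2)[OF p_pos] by metis
    then have "int p dvd poly P (int a)"
      unfolding poly_P mod_eq_dvd_iff[symmetric] of_nat_mod[symmetric] by (simp only:)
    then show "x \<in> code_point k p c ` ?roots" using points by auto
  qed
  then have "card (code_support k p c \<inter> code_support k p d) \<le> card ?roots"
    by (rule surj_card_le[rotated]) simp
  then show ?thesis using card_roots by simp
qed

lemma card_take_bit_eq_le:
  fixes c :: nat
  assumes "m \<le> k"
  shows "card {d. d < 2 ^ k \<and> take_bit m d = take_bit m c} \<le> 2 ^ (k - m)"
proof -
  let ?D = "{d. d < 2 ^ k \<and> take_bit m d = take_bit m c}"
  have "inj_on (\<lambda>d. d div 2 ^ m) ?D"
  proof (rule inj_onI)
    fix d d' assume "d \<in> ?D" "d' \<in> ?D" and div_eq: "d div 2 ^ m = d' div 2 ^ m"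
    then have "d mod 2 ^ m = d' mod 2 ^ m"
      by (simp add: take_bit_eq_mod)
    then show "d = d'"
      using div_eq by (metis div_mult_mod_eq)
  qed
  moreover have "(\<lambda>d. d div 2 ^ m) ` ?D \<subseteq> {..<2 ^ (k - m)}"
    using assms by (auto intro!: less_mult_imp_div_less simp: power_add[symmetric])
  ultimately have "card ?D \<le> card {..<2 ^ (k - m) :: nat}"
    by (intro card_inj_on_le) auto
  then show ?thesis by simp
qed

section \<open>Closure properties of elementary functions\<close>

definition head_nat :: "real list \<Rightarrow> nat" where
  "head_nat xs = nat \<lfloor>nth_default 0 xs 0\<rfloor>"

lemma head_nat_Cons [simp]: "head_nat (real i # xs) = i"
  by (simp add: head_nat_def)

lemma elementary_nth_default_floor:
  "elementary A f \<Longrightarrow> elementary A (\<lambda>xs. nth_default 0 xs (nat \<lfloor>f xs\<rfloor>))"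
  unfolding nth_default_def by (rule elementary.arg)

lemma elementary_numeral: "elementary A (\<lambda>xs. numeral n)"
  and elementary_one: "elementary A (\<lambda>xs. 1)"
  and elementary_zero: "elementary A (\<lambda>xs. 0)"
  using elementary.nat_const[of A "numeral n"] elementary.nat_const[of A 1]
    elementary.nat_const[of A 0]
  by simp_all

text \<open>Weakening: the formula may be used below a binder that inserts a variable at position \<open>d\<close>.\<close>

lemma elementary_insert_var:
  assumes "elementary A f"
  shows "elementary A (\<lambda>xs. f (take d xs @ drop (Suc d) xs))"
  using assms
proof (induction arbitrary: d rule: elementary.induct)
  case num_args
  have "(\<lambda>xs. real (length (take d xs @ drop (Suc d) xs))) =
      (\<lambda>xs. if 0 \<le> real (length (xs :: real list)) - real (Suc d) then real (length xs) - real 1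
        else real (length xs))"
    by (auto simp: fun_eq_iff)
  then show ?case
    by (simp only:) (intro elementary.intros)
next
  case (arg f)
  define F where "F = (\<lambda>xs. f (take d xs @ drop (Suc d) xs))"
  define F_pos where "F_pos = (\<lambda>xs. if 0 \<le> F xs then F xs else real 0)"
  define G where "G = (\<lambda>xs. if 0 \<le> F_pos xs - real d then F_pos xs + real 1 else F_pos xs)"
  have "elementary A F" using arg by (simp add: F_def)
  then have "elementary A F_pos" unfolding F_pos_def by (intro elementary.intros)
  then have "elementary A G" unfolding G_def by (intro elementary.intros)
  then have "elementary A (\<lambda>xs. nth_default 0 xs (nat \<lfloor>G xs\<rfloor>))"
    by (rule elementary_nth_default_floor)
  moreover have "nth_default 0 (take d xs @ drop (Suc d) xs) (nat \<lfloor>F xs\<rfloor>) =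
      nth_default 0 xs (nat \<lfloor>G xs\<rfloor>)" for xs
  proof -
    have F_pos: "nat \<lfloor>F_pos xs\<rfloor> = nat \<lfloor>F xs\<rfloor>" "0 \<le> F_pos xs" by (auto simp: F_pos_def)
    have le_floor_iff_le: "d \<le> nat \<lfloor>F_pos xs\<rfloor> \<longleftrightarrow> real d \<le> F_pos xs"
      using F_pos(2) by (simp add: le_nat_floor le_nat_iff le_floor_iff)
    have "nat \<lfloor>G xs\<rfloor> = (if d \<le> nat \<lfloor>F xs\<rfloor> then Suc (nat \<lfloor>F xs\<rfloor>) else nat \<lfloor>F xs\<rfloor>)"
      unfolding G_def F_pos(1)[symmetric] le_floor_iff_le using F_pos(2)
      by (auto simp: nat_add_distrib)
    then show ?thesis
      by (auto simp: nth_default_def nth_append)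
  qed
  ultimately show ?case unfolding F_def nth_default_def by simp
next
  case (sum f g)
  then show ?case
    using elementary.sum[OF sum.IH(1)[of d] sum.IH(2)[of "Suc d"]] by simp
next
  case (prod f g)
  then show ?case
    using elementary.prod[OF prod.IH(1)[of d] prod.IH(2)[of "Suc d"]] by simp
qed (auto intro: elementary.intros)

lemma elementary_tl: "elementary A f \<Longrightarrow> elementary A (\<lambda>xs. f (tl xs))"
  using elementary_insert_var[of A f 0] by (simp add: drop_Suc)

abbreviation elem_nat :: "real set \<Rightarrow> (real list \<Rightarrow> nat) \<Rightarrow> bool" where
  "elem_nat A f \<equiv> elementary A (\<lambda>xs. real (f xs))"

abbreviation elem_bool :: "real set \<Rightarrow> (real list \<Rightarrow> bool) \<Rightarrow> bool" where
  "elem_bool A P \<equiv> elementary A (\<lambda>xs. of_bool (P xs))"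

lemma elem_nat_head_nat: "elem_nat A head_nat"
proof -
  let ?head = "\<lambda>xs. nth_default 0 xs (nat \<lfloor>real 0\<rfloor>) :: real"
  have "elementary A (\<lambda>xs. if 0 \<le> ?head xs then of_int \<lfloor>?head xs\<rfloor> else real 0)"
    by (intro elementary.intros elementary_nth_default_floor)
  moreover have "(\<lambda>xs. if 0 \<le> ?head xs then of_int \<lfloor>?head xs\<rfloor> else real 0) =
      (\<lambda>xs. real (head_nat xs))"
    by (auto simp: fun_eq_iff head_nat_def)
  ultimately show ?thesis by simp
qed

lemma elementary_sum:
  assumes "elem_nat A n" "elementary A (\<lambda>ys. G (head_nat ys) (tl ys))"
  shows "elementary A (\<lambda>xs. \<Sum>i<n xs. G i xs)"
  using elementary.sum[OF assms] by simp

lemma elementary_prod: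
  assumes "elem_nat A n" "elementary A (\<lambda>ys. G (head_nat ys) (tl ys))"
  shows "elementary A (\<lambda>xs. \<Prod>i<n xs. G i xs)"
  using elementary.prod[OF assms] by simp

lemma elem_nat_add: "elem_nat A f \<Longrightarrow> elem_nat A g \<Longrightarrow> elem_nat A (\<lambda>xs. f xs + g xs)"
  using elementary.add[of A "\<lambda>xs. real (f xs)"] by simp

lemma elem_nat_mult: "elem_nat A f \<Longrightarrow> elem_nat A g \<Longrightarrow> elem_nat A (\<lambda>xs. f xs * g xs)"
  using elementary.mult[of A "\<lambda>xs. real (f xs)"] by simp

lemma elem_nat_div: "elem_nat A f \<Longrightarrow> elem_nat A g \<Longrightarrow> elem_nat A (\<lambda>xs. f xs div g xs)"
  using elementary.floor[OF elementary.divide[of A "\<lambda>xs. real (f xs)" "\<lambda>xs. real (g xs)"]]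
  by (simp add: floor_divide_of_nat_eq)

lemma elem_nat_mod:
  assumes "elem_nat A f" "elem_nat A g"
  shows "elem_nat A (\<lambda>xs. f xs mod g xs)"
proof -
  have "elementary A (\<lambda>xs. real (f xs) - real (f xs div g xs * g xs))"
    by (intro elementary.diff elem_nat_mult elem_nat_div assms)
  moreover have "real (f xs) - real (f xs div g xs * g xs) = real (f xs mod g xs)" for xs
    by (metis add_diff_cancel_left' div_mult_mod_eq of_nat_add)
  ultimately show ?thesis by simp
qed

lemma elem_nat_power:
  assumes "elem_nat A f" "elem_nat A g"
  shows "elem_nat A (\<lambda>xs. f xs ^ g xs)"
  using elementary_prod[OF assms(2), of "\<lambda>i xs. real (f xs)"] elementary_tl[OF assms(1)] by simp

lemma elem_nat_sum:
  assumes "elem_nat A n" "elem_nat A (\<lambda>ys. G (head_nat ys) (tl ys))"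
  shows "elem_nat A (\<lambda>xs. \<Sum>i<n xs. G i xs)"
  using elementary_sum[of A n "\<lambda>i xs. real (G i xs)"] assms by simp

lemma elem_nat_of_bool: "elem_bool A P \<Longrightarrow> elem_nat A (\<lambda>xs. of_bool (P xs))"
  by simp

lemma elem_bool_le: "elementary A f \<Longrightarrow> elementary A g \<Longrightarrow> elem_bool A (\<lambda>xs. f xs \<le> g xs)"
  using elementary.cond[OF elementary.diff[of A g f] elementary_one elementary_zero]
  by (simp add: of_bool_def)

lemma elem_bool_not: "elem_bool A P \<Longrightarrow> elem_bool A (\<lambda>xs. \<not> P xs)"
  using elementary.diff[OF elementary_one, of A "\<lambda>xs. of_bool (P xs)"]
  by (simp add: of_bool_not_iff)

lemma elem_bool_conj: "elem_bool A P \<Longrightarrow> elem_bool A Q \<Longrightarrow> elem_bool A (\<lambda>xs. P xs \<and> Q xs)"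
  using elementary.mult[of A "\<lambda>xs. of_bool (P xs)"] by (simp add: of_bool_conj)

lemma elem_bool_disj: "elem_bool A P \<Longrightarrow> elem_bool A Q \<Longrightarrow> elem_bool A (\<lambda>xs. P xs \<or> Q xs)"
  using elem_bool_not[OF elem_bool_conj[OF elem_bool_not[of A P] elem_bool_not[of A Q]]] by simp

lemma elem_bool_imp: "elem_bool A P \<Longrightarrow> elem_bool A Q \<Longrightarrow> elem_bool A (\<lambda>xs. P xs \<longrightarrow> Q xs)"
  unfolding imp_conv_disj by (intro elem_bool_disj elem_bool_not)

lemma elem_bool_iff: "elem_bool A P \<Longrightarrow> elem_bool A Q \<Longrightarrow> elem_bool A (\<lambda>xs. P xs \<longleftrightarrow> Q xs)"
  unfolding iff_conv_conj_imp by (intro elem_bool_conj elem_bool_imp)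

lemma elem_bool_eq: "elementary A f \<Longrightarrow> elementary A g \<Longrightarrow> elem_bool A (\<lambda>xs. f xs = g xs)"
  unfolding eq_iff by (intro elem_bool_conj elem_bool_le)

lemma elem_bool_nat_eq: "elem_nat A f \<Longrightarrow> elem_nat A g \<Longrightarrow> elem_bool A (\<lambda>xs. f xs = g xs)"
  using elem_bool_eq[of A "\<lambda>xs. real (f xs)" "\<lambda>xs. real (g xs)"] by simp

lemma elem_bool_nat_less: "elem_nat A f \<Longrightarrow> elem_nat A g \<Longrightarrow> elem_bool A (\<lambda>xs. f xs < g xs)"
  using elem_bool_not[OF elem_bool_le[of A "\<lambda>xs. real (g xs)" "\<lambda>xs. real (f xs)"]]
  by (simp add: not_le)

lemma elem_bool_all:
  assumes "elem_nat A n" "elem_bool A (\<lambda>ys. P (head_nat ys) (tl ys))"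
  shows "elem_bool A (\<lambda>xs. \<forall>i<n xs. P i xs)"
proof -
  have "(\<Prod>i<m. of_bool (P i xs) :: real) = of_bool (\<forall>i<m. P i xs)" for m xs
    by (induction m) (auto simp: less_Suc_eq)
  then show ?thesis
    using elementary_prod[of A n "\<lambda>i xs. of_bool (P i xs)"] assms by simp
qed

lemma elem_bool_ex:
  assumes "elem_nat A n" "elem_bool A (\<lambda>ys. P (head_nat ys) (tl ys))"
  shows "elem_bool A (\<lambda>xs. \<exists>i<n xs. P i xs)"
  using elem_bool_not[OF elem_bool_all[OF assms(1) elem_bool_not[OF assms(2)]]] by simp

lemma elem_bool_bit:
  assumes "elem_nat A f" "elem_nat A g"
  shows "elem_bool A (\<lambda>xs. bit (f xs) (g xs))"
proof -
  have "elem_bool A (\<lambda>xs. f xs div 2 ^ g xs mod 2 = 1)"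
    by (intro elem_bool_nat_eq elem_nat_mod elem_nat_div elem_nat_power elementary.nat_const assms)
  then show ?thesis by (simp add: bit_iff_odd odd_iff_mod_2_eq_one)
qed

lemmas elem_intros = elementary.nat_const elem_nat_head_nat elem_nat_add elem_nat_mult elem_nat_div
  elem_nat_mod elem_nat_power elem_nat_sum elem_bool_le elem_bool_not elem_bool_conj elem_bool_disj
  elem_bool_imp elem_bool_iff elem_bool_nat_eq elem_bool_nat_less elem_bool_all elem_bool_ex
  elem_bool_bit

lemma elem_nat_Least:
  assumes elem_nat_b: "elem_nat A b" and elem_bool_P: "elem_bool A (\<lambda>ys. P (head_nat ys) (tl ys))"
    and witness_below: "\<And>xs. \<exists>i<b xs. P i xs"
  shows "elem_nat A (\<lambda>xs. LEAST i. P i xs)"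
proof -
  have "head_nat (take 1 zs @ drop 2 zs) = head_nat zs \<and> tl (take 1 zs @ drop 2 zs) = tl (tl zs)"
    for zs
    by (cases zs) (auto simp: head_nat_def numeral_2_eq_2 drop_Suc)
  then have "elem_bool A (\<lambda>zs. P (head_nat zs) (tl (tl zs)))"
    using elementary_insert_var[OF elem_bool_P, of 1] by (simp add: numeral_2_eq_2)
  then have "elem_nat A (\<lambda>xs. \<Sum>j<b xs. of_bool (\<forall>i<j + 1. \<not> P i xs))"
    by (intro elem_intros elem_nat_of_bool elem_nat_b)
  moreover have "(\<Sum>j<b xs. of_bool (\<forall>i<j + 1. \<not> P i xs)) = (LEAST i. P i xs)" for xs
  proof -
    define l where "l = (LEAST i. P i xs)"
    obtain i where witness: "i < b xs" "P i xs" using witness_below by blast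
    have "P l xs"
      unfolding l_def using witness(2) by (rule LeastI)
    moreover have "l \<le> i"
      unfolding l_def using witness(2) by (rule Least_le)
    moreover have "\<not> P i xs" if "i < l" for i
      using that unfolding l_def by (rule not_less_Least)
    ultimately have "(\<forall>i<j + 1. \<not> P i xs) \<longleftrightarrow> j < l" and "l < b xs" for j
      using witness(1) by (auto simp: less_Suc_eq_le not_le[symmetric])
    then have "(\<Sum>j<b xs. of_bool (\<forall>i<j + 1. \<not> P i xs)) = card ({..<b xs} \<inter> {..<l})"
      by (simp add: of_bool_def sum.If_cases flip: lessThan_def)
    also have "{..<b xs} \<inter> {..<l} = {..<l}"
      using \<open>l < b xs\<close> by auto
    finally show ?thesis by (simp add: l_def)
  qed
  ultimately show ?thesis by simp
qed

lemma elem_bool_prime: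
  assumes "elem_nat A f"
  shows "elem_bool A (\<lambda>xs. prime (f xs))"
proof -
  have "prime n \<longleftrightarrow> 1 < n \<and> (\<forall>i<n. 1 < i \<longrightarrow> \<not> n mod i = 0)" for n :: nat
    by (simp add: prime_nat_iff' mod_eq_0_iff_dvd Ball_def Suc_le_eq numeral_2_eq_2) blast
  then show ?thesis
    by (simp only:) (intro elem_intros assms elementary_tl[OF assms])
qed

lemma elem_nat_least_prime_above:
  assumes elem_nat_ge_4: "elem_nat A N" "\<And>xs. 4 \<le> N xs"
  shows "elem_nat A (\<lambda>xs. least_prime_above (N xs))"
  unfolding least_prime_above_def
proof (rule elem_nat_Least)
  show "elem_nat A (\<lambda>xs. 2 * N xs ^ 3 + 1)"
    by (intro elem_intros elem_nat_ge_4)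
  show "elem_bool A (\<lambda>ys. prime (head_nat ys) \<and> N (tl ys) < head_nat ys)"
    by (intro elem_intros elem_bool_prime elementary_tl[OF elem_nat_ge_4(1)])
  show "\<exists>p<2 * N xs ^ 3 + 1. prime p \<and> N xs < p" for xs
    using exists_prime_le_cube[OF elem_nat_ge_4(2), of xs]
    by (meson less_add_one order_le_less_trans)
qed

definition is_drop :: "('a list \<Rightarrow> 'a list) \<Rightarrow> bool" where
  "is_drop D \<longleftrightarrow> (\<exists>d. D = drop d)"

lemma is_drop_drop: "is_drop (drop d)"
  by (auto simp: is_drop_def)

lemma is_drop_tl: "is_drop D \<Longrightarrow> is_drop (\<lambda>xs. D (tl xs))"
  by (auto simp: is_drop_def fun_eq_iff drop_Suc intro: exI[of _ "Suc _"])

lemma elementary_nth_default: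
  assumes "is_drop D" "elem_nat A f"
  shows "elementary A (\<lambda>xs. nth_default 0 (D xs) (f xs))"
proof -
  obtain d where D_eq: "D = drop d" using assms(1) by (auto simp: is_drop_def)
  have "elementary A (\<lambda>xs. nth_default 0 xs (nat \<lfloor>real (d + f xs)\<rfloor>))"
    by (intro elementary_nth_default_floor elem_intros assms)
  moreover have "nth_default 0 xs (nat \<lfloor>real (d + f xs)\<rfloor>) = nth_default 0 (drop d xs) (f xs)"
    for xs :: "real list"
    by (auto simp: nth_default_def floor_of_nat simp del: of_nat_add)
  ultimately show ?thesis by (simp only: D_eq)
qed

section \<open>Independent coordinates and subgaussian tails\<close>

abbreviation iid :: "'a measure \<Rightarrow> 'i set \<Rightarrow> ('i \<Rightarrow> 'a) measure" where
  "iid \<mu> I \<equiv> Pi\<^sub>M I (\<lambda>_. \<mu>)"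

lemma prob_space_iid: "prob_space \<mu> \<Longrightarrow> prob_space (iid \<mu> I)"
  by (rule prob_space_PiM)

lemma indep_vars_iid_coordinates:
  assumes prob_space_\<mu>: "prob_space \<mu>"
  shows "prob_space.indep_vars (iid \<mu> I) (\<lambda>_. \<mu>) (\<lambda>i \<omega>. \<omega> i) I"
proof -
  interpret P: prob_space "iid \<mu> I" by (rule prob_space_iid[OF prob_space_\<mu>])
  show ?thesis
  proof (cases "I = {}")
    case False
    have "distr (iid \<mu> I) (iid \<mu> I) (\<lambda>\<omega>. \<lambda>i\<in>I. \<omega> i) = distr (iid \<mu> I) (iid \<mu> I) (\<lambda>\<omega>. \<omega>)"
      by (rule distr_cong) (auto simp: space_PiM PiE_iff intro: extensional_restrict)
    also have "\<dots> = (\<Pi>\<^sub>M i\<in>I. distr (iid \<mu> I) \<mu> (\<lambda>\<omega>. \<omega> i))"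
      using distr_PiM_component[of I "\<lambda>_. \<mu>"] prob_space_\<mu> by (simp add: distr_id cong: PiM_cong)
    finally show ?thesis
      by (subst P.indep_vars_iff_distr_eq_PiM'[OF False]) auto
  next
    case True
    then show ?thesis
      unfolding P.indep_vars_def P.indep_sets_def by simp
  qed
qed

lemma measure_iid_restrict:
  assumes prob_space_\<mu>: "prob_space \<mu>" and finite_superset: "finite K" "I \<subseteq> K"
    and sets_A: "A \<in> sets (iid \<mu> I)"
  shows "\<P>(\<omega> in iid \<mu> K. restrict \<omega> I \<in> A) = measure (iid \<mu> I) A"
proof -
  interpret product_prob_space "\<lambda>_. \<mu>" K
    by (rule product_prob_spaceI) (rule prob_space_\<mu>)
  have "measure (iid \<mu> I) A = measure (distr (iid \<mu> K) (iid \<mu> I) (\<lambda>\<omega>. restrict \<omega> I)) A"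
    using distr_restrict[OF finite_superset(2,1)] by simp
  also have "\<dots> = \<P>(\<omega> in iid \<mu> K. restrict \<omega> I \<in> A)"
    using measure_distr[OF measurable_restrict_subset[OF finite_superset(2)] sets_A]
    by (simp add: vimage_def Int_def conj_commute)
  finally show ?thesis by simp
qed

lemma measure_iid_restrict_conj:
  assumes prob_space_\<mu>: "prob_space \<mu>" and disjoint_subsets: "finite K" "I \<subseteq> K" "J \<subseteq> K" "I \<inter> J = {}"
    and sets_A: "A \<in> sets (iid \<mu> I)" and sets_B: "B \<in> sets (iid \<mu> J)"
  shows "\<P>(\<omega> in iid \<mu> K. restrict \<omega> I \<in> A \<and> restrict \<omega> J \<in> B) =
    measure (iid \<mu> I) A * measure (iid \<mu> J) B"
proof -
  interpret P: prob_space "iid \<mu> K" by (rule prob_space_iid[OF prob_space_\<mu>])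
  have "P.indep_var (iid \<mu> I) (\<lambda>\<omega>. restrict \<omega> I) (iid \<mu> J) (\<lambda>\<omega>. restrict \<omega> J)"
    by (rule P.indep_var_restrict[OF indep_vars_iid_coordinates[OF prob_space_\<mu>]
      disjoint_subsets(4,2,3)])
  from P.indep_varD[OF this sets_A sets_B]
  have "\<P>(\<omega> in iid \<mu> K. restrict \<omega> I \<in> A \<and> restrict \<omega> J \<in> B) =
      \<P>(\<omega> in iid \<mu> K. restrict \<omega> I \<in> A) * \<P>(\<omega> in iid \<mu> K. restrict \<omega> J \<in> B)"
    by (simp add: vimage_def Int_def conj_commute)
  then show ?thesis
    using measure_iid_restrict[OF prob_space_\<mu> disjoint_subsets(1,2) sets_A]
      measure_iid_restrict[OF prob_space_\<mu> disjoint_subsets(1,3) sets_B] by simp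
qed

definition subgaussian :: "'a measure \<Rightarrow> ('a \<Rightarrow> real) \<Rightarrow> bool" where
  "subgaussian M X \<longleftrightarrow> X \<in> borel_measurable M \<and>
     (\<forall>t. (\<integral>\<^sup>+x. ennreal (exp (t * X x)) \<partial>M) \<le> ennreal (exp (t\<^sup>2 / 2)))"

lemma subgaussian_uminus:
  assumes "subgaussian M X"
  shows "subgaussian M (\<lambda>x. - X x)"
proof -
  have "(\<integral>\<^sup>+x. ennreal (exp (t * - X x)) \<partial>M) \<le> ennreal (exp (t\<^sup>2 / 2))" for t
    using assms[unfolded subgaussian_def, THEN conjunct2, rule_format, of "- t"] by simp
  then show ?thesis using assms by (simp add: subgaussian_def)
qed

lemma subgaussian_distr_iff:
  assumes [measurable]: "f \<in> M \<rightarrow>\<^sub>M N" "X \<in> borel_measurable N"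
  shows "subgaussian (distr M N f) X \<longleftrightarrow> subgaussian M (\<lambda>x. X (f x))"
  by (simp add: subgaussian_def nn_integral_distr)

lemma (in interval_bounded_random_variable) subgaussian_if_mean_zero:
  assumes mean_zero: "expectation f = 0" and width: "b - a = 2"
  shows "subgaussian M f"
proof -
  have "(\<integral>\<^sup>+x. ennreal (exp (t * f x)) \<partial>M) \<le> ennreal (exp (t\<^sup>2 / 2))" for t
  proof (cases t "0 :: real" rule: linorder_cases)
    case greater
    then show ?thesis
      using Hoeffdings_lemma_nn_integral_0[OF greater mean_zero] by (simp add: width)
  next
    case less
    interpret neg: interval_bounded_random_variable M "\<lambda>x. - f x" "- b" "- a"
      by unfold_locales (auto intro!: eventually_mono[OF AE_in_interval])
    show ?thesis
      using neg.Hoeffdings_lemma_nn_integral_0[of "- t"] less mean_zero width by simp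
  qed (simp add: emeasure_space_1)
  then show ?thesis by (simp add: subgaussian_def)
qed

lemma (in prob_space) subgaussian_sum_tail:
  assumes finite_J: "finite J" and indep: "indep_vars (\<lambda>_. borel) X J"
    and subgaussian_X: "\<And>j. j \<in> J \<Longrightarrow> subgaussian M (X j)" and t_nonneg: "0 \<le> t"
  shows "\<P>(\<omega> in M. u \<le> (\<Sum>j\<in>J. X j \<omega>)) \<le> exp (real (card J) * (t\<^sup>2 / 2) - t * u)"
proof (cases "t = 0")
  case False
  with t_nonneg have t_pos: "0 < t" by simp
  have [measurable]: "X j \<in> borel_measurable M" if "j \<in> J" for j
    using subgaussian_X[OF that] by (simp add: subgaussian_def)
  let ?S = "\<lambda>\<omega>. \<Sum>j\<in>J. X j \<omega>"
  have "(\<integral>\<^sup>+\<omega>\<in>space M. ennreal (exp (t * ?S \<omega>)) \<partial>M) = (\<integral>\<^sup>+\<omega>. (\<Prod>j\<in>J. ennreal (exp (t * X j \<omega>))) \<partial>M)"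
    by (intro nn_integral_cong) (simp add: sum_distrib_left exp_sum[OF finite_J] prod_ennreal)
  also have "\<dots> = (\<Prod>j\<in>J. \<integral>\<^sup>+\<omega>. ennreal (exp (t * X j \<omega>)) \<partial>M)"
    by (intro indep_vars_nn_integral finite_J indep_vars_compose2[OF indep]) auto
  also have "\<dots> \<le> (\<Prod>j\<in>J. ennreal (exp (t\<^sup>2 / 2)))"
    using subgaussian_X by (intro prod_mono_ennreal) (auto simp: subgaussian_def)
  also have "\<dots> = ennreal (exp (real (card J) * (t\<^sup>2 / 2)))"
    by (simp only: prod_constant ennreal_power exp_ge_zero exp_of_nat_mult)
  finally have mgf: "(\<integral>\<^sup>+\<omega>\<in>space M. ennreal (exp (t * ?S \<omega>)) \<partial>M) \<le>
      ennreal (exp (real (card J) * (t\<^sup>2 / 2)))" .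
  have "ennreal (\<P>(\<omega> in M. u \<le> ?S \<omega>)) \<le>
      ennreal (exp (- t * u)) * (\<integral>\<^sup>+\<omega>\<in>space M. ennreal (exp (t * ?S \<omega>)) \<partial>M)"
    unfolding emeasure_eq_measure[symmetric] by (rule Chernoff_ineq_nn_integral_ge[OF t_pos]) auto
  also have "\<dots> \<le> ennreal (exp (- t * u)) * ennreal (exp (real (card J) * (t\<^sup>2 / 2)))"
    by (intro mult_left_mono mgf) simp
  also have "\<dots> = ennreal (exp (real (card J) * (t\<^sup>2 / 2) - t * u))"
    by (simp add: algebra_simps flip: ennreal_mult exp_add)
  finally show ?thesis by simp
qed simp

lemma subgaussian_iid_sum_tail:
  assumes prob_space_\<mu>: "prob_space \<mu>" and subgaussian_f: "subgaussian \<mu> f"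
    and finite_subset_J: "finite J" "J \<subseteq> K" and t_nonneg: "0 \<le> t"
  shows "\<P>(\<omega> in iid \<mu> K. u \<le> (\<Sum>j\<in>J. f (\<omega> j))) \<le> exp (real (card J) * (t\<^sup>2 / 2) - t * u)"
proof -
  interpret P: prob_space "iid \<mu> K" by (rule prob_space_iid[OF prob_space_\<mu>])
  have [measurable]: "f \<in> borel_measurable \<mu>" using subgaussian_f by (simp add: subgaussian_def)
  have "P.indep_vars (\<lambda>_. \<mu>) (\<lambda>j \<omega>. \<omega> j) J"
    by (rule P.indep_vars_subset[OF indep_vars_iid_coordinates[OF prob_space_\<mu>] finite_subset_J(2)])
  then have indep: "P.indep_vars (\<lambda>_. borel) (\<lambda>j \<omega>. f (\<omega> j)) J"
    by (rule P.indep_vars_compose2) simp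
  show ?thesis
  proof (rule P.subgaussian_sum_tail[OF finite_subset_J(1) indep _ t_nonneg])
    fix j assume "j \<in> J"
    then have j_in_K: "j \<in> K" using finite_subset_J(2) by blast
    have "distr (iid \<mu> K) \<mu> (\<lambda>\<omega>. \<omega> j) = \<mu>"
      using distr_PiM_component[of K "\<lambda>_. \<mu>", OF prob_space_\<mu> j_in_K] .
    then show "subgaussian (iid \<mu> K) (\<lambda>\<omega>. f (\<omega> j))"
      using subgaussian_distr_iff[of "\<lambda>\<omega>. \<omega> j" "iid \<mu> K" \<mu> f] subgaussian_f j_in_K by simp
  qed
qed

lemma subgaussian_iid_coordinate_tail:
  assumes prob_space_\<mu>: "prob_space \<mu>" and subgaussian_f: "subgaussian \<mu> f" and i_in_K: "i \<in> K"
    and M_nonneg: "0 \<le> M"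
  shows "\<P>(\<omega> in iid \<mu> K. M < \<bar>f (\<omega> i)\<bar>) \<le> 2 * exp (- (M\<^sup>2 / 2))"
proof -
  let ?P = "iid \<mu> K"
  interpret P: prob_space ?P by (rule prob_space_iid[OF prob_space_\<mu>])
  have [measurable]: "f \<in> borel_measurable \<mu>" using subgaussian_f by (simp add: subgaussian_def)
  note [measurable] = measurable_component_singleton[OF i_in_K, of "\<lambda>_. \<mu>"]
  have tail: "\<P>(\<omega> in ?P. M \<le> g (\<omega> i)) \<le> exp (- (M\<^sup>2 / 2))" if "subgaussian \<mu> g" for g
    using subgaussian_iid_sum_tail[OF prob_space_\<mu> that, of "{i}" K M M] i_in_K M_nonneg
    by (simp add: power2_eq_square)
  have "\<P>(\<omega> in ?P. M < \<bar>f (\<omega> i)\<bar>) \<le>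
      measure ?P ({\<omega> \<in> space ?P. M \<le> f (\<omega> i)} \<union> {\<omega> \<in> space ?P. M \<le> - f (\<omega> i)})"
    by (rule P.finite_measure_mono) auto
  also have "\<dots> \<le> \<P>(\<omega> in ?P. M \<le> f (\<omega> i)) + \<P>(\<omega> in ?P. M \<le> - f (\<omega> i))"
    by (rule measure_Un_le) auto
  finally show ?thesis using tail[OF subgaussian_f] tail[OF subgaussian_uminus[OF subgaussian_f]]
    by linarith
qed

lemma sum_outside_overlap_ge:
  fixes g :: "'i \<Rightarrow> real"
  assumes "finite J" and bounded: "\<And>i. i \<in> I \<Longrightarrow> g i \<le> M"
    and overlap: "real (card (J \<inter> I)) \<le> q" and "0 \<le> M" and u_le_sum: "u \<le> (\<Sum>j\<in>J. g j)"
  shows "u - q * M \<le> (\<Sum>j\<in>J - I. g j)"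
proof -
  have "(\<Sum>j\<in>J. g j) = (\<Sum>j\<in>J \<inter> I. g j) + (\<Sum>j\<in>J - I. g j)"
    by (rule sum.Int_Diff[OF \<open>finite J\<close>])
  moreover have "(\<Sum>j\<in>J \<inter> I. g j) \<le> real (card (J \<inter> I)) * M"
    using bounded by (intro sum_bounded_above) auto
  moreover have "real (card (J \<inter> I)) * M \<le> q * M"
    using overlap \<open>0 \<le> M\<close> by (rule mult_right_mono)
  ultimately show ?thesis using u_le_sum by linarith
qed

text \<open>The coordinates outside of \<open>I\<close> are independent of the event \<open>E\<close>.\<close>

lemma subgaussian_overlapping_sum_tail:
  fixes f :: "'a \<Rightarrow> real" and I J K :: "'i set"
  assumes prob_space_\<mu>: "prob_space \<mu>" and subgaussian_f: "subgaussian \<mu> f"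
    and finite_supersets: "finite K" "I \<subseteq> K" "J \<subseteq> K"
    and sets_E: "E \<in> sets (iid \<mu> I)" and bounded: "\<And>\<omega> i. \<omega> \<in> E \<Longrightarrow> i \<in> I \<Longrightarrow> f (\<omega> i) \<le> M"
    and overlap: "real (card (J \<inter> I)) \<le> q" "0 \<le> M" and "0 \<le> t"
  shows "\<P>(\<omega> in iid \<mu> K. restrict \<omega> I \<in> E \<and> u \<le> (\<Sum>j\<in>J. f (\<omega> j)))
    \<le> measure (iid \<mu> I) E * exp (real (card J) * (t\<^sup>2 / 2) - t * (u - q * M))"
proof -
  let ?P = "iid \<mu> K"
  interpret P: prob_space ?P by (rule prob_space_iid[OF prob_space_\<mu>])
  have [measurable]: "f \<in> borel_measurable \<mu>" using subgaussian_f by (simp add: subgaussian_def)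
  define L where "L = J - I"
  have finite: "finite J" "finite L" and L_disjoint: "L \<subseteq> K" "I \<inter> L = {}"
    using finite_supersets by (auto simp: L_def intro: finite_subset)
  define A where "A = {\<omega> \<in> space (iid \<mu> L). u - q * M \<le> (\<Sum>j\<in>L. f (\<omega> j))}"
  have sets_A: "A \<in> sets (iid \<mu> L)" unfolding A_def by measurable
  note [measurable] = measurable_restrict_subset[OF finite_supersets(2), of "\<lambda>_. \<mu>"]
    measurable_restrict_subset[OF L_disjoint(1), of "\<lambda>_. \<mu>"] sets_A sets_E
  have outside: "restrict \<omega> L \<in> A"
    if in_event: "\<omega> \<in> space ?P" "restrict \<omega> I \<in> E" "u \<le> (\<Sum>j\<in>J. f (\<omega> j))" for \<omega>
  proof -
    have "f (restrict \<omega> I i) \<le> M" if "i \<in> I" for i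
      by (rule bounded[OF in_event(2) that])
    then have "u - q * M \<le> (\<Sum>j\<in>L. f (\<omega> j))"
      unfolding L_def using overlap in_event(3) by (intro sum_outside_overlap_ge finite) auto
    moreover have "restrict \<omega> L \<in> space (iid \<mu> L)"
      using in_event(1) by (rule measurable_space[rotated]) measurable
    ultimately show ?thesis by (simp add: A_def)
  qed
  have "\<P>(\<omega> in ?P. restrict \<omega> I \<in> E \<and> u \<le> (\<Sum>j\<in>J. f (\<omega> j))) \<le>
      \<P>(\<omega> in ?P. restrict \<omega> I \<in> E \<and> restrict \<omega> L \<in> A)"
    using outside by (intro P.finite_measure_mono) auto
  also have "\<dots> = measure (iid \<mu> I) E * measure (iid \<mu> L) A"
    by (rule measure_iid_restrict_conj[OF prob_space_\<mu> finite_supersets(1,2) L_disjoint sets_E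
      sets_A])
  also have "\<dots> \<le> measure (iid \<mu> I) E * exp (real (card L) * (t\<^sup>2 / 2) - t * (u - q * M))"
    unfolding A_def using finite(2) \<open>0 \<le> t\<close>
    by (intro mult_left_mono subgaussian_iid_sum_tail[OF prob_space_\<mu> subgaussian_f]) auto
  also have "\<dots> \<le> measure (iid \<mu> I) E * exp (real (card J) * (t\<^sup>2 / 2) - t * (u - q * M))"
    using card_mono[OF finite(1), of L]
    by (intro mult_left_mono mult_right_mono iffD2[OF exp_le_cancel_iff] diff_right_mono)
      (auto simp: L_def)
  finally show ?thesis .
qed

lemma (in finite_measure) measure_Diff_UN_ge:
  assumes finite_D: "finite D" and sets_A: "A \<in> sets M" and sets_B: "\<And>d. d \<in> D \<Longrightarrow> B d \<in> sets M"
  shows "measure M A - (\<Sum>d\<in>D. measure M (A \<inter> B d)) \<le> measure M (A - (\<Union>d\<in>D. B d))"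
proof -
  have "measure M (A \<inter> (\<Union>d\<in>D. B d)) \<le> (\<Sum>d\<in>D. measure M (A \<inter> B d))"
    unfolding Int_UN_distrib using sets_A sets_B by (intro measure_UNION_le[OF finite_D]) auto
  moreover have "measure M (A - (\<Union>d\<in>D. B d)) = measure M A - measure M (A \<inter> (\<Union>d\<in>D. B d))"
    using sets_A sets_B finite_D by (intro finite_measure_Diff') auto
  ultimately show ?thesis by simp
qed

section \<open>The method of types\<close>

definition words_of_type :: "'i set \<Rightarrow> 'a set \<Rightarrow> ('a \<Rightarrow> nat) \<Rightarrow> ('i \<Rightarrow> 'a) set" where
  "words_of_type I A m = {f \<in> I \<rightarrow>\<^sub>E A. \<forall>a\<in>A. card {i \<in> I. f i = a} = m a}"

lemma finite_words_of_type: "finite I \<Longrightarrow> finite A \<Longrightarrow> finite (words_of_type I A m)"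
  by (simp add: words_of_type_def finite_PiE)

lemma sum_words_of_type:
  fixes w :: "'a \<Rightarrow> 'b :: semiring_1"
  assumes "finite I" "finite A" "f \<in> words_of_type I A m"
  shows "(\<Sum>i\<in>I. w (f i)) = (\<Sum>a\<in>A. of_nat (m a) * w a)"
proof -
  have "(\<Sum>i\<in>I. w (f i)) = (\<Sum>a\<in>A. of_nat (card {i \<in> I. f i = a}) * w a)"
    by (rule sum_fun_comp) (use assms in \<open>auto simp: words_of_type_def\<close>)
  also have "\<dots> = (\<Sum>a\<in>A. of_nat (m a) * w a)"
    using assms(3) by (intro sum.cong) (auto simp: words_of_type_def)
  finally show ?thesis .
qed

lemma prod_words_of_type:
  fixes w :: "'a \<Rightarrow> 'b :: comm_monoid_mult"
  assumes "finite I" "finite A" "f \<in> words_of_type I A m"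
  shows "(\<Prod>i\<in>I. w (f i)) = (\<Prod>a\<in>A. w a ^ m a)"
proof -
  have "(\<Prod>i\<in>I. w (f i)) = (\<Prod>a\<in>A. \<Prod>i\<in>{i \<in> I. f i = a}. w (f i))"
    using assms by (intro prod.group[symmetric]) (auto simp: words_of_type_def)
  also have "\<dots> = (\<Prod>a\<in>A. w a ^ m a)"
    using assms(3) by (intro prod.cong) (auto simp: words_of_type_def)
  finally show ?thesis .
qed

lemma count_sum_replicate_mset:
  "finite A \<Longrightarrow> count (\<Sum>a\<in>A. replicate_mset (m a) a) b = (if b \<in> A then m b else 0)"
  by (simp add: count_sum)

lemma bij_betw_words_of_type_permutations:
  assumes xs: "distinct xs" and finite_A: "finite A" and sum_m: "(\<Sum>a\<in>A. m a) = length xs"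
  shows "bij_betw (\<lambda>f. map f xs) (words_of_type (set xs) A m)
    (permutations_of_multiset (\<Sum>a\<in>A. replicate_mset (m a) a))"
    (is "bij_betw _ ?W (permutations_of_multiset ?M)")
  unfolding bij_betw_def
proof (intro conjI subset_antisym subsetI)
  note count_M = count_sum_replicate_mset[OF finite_A]
  have count_map: "count (mset (map f xs)) a = card {i \<in> set xs. f i = a}" for f :: "'a \<Rightarrow> 'b" and a
    using count_image_mset_eq_card_vimage[of "set xs" f a] mset_set_set[OF xs] by simp
  show "inj_on (\<lambda>f. map f xs) ?W"
    by (rule inj_onI) (auto simp: words_of_type_def intro: PiE_ext)
  {
    fix ys assume "ys \<in> (\<lambda>f. map f xs) ` ?W"
    then obtain f where f: "f \<in> set xs \<rightarrow>\<^sub>E A" "\<And>a. a \<in> A \<Longrightarrow> card {i \<in> set xs. f i = a} = m a"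
        "ys = map f xs"
      by (auto simp: words_of_type_def)
    have "count (mset ys) a = count ?M a" for a
    proof (cases "a \<in> A")
      case False
      then have "{i \<in> set xs. f i = a} = {}" using f(1) by auto
      then show ?thesis using False by (simp only: f(3) count_map count_M) simp
    qed (simp only: f count_map count_M if_True)
    then show "ys \<in> permutations_of_multiset ?M"
      by (intro permutations_of_multisetI multiset_eqI)
  }
  fix ys assume "ys \<in> permutations_of_multiset ?M"
  then have ys: "mset ys = ?M" by (simp add: permutations_of_multiset_def)
  have length_eq: "length xs = length ys"
    using sum_m by (simp add: ys size_multiset_sum flip: size_mset)
  define f where "f = (\<lambda>i\<in>set xs. the (map_of (zip xs ys) i))"
  have f: "map f xs = ys"
    using length_eq xs by (intro nth_equalityI) (auto simp: f_def map_of_zip_nth)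
  have "f ` set xs = {a. 0 < count ?M a}"
    by (simp flip: ys f add: count_map)
  also have "\<dots> \<subseteq> A"
    by (auto simp: count_M)
  finally have "f \<in> set xs \<rightarrow>\<^sub>E A"
    by (auto simp: f_def)
  moreover have "card {i \<in> set xs. f i = a} = m a" if "a \<in> A" for a
    using count_map[of f a] that unfolding f ys count_M by simp
  ultimately show "ys \<in> (\<lambda>f. map f xs) ` ?W"
    using f by (force simp: words_of_type_def)
qed

lemma card_words_of_type:
  assumes finite_I: "finite I" and finite_A: "finite A" and sum_m: "(\<Sum>a\<in>A. m a) = card I"
  shows "card (words_of_type I A m) * (\<Prod>a\<in>A. fact (m a)) = fact (card I)"
proof -
  define M where "M = (\<Sum>a\<in>A. replicate_mset (m a) a)"
  obtain xs where xs: "set xs = I" "distinct xs"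
    using finite_distinct_list[OF finite_I] by blast
  have "card (words_of_type I A m) = card (permutations_of_multiset M)"
    using bij_betw_same_card[OF bij_betw_words_of_type_permutations[OF xs(2) finite_A, of m]]
    by (simp add: M_def sum_m xs(1) flip: distinct_card[OF xs(2)])
  moreover have "(\<Prod>a\<in>A. fact (m a) :: nat) = (\<Prod>a\<in>set_mset M. fact (count M a))"
    using finite_A
    by (intro prod.mono_neutral_cong_right)
      (auto simp: M_def count_sum_replicate_mset set_mset_def split: if_splits intro: Nat.gr0I)
  moreover have "size M = card I"
    using sum_m by (simp add: M_def size_multiset_sum)
  ultimately show ?thesis
    by (simp only: card_permutations_of_multiset_aux)
qed

lemma fact_mult_power_le: "fact m * m ^ j \<le> (fact j * m ^ m :: nat)"
proof (cases "m \<le> j")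
  case True
  then show ?thesis
  proof (induction j rule: dec_induct)
    case (step j)
    have "fact m * m ^ Suc j = m * (fact m * m ^ j)" by simp
    also have "\<dots> \<le> Suc j * (fact j * m ^ m)" by (rule mult_le_mono) (use step in auto)
    finally show ?case by (simp add: algebra_simps)
  qed simp
next
  case False
  then have "j \<le> m" by simp
  then show ?thesis
  proof (induction j rule: inc_induct)
    case (step j)
    have "m * (fact m * m ^ j) = fact m * m ^ Suc j" by simp
    also have "\<dots> \<le> fact (Suc j) * m ^ m" by (rule step.IH)
    also have "\<dots> = Suc j * (fact j * m ^ m)" by (simp add: algebra_simps)
    also have "\<dots> \<le> m * (fact j * m ^ m)" by (rule mult_le_mono) (use step in auto)
    finally show ?case using step by simp
  qed simp
qed

text \<open>Under the distribution with weights \<open>m a / card I\<close>, no type is more likely than \<open>m\<close>.\<close>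

lemma words_of_type_mode:
  assumes finite_I: "finite I" and finite_A: "finite A" and sum_m: "(\<Sum>a\<in>A. m a) = card I"
    and sum_m': "(\<Sum>a\<in>A. m' a) = card I"
  shows "card (words_of_type I A m') * (\<Prod>a\<in>A. m a ^ m' a) \<le>
      card (words_of_type I A m) * (\<Prod>a\<in>A. m a ^ m a)"
proof -
  define F F' :: nat where "F = (\<Prod>a\<in>A. fact (m a))" and "F' = (\<Prod>a\<in>A. fact (m' a))"
  have "F * F' * (card (words_of_type I A m') * (\<Prod>a\<in>A. m a ^ m' a)) =
      fact (card I) * (\<Prod>a\<in>A. fact (m a) * m a ^ m' a)"
    unfolding card_words_of_type[OF finite_I finite_A sum_m', symmetric]
    by (simp add: F_def F'_def prod.distrib mult_ac)
  also have "\<dots> \<le> fact (card I) * (\<Prod>a\<in>A. fact (m' a) * m a ^ m a)"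
    by (intro mult_left_mono prod_mono conjI fact_mult_power_le) auto
  also have "\<dots> = F * F' * (card (words_of_type I A m) * (\<Prod>a\<in>A. m a ^ m a))"
    unfolding card_words_of_type[OF finite_I finite_A sum_m, symmetric]
    by (simp add: F_def F'_def prod.distrib mult_ac)
  finally have "F * F' * (card (words_of_type I A m') * (\<Prod>a\<in>A. m a ^ m' a)) \<le>
      F * F' * (card (words_of_type I A m) * (\<Prod>a\<in>A. m a ^ m a))" .
  moreover have "0 < F * F'"
    by (auto simp: F_def F'_def intro!: prod_pos)
  ultimately show ?thesis by (rule mult_left_le_imp_le)
qed

lemma card_power_card_le_words_of_type:
  assumes finite_I: "finite I" and finite_A: "finite A" and sum_m: "(\<Sum>a\<in>A. m a) = card I"
  shows "card I ^ card I \<le> Suc (card I) ^ card A * (card (words_of_type I A m) * (\<Prod>a\<in>A. m a ^ m a))"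
proof -
  let ?type = "\<lambda>f. \<lambda>a\<in>A. card {i \<in> I. f i = a}"
  let ?types = "A \<rightarrow>\<^sub>E {..card I}"
  have type_in_types: "?type ` (I \<rightarrow>\<^sub>E A) \<subseteq> ?types"
    using finite_I by (auto intro!: card_mono)
  have fiber: "{f \<in> I \<rightarrow>\<^sub>E A. ?type f = m'} = words_of_type I A m'" if "m' \<in> ?types" for m'
    using that by (auto simp: words_of_type_def fun_eq_iff PiE_iff extensional_def)
  have "card I ^ card I = (\<Prod>i\<in>I. \<Sum>a\<in>A. m a)"
    by (simp add: sum_m)
  also have "\<dots> = (\<Sum>f\<in>I \<rightarrow>\<^sub>E A. \<Prod>i\<in>I. m (f i))"
    using finite_I finite_A by (rule prod_sum_PiE)
  also have "\<dots> = (\<Sum>m'\<in>?types. \<Sum>f | f \<in> I \<rightarrow>\<^sub>E A \<and> ?type f = m'. \<Prod>i\<in>I. m (f i))"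
    using finite_I finite_A by (intro sum.group[symmetric] type_in_types) (auto intro: finite_PiE)
  also have "\<dots> = (\<Sum>m'\<in>?types. card (words_of_type I A m') * (\<Prod>a\<in>A. m a ^ m' a))"
    by (intro sum.cong refl) (simp add: fiber prod_words_of_type[OF finite_I finite_A])
  also have "\<dots> \<le> (\<Sum>m'\<in>?types. card (words_of_type I A m) * (\<Prod>a\<in>A. m a ^ m a))"
  proof (rule sum_mono)
    fix m'
    show "card (words_of_type I A m') * (\<Prod>a\<in>A. m a ^ m' a) \<le>
        card (words_of_type I A m) * (\<Prod>a\<in>A. m a ^ m a)"
    proof (cases "words_of_type I A m' = {}")
      case False
      then obtain f where "f \<in> words_of_type I A m'" by blast
      from sum_words_of_type[OF finite_I finite_A this, of "\<lambda>_. 1 :: nat"]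
      show ?thesis by (intro words_of_type_mode finite_I finite_A sum_m) simp
    qed simp
  qed
  finally show ?thesis
    using finite_A by (simp add: card_PiE)
qed

lemma sets_words_of_type:
  assumes "finite I" "finite A" "\<And>a. a \<in> A \<Longrightarrow> {a} \<in> sets \<mu>"
  shows "words_of_type I A m \<in> sets (iid \<mu> I)"
    and "f \<in> words_of_type I A m \<Longrightarrow> {f} \<in> sets (iid \<mu> I)"
proof -
  have "{f} \<in> sets (iid \<mu> I)" if "f \<in> I \<rightarrow>\<^sub>E A" for f
  proof -
    have "{f} = (\<Pi>\<^sub>E i\<in>I. {f i})"
      using that by (intro PiE_singleton[symmetric]) (simp add: PiE_def)
    then show ?thesis
      using assms that by (simp only:) (intro sets_PiM_I_finite, auto)
  qed
  then show singleton: "f \<in> words_of_type I A m \<Longrightarrow> {f} \<in> sets (iid \<mu> I)" for f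
    by (simp add: words_of_type_def)
  have "(\<Union>f\<in>words_of_type I A m. {f}) \<in> sets (iid \<mu> I)"
    using finite_words_of_type[OF assms(1,2)] singleton by (intro sets.finite_UN) auto
  then show "words_of_type I A m \<in> sets (iid \<mu> I)" by simp
qed

lemma measure_words_of_type:
  assumes prob_space_\<mu>: "prob_space \<mu>" and finite_I: "finite I" and finite_A: "finite A"
    and sets_singleton: "\<And>a. a \<in> A \<Longrightarrow> {a} \<in> sets \<mu>"
  shows "measure (iid \<mu> I) (words_of_type I A m) =
      card (words_of_type I A m) * (\<Prod>a\<in>A. measure \<mu> {a} ^ m a)"
proof -
  interpret \<mu>: prob_space \<mu> by (rule prob_space_\<mu>)
  interpret P: product_prob_space "\<lambda>_. \<mu>" I
    by (rule product_prob_spaceI) (rule prob_space_\<mu>)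
  have measure_word: "measure (iid \<mu> I) {f} = (\<Prod>a\<in>A. measure \<mu> {a} ^ m a)"
    if f_in_words: "f \<in> words_of_type I A m" for f
  proof -
    have "{f} = (\<Pi>\<^sub>E i\<in>I. {f i})"
      using f_in_words by (intro PiE_singleton[symmetric]) (simp add: words_of_type_def PiE_def)
    then have "emeasure (iid \<mu> I) {f} = (\<Prod>i\<in>I. emeasure \<mu> {f i})"
      using f_in_words sets_singleton
      by (simp only:) (subst P.emeasure_PiM[OF finite_I], auto simp: words_of_type_def)
    then have "measure (iid \<mu> I) {f} = (\<Prod>i\<in>I. measure \<mu> {f i})"
      by (simp add: P.emeasure_eq_measure \<mu>.emeasure_eq_measure prod_ennreal prod_nonneg)
    also have "\<dots> = (\<Prod>a\<in>A. measure \<mu> {a} ^ m a)"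
      using prod_words_of_type[OF finite_I finite_A f_in_words, of "\<lambda>a. measure \<mu> {a}"] .
    finally show ?thesis .
  qed
  have "measure (iid \<mu> I) (words_of_type I A m) = (\<Sum>f\<in>words_of_type I A m. measure (iid \<mu> I) {f})"
    using finite_I finite_A
    by (intro P.finite_measure_eq_sum_singleton finite_words_of_type sets_words_of_type(2)
      sets_singleton)
  then show ?thesis by (simp add: measure_word)
qed

lemma measure_words_of_type_ge:
  fixes q :: "'a \<Rightarrow> real"
  assumes prob_space_\<mu>: "prob_space \<mu>" and finite_I: "finite I" and finite_A: "finite A"
    and sets_singleton: "\<And>a. a \<in> A \<Longrightarrow> {a} \<in> sets \<mu>"
    and letter_prob: "\<And>a. a \<in> A \<Longrightarrow> measure \<mu> {a} = q a \<and> 0 < q a" and sum_m: "(\<Sum>a\<in>A. m a) = card I"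
  shows "exp (- (\<Sum>a\<in>A. m a * ln (m a / (card I * q a)))) / real (Suc (card I)) ^ card A
    \<le> measure (iid \<mu> I) (words_of_type I A m)"
proof -
  define n where "n = real (card I)"
  define D where "D = (\<Sum>a\<in>A. m a * ln (m a / (n * q a)))"
  define W where "W = (\<Prod>a\<in>A. real (m a) ^ m a)"
  have "0 < real j ^ j" for j
    by (cases j) simp_all
  then have W_pos: "0 < W"
    unfolding W_def by (intro prod_pos)
  have letter_weight: "real (m a) ^ m a = exp (m a * ln (m a / (n * q a))) * (n * q a) ^ m a"
    if a_in_A: "a \<in> A" for a
  proof (cases "m a = 0")
    case False
    have "m a \<le> card I" using member_le_sum[OF a_in_A, of m] finite_A sum_m by simp
    then have "0 < n" "0 < q a" using False letter_prob[OF a_in_A] by (simp_all add: n_def)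
    then show ?thesis
      using False by (simp add: exp_of_nat_mult power_divide power_mult_distrib)
  qed simp
  have "W = (\<Prod>a\<in>A. exp (m a * ln (m a / (n * q a))) * (n * q a) ^ m a)"
    unfolding W_def by (intro prod.cong letter_weight refl)
  also have "\<dots> = exp D * (n ^ card I * (\<Prod>a\<in>A. q a ^ m a))"
    using finite_A
    by (simp add: D_def exp_sum prod.distrib power_mult_distrib power_sum flip: sum_m)
  finally have weights: "exp (- D) * W = n ^ card I * (\<Prod>a\<in>A. q a ^ m a)"
    by (simp add: exp_minus)
  have "n ^ card I \<le> real (Suc (card I)) ^ card A * (real (card (words_of_type I A m)) * W)"
    using card_power_card_le_words_of_type[OF finite_I finite_A sum_m] unfolding n_def W_def
    by (simp flip: of_nat_power of_nat_mult of_nat_prod del: of_nat_Suc)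
  then have "n ^ card I * (\<Prod>a\<in>A. q a ^ m a) \<le>
      real (Suc (card I)) ^ card A * (real (card (words_of_type I A m)) * W) * (\<Prod>a\<in>A. q a ^ m a)"
    using letter_prob by (intro mult_right_mono prod_nonneg) (auto intro: less_imp_le)
  also have "\<dots> = real (Suc (card I)) ^ card A * measure (iid \<mu> I) (words_of_type I A m) * W"
    using letter_prob
    by (simp add: measure_words_of_type[OF prob_space_\<mu> finite_I finite_A sets_singleton] mult_ac)
  finally have "exp (- D) \<le> real (Suc (card I)) ^ card A * measure (iid \<mu> I) (words_of_type I A m)"
    unfolding weights[symmetric] using W_pos by simp
  then show ?thesis
    by (simp add: D_def n_def divide_le_eq mult.commute)
qed

lemma sum_mult_le_if_mass_moved:
  fixes t m g :: "'a \<Rightarrow> real"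
  assumes "(\<Sum>a\<in>A. m a) = (\<Sum>a\<in>A. t a)" "\<And>a. a \<in> A - {b} \<Longrightarrow> t a \<le> m a" "\<And>a. a \<in> A \<Longrightarrow> g b \<le> g a"
  shows "(\<Sum>a\<in>A. t a * g a) \<le> (\<Sum>a\<in>A. m a * g a)"
proof -
  have "0 \<le> (m a - t a) * (g a - g b)" if "a \<in> A" for a
    using that assms(2,3)[of a] by (cases "a = b") auto
  then have "0 \<le> (\<Sum>a\<in>A. (m a - t a) * (g a - g b))"
    by (intro sum_nonneg)
  also have "\<dots> = (\<Sum>a\<in>A. m a * g a) - (\<Sum>a\<in>A. t a * g a) - ((\<Sum>a\<in>A. m a) - (\<Sum>a\<in>A. t a)) * g b"
    by (simp add: algebra_simps sum.distrib sum_subtractf sum_distrib_left)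
  finally show ?thesis by (simp add: assms(1))
qed

lemma sum_nat_ceiling_bounds:
  fixes t :: "'a \<Rightarrow> real"
  assumes "\<And>a. a \<in> B \<Longrightarrow> 0 \<le> t a"
  shows "(\<Sum>a\<in>B. t a) \<le> (\<Sum>a\<in>B. real (nat \<lceil>t a\<rceil>))"
    and "(\<Sum>a\<in>B. real (nat \<lceil>t a\<rceil>)) \<le> (\<Sum>a\<in>B. t a) + card B"
proof -
  have bounds: "t a \<le> nat \<lceil>t a\<rceil>" "nat \<lceil>t a\<rceil> \<le> t a + 1" if "a \<in> B" for a
    using assms[OF that] by linarith+
  show "(\<Sum>a\<in>B. t a) \<le> (\<Sum>a\<in>B. real (nat \<lceil>t a\<rceil>))"
    by (intro sum_mono bounds)
  have "(\<Sum>a\<in>B. real (nat \<lceil>t a\<rceil>)) \<le> (\<Sum>a\<in>B. t a + 1)"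
    by (intro sum_mono bounds)
  then show "(\<Sum>a\<in>B. real (nat \<lceil>t a\<rceil>)) \<le> (\<Sum>a\<in>B. t a) + card B"
    by (simp add: sum.distrib)
qed

lemma rounding_with_fixed_sum:
  fixes t :: "'a \<Rightarrow> real"
  assumes finite_mem: "finite A" "a0 \<in> A"
    and t_total: "\<And>a. a \<in> A \<Longrightarrow> 0 \<le> t a" "real (card A) \<le> t a0" "(\<Sum>a\<in>A. t a) = real n"
  obtains m :: "'a \<Rightarrow> nat" where "(\<Sum>a\<in>A. m a) = n" "\<And>a. a \<in> A \<Longrightarrow> \<bar>m a - t a\<bar> \<le> card A"
    "\<And>g :: 'a \<Rightarrow> real. (\<And>a. a \<in> A \<Longrightarrow> g a0 \<le> g a) \<Longrightarrow> (\<Sum>a\<in>A. t a * g a) \<le> (\<Sum>a\<in>A. m a * g a)"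
proof -
  define B where "B = A - {a0}"
  have A_split: "(\<Sum>a\<in>A. f a) = f a0 + (\<Sum>a\<in>B. f a)" for f :: "'a \<Rightarrow> real"
    using finite_mem by (simp_all add: B_def sum.remove)
  define up where "up a = nat \<lceil>t a\<rceil>" for a
  have up_bounds: "t a \<le> up a" "up a \<le> t a + 1" if "a \<in> B" for a
    using that t_total(1)[of a] by (auto simp: up_def B_def)
  have "card B \<le> card A" using finite_mem by (simp add: B_def card_mono)
  then have up_sum: "(\<Sum>a\<in>B. t a) \<le> (\<Sum>a\<in>B. real (up a))" "(\<Sum>a\<in>B. real (up a)) \<le> (\<Sum>a\<in>B. t a) + card A"
    using sum_nat_ceiling_bounds[of B t] t_total(1) by (auto simp: up_def B_def)
  have sum_split: "real n = t a0 + (\<Sum>a\<in>B. t a)"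
    using t_total(3) A_split[of t] by simp
  then have sum_up_le: "(\<Sum>a\<in>B. up a) \<le> n"
    using up_sum(2) t_total(2) by (simp flip: of_nat_sum of_nat_le_iff)
  define m where "m a = (if a = a0 then n - (\<Sum>a\<in>B. up a) else up a)" for a
  have m_B: "m a = up a" if "a \<in> B" for a
    using that by (auto simp: m_def B_def)
  have m_a0: "real (m a0) = real n - (\<Sum>a\<in>B. real (up a))"
    using sum_up_le by (simp add: m_def of_nat_diff)
  have m_sum: "(\<Sum>a\<in>A. real (m a)) = real n"
    using m_B m_a0 by (simp add: A_split)
  show ?thesis
  proof
    show "(\<Sum>a\<in>A. m a) = n"
      using m_sum by (simp flip: of_nat_sum)
    show "\<bar>m a - t a\<bar> \<le> card A" if "a \<in> A" for a
    proof (cases "a = a0")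
      case True
      then show ?thesis using m_a0 sum_split up_sum by simp
    next
      case False
      then have "a \<in> B" using that by (simp add: B_def)
      moreover have "1 \<le> real (card A)" using finite_mem
        by (simp add: Suc_le_eq card_gt_0_iff) blast
      ultimately show ?thesis using up_bounds[of a] by (simp add: m_B)
    qed
    show "(\<Sum>a\<in>A. t a * g a) \<le> (\<Sum>a\<in>A. m a * g a)" if "\<And>a. a \<in> A \<Longrightarrow> g a0 \<le> g a" for g :: "'a \<Rightarrow> real"
      using m_sum t_total(3) up_bounds m_B that
      by (intro sum_mult_le_if_mass_moved[where b = a0]) (auto simp: B_def)
  qed
qed

lemma ln_one_plus_le_cubic:
  fixes x :: real
  assumes "-1 < x"
  shows "ln (1 + x) \<le> x - x\<^sup>2 / 2 + x ^ 3 / 3"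
proof -
  define f where "f = (\<lambda>x::real. x - x\<^sup>2 / 2 + x ^ 3 / 3 - ln (1 + x))"
  have deriv_f: "(f has_real_derivative (y ^ 3 / (1 + y))) (at y)" if "-1 < y" for y
    unfolding f_def using that
    by (auto intro!: derivative_eq_intros simp: field_simps power2_eq_square power3_eq_cube)
  have "f 0 \<le> f x"
  proof (cases "0 \<le> x")
    case True
    show ?thesis
    proof (rule DERIV_nonneg_imp_nondecreasing[OF True])
      fix y assume "0 \<le> y" "y \<le> x"
      then show "\<exists>D. (f has_real_derivative D) (at y) \<and> 0 \<le> D"
        using deriv_f[of y] by (intro exI[of _ "y ^ 3 / (1 + y)"]) auto
    qed
  next
    case False
    show ?thesis
    proof (rule DERIV_nonpos_imp_nonincreasing[of x 0 f])
      fix y assume "x \<le> y" "y \<le> 0"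
      then show "\<exists>D. (f has_real_derivative D) (at y) \<and> D \<le> 0"
        using deriv_f[of y] assms
        by (intro exI[of _ "y ^ 3 / (1 + y)"])
          (auto intro!: divide_nonpos_pos simp: power_le_zero_eq)
    qed (use False in simp)
  qed
  then show ?thesis by (simp add: f_def)
qed

lemma mult_ln_one_plus_le:
  fixes x :: real
  assumes "-1 < x" "x \<le> 1"
  shows "(1 + x) * ln (1 + x) \<le> x + x\<^sup>2 / 2 + \<bar>x\<bar> ^ 3"
proof -
  have "(1 + x) * ln (1 + x) \<le> (1 + x) * (x - x\<^sup>2 / 2 + x ^ 3 / 3)"
    using assms by (intro mult_left_mono ln_one_plus_le_cubic) auto
  also have "\<dots> = x + x\<^sup>2 / 2 + (- (x ^ 3) / 6 + x * x ^ 3 / 3)"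
    by (simp add: field_simps power2_eq_square power3_eq_cube)
  also have "- (x ^ 3) / 6 + x * x ^ 3 / 3 \<le> \<bar>x\<bar> ^ 3"
  proof -
    have minus_cube_le: "- (x ^ 3) \<le> \<bar>x\<bar> ^ 3" by (metis abs_ge_minus_self power_abs)
    have "x * x ^ 3 \<le> \<bar>x\<bar> * \<bar>x\<bar> ^ 3" by (metis abs_ge_self abs_mult power_abs)
    also have "\<dots> \<le> 1 * \<bar>x\<bar> ^ 3" by (rule mult_right_mono) (use assms in auto)
    finally have "x * x ^ 3 \<le> \<bar>x\<bar> ^ 3" by simp
    moreover have "0 \<le> \<bar>x\<bar> ^ 3" by simp
    ultimately show ?thesis using minus_cube_le by linarith
  qed
  finally show ?thesis by simp
qed

text \<open>The contribution of one letter to the relative entropy of a type: the letter has mean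
  frequency \<open>w\<close>, tilted by the factor \<open>1 + y\<close> and rounded by at most \<open>C\<close>.\<close>

lemma tilted_entropy_le:
  fixes w y C \<tau> m :: real
  assumes w_pos: "0 < w" and rounding: "\<bar>m - w * (1 + y)\<bar> \<le> C"
    and \<tau>_bounds: "\<bar>y\<bar> + C / w \<le> \<tau>" "\<tau> \<le> 1 / 2"
  shows "m * ln (m / w) \<le> (m - w) + w * y\<^sup>2 / 2 + C + w * \<tau> ^ 3"
proof -
  define c where "c = m - w * (1 + y)"
  define x where "x = y + c / w"
  have abs_c_le: "\<bar>c\<bar> \<le> C" using rounding by (simp add: c_def)
  have m_eq: "m = w * (1 + x)" using w_pos by (simp add: x_def c_def field_simps)
  have abs_quotient_le: "\<bar>c / w\<bar> \<le> C / w" using abs_c_le w_pos by (simp add: divide_right_mono)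
  then have abs_x_le: "\<bar>x\<bar> \<le> \<tau>" using \<tau>_bounds(1) unfolding x_def by linarith
  have small: "\<bar>y\<bar> \<le> 1 / 2" "\<bar>c / w\<bar> \<le> 1 / 2" using \<tau>_bounds abs_quotient_le by linarith+
  have "\<bar>y * c\<bar> \<le> 1 / 2 * C" "\<bar>c * (c / w)\<bar> \<le> C * (1 / 2)"
    unfolding abs_mult using small abs_c_le by (intro mult_mono; linarith)+
  moreover have "w * x\<^sup>2 = w * y\<^sup>2 + 2 * (y * c) + c * (c / w)"
    using w_pos by (simp add: x_def power2_eq_square field_simps)
  ultimately have square_le: "w * x\<^sup>2 / 2 \<le> w * y\<^sup>2 / 2 + C"
    using abs_c_le by linarith
  have cube_le: "w * \<bar>x\<bar> ^ 3 \<le> w * \<tau> ^ 3" using w_pos abs_x_le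
    by (intro mult_left_mono power_mono) auto
  have "m * ln (m / w) = w * ((1 + x) * ln (1 + x))"
    using w_pos by (simp add: m_eq)
  also have "\<dots> \<le> w * (x + x\<^sup>2 / 2 + \<bar>x\<bar> ^ 3)"
    using w_pos abs_x_le \<tau>_bounds(2) by (intro mult_left_mono mult_ln_one_plus_le) auto
  also have "\<dots> = (m - w) + w * x\<^sup>2 / 2 + w * \<bar>x\<bar> ^ 3"
    by (simp add: m_eq algebra_simps)
  finally show ?thesis using square_le cube_le by linarith
qed

lemma tilted_relative_entropy_le:
  fixes q y :: "'a \<Rightarrow> real" and m :: "'a \<Rightarrow> nat" and \<nu> C \<tau> :: real
  assumes weights: "\<And>a. a \<in> A \<Longrightarrow> 0 < q a" "(\<Sum>a\<in>A. q a) = 1"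
    and \<nu>_pos: "0 < \<nu>"
    and rounding: "(\<Sum>a\<in>A. real (m a)) = \<nu>" "\<And>a. a \<in> A \<Longrightarrow> \<bar>m a - \<nu> * q a * (1 + y a)\<bar> \<le> C"
    and \<tau>_bounds: "\<And>a. a \<in> A \<Longrightarrow> \<bar>y a\<bar> + C / (\<nu> * q a) \<le> \<tau>" "\<tau> \<le> 1 / 2"
  shows "(\<Sum>a\<in>A. m a * ln (m a / (\<nu> * q a))) \<le>
      \<nu> * (\<Sum>a\<in>A. q a * (y a)\<^sup>2) / 2 + card A * C + \<nu> * \<tau> ^ 3"
proof -
  have "(\<Sum>a\<in>A. m a * ln (m a / (\<nu> * q a))) \<le>
      (\<Sum>a\<in>A. (m a - \<nu> * q a) + \<nu> * q a * (y a)\<^sup>2 / 2 + C + \<nu> * q a * \<tau> ^ 3)"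
    using weights(1) \<nu>_pos rounding(2) \<tau>_bounds by (intro sum_mono tilted_entropy_le) auto
  also have "\<dots> = ((\<Sum>a\<in>A. real (m a)) - \<nu> * (\<Sum>a\<in>A. q a)) + \<nu> * (\<Sum>a\<in>A. q a * (y a)\<^sup>2) / 2 +
      card A * C +
      \<nu> * (\<Sum>a\<in>A. q a) * \<tau> ^ 3"
    by (simp add: sum.distrib sum_subtractf sum_distrib_left sum_distrib_right sum_divide_distrib
      mult_ac)
  finally show ?thesis by (simp add: rounding(1) weights(2))
qed

section \<open>Joint tails of a source\<close>

definition joint_tail_event :: "real \<Rightarrow> real \<Rightarrow> real \<Rightarrow> 'i set \<Rightarrow> ('i \<Rightarrow> real \<times> real) \<Rightarrow> bool" where
  "joint_tail_event s u M I \<omega> \<longleftrightarrow> s \<le> (\<Sum>i\<in>I. fst (\<omega> i)) \<and> u \<le> (\<Sum>i\<in>I. snd (\<omega> i)) \<and>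
     (\<forall>i\<in>I. \<bar>fst (\<omega> i)\<bar> \<le> M \<and> \<bar>snd (\<omega> i)\<bar> \<le> M)"

text \<open>A sum of variance \<open>n\<close> passes the threshold with probability about \<open>exp (- H)\<close>.\<close>

definition tail_threshold :: "real \<Rightarrow> nat \<Rightarrow> real" where
  "tail_threshold H n = sqrt (2 * H * real n)"

abbreviation truncation :: "nat \<Rightarrow> real" where
  "truncation n \<equiv> sqrt (sqrt (real n))"

definition joint_tail_prob :: "(real \<times> real) measure \<Rightarrow> real \<Rightarrow> real \<Rightarrow> 'i set \<Rightarrow> real" where
  "joint_tail_prob \<mu> \<phi> H I = \<P>(\<omega> in iid \<mu> I. joint_tail_event
     (tail_threshold H (card I)) (\<phi> * tail_threshold H (card I)) (truncation (card I)) I \<omega>)"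

definition joint_tail_bound :: "(real \<times> real) measure \<Rightarrow> real \<Rightarrow> real \<Rightarrow> nat \<Rightarrow> nat \<Rightarrow> nat \<Rightarrow> bool" where
  "joint_tail_bound \<mu> \<delta> \<phi> B b e \<longleftrightarrow> 0 < B \<and> 0 < b \<and>
     (\<forall>H\<ge>1. \<forall>I :: nat set. finite I \<longrightarrow> real B * H ^ 6 \<le> real (card I) \<longrightarrow>
       exp (- ((1 + \<delta>\<^sup>2) * H)) / (real b * real (card I) ^ e) \<le> joint_tail_prob \<mu> \<phi> H I)"

lemma borel_measurable_fst_snd:
  assumes "sets \<mu> = sets (borel :: (real \<times> real) measure)"
  shows "fst \<in> borel_measurable \<mu>" "snd \<in> borel_measurable \<mu>"
  unfolding measurable_cong_sets[OF assms refl]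
  by (auto intro!: borel_measurable_continuous_onI continuous_on_fst continuous_on_snd
    continuous_on_id)

lemma borel_measurable_iid_fst_snd:
  assumes "sets \<mu> = sets (borel :: (real \<times> real) measure)" "i \<in> I"
  shows "(\<lambda>\<omega>. fst (\<omega> i)) \<in> borel_measurable (iid \<mu> I)"
    and "(\<lambda>\<omega>. snd (\<omega> i)) \<in> borel_measurable (iid \<mu> I)"
  by (rule measurable_compose[OF measurable_component_singleton[OF assms(2)]],
      rule borel_measurable_fst_snd[OF assms(1)])+

lemma borel_measurable_iid_sum_fst_snd:
  assumes "sets \<mu> = sets (borel :: (real \<times> real) measure)" "J \<subseteq> I"
  shows "(\<lambda>\<omega>. \<Sum>i\<in>J. fst (\<omega> i)) \<in> borel_measurable (iid \<mu> I)"
    and "(\<lambda>\<omega>. \<Sum>i\<in>J. snd (\<omega> i)) \<in> borel_measurable (iid \<mu> I)"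
  using borel_measurable_iid_fst_snd[OF assms(1) subsetD[OF assms(2)]]
  by (auto intro: borel_measurable_sum)

lemma sets_joint_tail_event:
  assumes "sets \<mu> = sets (borel :: (real \<times> real) measure)" "finite J" "J \<subseteq> I"
  shows "{\<omega> \<in> space (iid \<mu> I). joint_tail_event s u M J \<omega>} \<in> sets (iid \<mu> I)"
proof -
  note [measurable] = borel_measurable_iid_fst_snd[OF assms(1) subsetD[OF assms(3)]]
  show ?thesis
    unfolding joint_tail_event_def using assms(2) by measurable
qed

lemma joint_tail_boundI:
  fixes c B :: real
  assumes "0 < c"
    and tail_prob_ge: "\<And>H (I :: nat set). 1 \<le> H \<Longrightarrow> finite I \<Longrightarrow> I \<noteq> {} \<Longrightarrow> B * H ^ 6 \<le> real (card I) \<Longrightarrow>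
      exp (- ((1 + \<delta>\<^sup>2) * H)) / (c * real (card I) ^ e) \<le> joint_tail_prob \<mu> \<phi> H I"
  shows "\<exists>B b. joint_tail_bound \<mu> \<delta> \<phi> B b e"
proof -
  define B' where "B' = nat \<lceil>B\<rceil> + 1"
  define b where "b = nat \<lceil>c\<rceil>"
  have B'_bounds: "0 < B'" "B \<le> real B'" unfolding B'_def by linarith+
  have b_bounds: "c \<le> real b" "0 < b" using \<open>0 < c\<close> unfolding b_def by linarith+
  have "exp (- ((1 + \<delta>\<^sup>2) * H)) / (real b * real (card I) ^ e) \<le> joint_tail_prob \<mu> \<phi> H I"
    if H_ge_1: "1 \<le> H" and card_large: "finite I" "real B' * H ^ 6 \<le> real (card I)"
      for H and I :: "nat set"
  proof -
    have "0 < real B' * H ^ 6"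
      using H_ge_1 B'_bounds by simp
    then have card_pos: "0 < real (card I)"
      using card_large(2) by linarith
    have "B * H ^ 6 \<le> real B' * H ^ 6"
      using B'_bounds H_ge_1 by (intro mult_right_mono) auto
    then have "exp (- ((1 + \<delta>\<^sup>2) * H)) / (c * real (card I) ^ e) \<le> joint_tail_prob \<mu> \<phi> H I"
      using card_pos card_large by (intro tail_prob_ge H_ge_1) auto
    moreover have "exp (- ((1 + \<delta>\<^sup>2) * H)) / (real b * real (card I) ^ e) \<le>
        exp (- ((1 + \<delta>\<^sup>2) * H)) / (c * real (card I) ^ e)"
      using b_bounds card_pos \<open>0 < c\<close> by (intro divide_left_mono mult_right_mono mult_pos_pos) auto
    ultimately show ?thesis by linarith
  qed
  then show ?thesis
    using B'_bounds b_bounds unfolding joint_tail_bound_def by blast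
qed

section \<open>The binary source\<close>

lemma pmf_of_signs:
  shows "subgaussian (measure_pmf (pmf_of_set {-1, 1 :: real})) (\<lambda>x. x)"
    and "measure (measure_pmf (pmf_of_set {-1, 1 :: real})) {0..} = 1 / 2"
proof -
  let ?U = "pmf_of_set {-1, 1 :: real}"
  interpret interval_bounded_random_variable "measure_pmf ?U" "\<lambda>x. x" "-1" 1
    by unfold_locales (auto simp: AE_measure_pmf_iff)
  show "subgaussian (measure_pmf ?U) (\<lambda>x. x)"
    by (rule subgaussian_if_mean_zero) (simp_all add: integral_pmf_of_set)
  show "measure (measure_pmf ?U) {0..} = 1 / 2"
    by (subst measure_pmf_of_set) auto
qed

lemma DSBS_marginals:
  assumes \<rho>_bounds: "-1 \<le> \<rho>" "\<rho> \<le> 1"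
  shows "subgaussian (DSBS \<rho>) fst" "subgaussian (DSBS \<rho>) snd" "\<P>(x in DSBS \<rho>. 0 \<le> fst x) = 1 / 2"
proof -
  note DSBS = DSBS_source[OF \<rho>_bounds]
  note meas = borel_measurable_fst_snd[OF DSBS(2)]
  let ?U = "measure_pmf (pmf_of_set {-1, 1 :: real})"
  have uniform: "subgaussian (distr ?U borel id) (\<lambda>x. x)"
    using pmf_of_signs(1) by (simp add: subgaussian_distr_iff)
  show "subgaussian (DSBS \<rho>) fst" "subgaussian (DSBS \<rho>) snd"
    using uniform DSBS(3,4)
      subgaussian_distr_iff[OF meas(1), of "\<lambda>x. x"] subgaussian_distr_iff[OF meas(2), of "\<lambda>x. x"]
    by simp_all
  have "\<P>(x in DSBS \<rho>. 0 \<le> fst x) = measure (distr (DSBS \<rho>) borel fst) {0..}"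
    by (subst measure_distr[OF meas(1)]) (auto intro!: arg_cong[of _ _ "measure (DSBS \<rho>)"])
  then show "\<P>(x in DSBS \<rho>. 0 \<le> fst x) = 1 / 2"
    using pmf_of_signs(2) by (simp add: DSBS(3) measure_distr)
qed

definition sign_pairs :: "(real \<times> real) set" where
  "sign_pairs = {-1, 1} \<times> {-1, 1}"

lemma finite_sign_pairs [simp]: "finite sign_pairs"
  and card_sign_pairs [simp]: "card sign_pairs = 4"
  by (simp_all add: sign_pairs_def card_cartesian_product)

lemma sum_sign_pairs: "(\<Sum>a\<in>sign_pairs. f a) = f (1, 1) + f (1, -1) + f (-1, 1) + f (-1, -1)"
  for f :: "real \<times> real \<Rightarrow> real"
  by (simp add: sign_pairs_def flip: sum.cartesian_product')

definition DSBS_weight :: "real \<Rightarrow> real \<times> real \<Rightarrow> real" where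
  "DSBS_weight \<rho> a = (1 + \<rho> * fst a * snd a) / 4"

lemma measure_DSBS_singleton:
  assumes \<rho>_bounds: "-1 \<le> \<rho>" "\<rho> \<le> 1" and a_in_sign_pairs: "a \<in> sign_pairs"
  shows "measure (DSBS \<rho>) {a} = DSBS_weight \<rho> a"
proof -
  define h where "h = (\<lambda>(x::real, b). (x, if b then x else - x))"
  define Q where "Q = pair_pmf (pmf_of_set {-1, 1 :: real}) (bernoulli_pmf ((1 + \<rho>) / 2))"
  have "measure (DSBS \<rho>) {a} = measure (measure_pmf Q) (h -` {a})"
    unfolding DSBS_def Q_def h_def by (subst measure_distr) auto
  also have "h -` {a} = {(fst a, snd a = fst a)}"
    using a_in_sign_pairs by (auto simp: sign_pairs_def h_def split: if_splits)
  also have "measure (measure_pmf Q) {(fst a, snd a = fst a)} = DSBS_weight \<rho> a"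
    using a_in_sign_pairs \<rho>_bounds
    by (auto simp: sign_pairs_def measure_pmf_single Q_def pmf_pair DSBS_weight_def field_simps)
  finally show ?thesis .
qed

lemma DSBS_weight_moments:
  shows "(\<Sum>a\<in>sign_pairs. DSBS_weight \<rho> a) = 1"
    and "(\<Sum>a\<in>sign_pairs. DSBS_weight \<rho> a * (1 + (\<alpha> * fst a + \<beta> * snd a))) = 1"
    and "(\<Sum>a\<in>sign_pairs. DSBS_weight \<rho> a * (1 + (\<alpha> * fst a + \<beta> * snd a)) * fst a) = \<alpha> + \<rho> * \<beta>"
    and "(\<Sum>a\<in>sign_pairs. DSBS_weight \<rho> a * (1 + (\<alpha> * fst a + \<beta> * snd a)) * snd a) = \<rho> * \<alpha> + \<beta>"
    and "(\<Sum>a\<in>sign_pairs. DSBS_weight \<rho> a * (\<alpha> * fst a + \<beta> * snd a)\<^sup>2) = \<alpha>\<^sup>2 + 2 * \<rho> * \<alpha> * \<beta> + \<beta>\<^sup>2"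
  unfolding sum_sign_pairs DSBS_weight_def by (simp_all add: power2_eq_square field_simps)

lemma DSBS_type_prob_ge:
  fixes I :: "'i set" and m :: "real \<times> real \<Rightarrow> nat"
  assumes \<rho>_bounds: "-1 < \<rho>" "\<rho> < 1" and finite_I: "finite I"
    and sum_m: "(\<Sum>a\<in>sign_pairs. m a) = card I"
    and s_le: "s \<le> (\<Sum>a\<in>sign_pairs. m a * fst a)" and u_le: "u \<le> (\<Sum>a\<in>sign_pairs. m a * snd a)"
    and M_ge_1: "1 \<le> M"
  shows "exp (- (\<Sum>a\<in>sign_pairs. m a * ln (m a / (card I * DSBS_weight \<rho> a)))) /
      real (Suc (card I)) ^ 4 \<le>
    \<P>(\<omega> in iid (DSBS \<rho>) I. joint_tail_event s u M I \<omega>)"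
proof -
  have \<rho>_weak_bounds: "-1 \<le> \<rho>" "\<rho> \<le> 1" using \<rho>_bounds by simp_all
  note DSBS = DSBS_source(1,2)[OF \<rho>_weak_bounds]
  interpret P: prob_space "iid (DSBS \<rho>) I" by (rule prob_space_iid[OF DSBS(1)])
  have weight: "measure (DSBS \<rho>) {a} = DSBS_weight \<rho> a \<and> 0 < DSBS_weight \<rho> a"
    if "a \<in> sign_pairs" for a
    using that \<rho>_bounds measure_DSBS_singleton[OF \<rho>_weak_bounds that]
    by (auto simp: sign_pairs_def DSBS_weight_def)
  have "exp (- (\<Sum>a\<in>sign_pairs. m a * ln (m a / (card I * DSBS_weight \<rho> a)))) /
      real (Suc (card I)) ^ 4 \<le>
      measure (iid (DSBS \<rho>) I) (words_of_type I sign_pairs m)"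
    using measure_words_of_type_ge[OF DSBS(1) finite_I _ _ weight sum_m] by (simp add: DSBS(2))
  also have "\<dots> \<le> \<P>(\<omega> in iid (DSBS \<rho>) I. joint_tail_event s u M I \<omega>)"
  proof (rule P.finite_measure_mono[OF subsetI sets_joint_tail_event[OF DSBS(2) finite_I
    subset_refl]])
    fix \<omega> assume word_of_type: "\<omega> \<in> words_of_type I sign_pairs m"
    have "s \<le> (\<Sum>i\<in>I. fst (\<omega> i))" "u \<le> (\<Sum>i\<in>I. snd (\<omega> i))"
      using s_le u_le sum_words_of_type[OF finite_I _ word_of_type, of fst]
        sum_words_of_type[OF finite_I _ word_of_type, of snd] by simp_all
    moreover have "\<omega> \<in> I \<rightarrow>\<^sub>E sign_pairs"
      using word_of_type by (simp add: words_of_type_def)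
    then have "\<bar>fst (\<omega> i)\<bar> = 1" "\<bar>snd (\<omega> i)\<bar> = 1" if "i \<in> I" for i
      using that by (force simp: sign_pairs_def PiE_iff)+
    moreover have "\<omega> \<in> space (iid (DSBS \<rho>) I)"
      using \<open>\<omega> \<in> I \<rightarrow>\<^sub>E sign_pairs\<close> sets_eq_imp_space_eq[OF DSBS(2)]
      by (auto simp: space_PiM PiE_iff)
    ultimately show "\<omega> \<in> {\<omega> \<in> space (iid (DSBS \<rho>) I). joint_tail_event s u M I \<omega>}"
      using M_ge_1 by (simp add: joint_tail_event_def)
  qed
  finally show ?thesis .
qed

lemma tail_deviation_bounds:
  fixes H \<nu> K :: real
  assumes H_ge_1: "1 \<le> H" and K_pos: "0 < K" and \<nu>_ge: "(8 * K\<^sup>2 + 2) * H ^ 6 \<le> \<nu>"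
  defines "\<sigma> \<equiv> sqrt (2 * H / \<nu>)"
  shows "1 \<le> \<nu>" "\<nu> * \<sigma>\<^sup>2 = 2 * H" "1 / \<nu> \<le> \<sigma>" "K * \<sigma> \<le> 1 / 2" "\<nu> * (K * \<sigma>) ^ 3 \<le> 2 * K ^ 3"
proof -
  have H_powers: "H \<le> H ^ 6" "H ^ 3 \<le> H ^ 6" "1 \<le> H ^ 6"
    using H_ge_1 power_increasing[of 1 6 H] power_increasing[of 3 6 H] by auto
  have "0 \<le> 8 * K\<^sup>2 * H ^ 6" using H_ge_1 by simp
  then have \<nu>_H: "2 * H ^ 6 \<le> \<nu>" and \<nu>_K: "8 * K\<^sup>2 * H ^ 6 \<le> \<nu>"
    using \<nu>_ge H_powers unfolding distrib_right by linarith+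
  show \<nu>_ge_1: "1 \<le> \<nu>" using \<nu>_H H_powers by linarith
  show \<sigma>_square: "\<nu> * \<sigma>\<^sup>2 = 2 * H" using H_ge_1 \<nu>_ge_1 by (simp add: \<sigma>_def)
  show "1 / \<nu> \<le> \<sigma>"
    unfolding \<sigma>_def
  proof (rule real_le_rsqrt)
    have "1 / \<nu> \<le> 2 * H"
      using H_ge_1 \<nu>_ge_1 divide_le_eq_1[of 1 \<nu>] by linarith
    then have "1 / \<nu> * (1 / \<nu>) \<le> 2 * H * (1 / \<nu>)"
      using \<nu>_ge_1 by (intro mult_right_mono) auto
    then show "(1 / \<nu>)\<^sup>2 \<le> 2 * H / \<nu>" by (simp add: power2_eq_square)
  qed
  show "K * \<sigma> \<le> 1 / 2"
  proof (rule power2_le_imp_le)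
    have "8 * K\<^sup>2 * H \<le> 8 * K\<^sup>2 * H ^ 6" using H_powers by (intro mult_left_mono) auto
    then have "8 * K\<^sup>2 * H \<le> \<nu>" using \<nu>_K by linarith
    then show "(K * \<sigma>)\<^sup>2 \<le> (1 / 2)\<^sup>2"
      using \<nu>_ge_1 H_ge_1 by (simp add: \<sigma>_def power_mult_distrib field_simps power2_eq_square)
  qed simp
  have "H * \<sigma> \<le> 1"
  proof (rule power2_le_imp_le)
    have "2 * H ^ 3 \<le> \<nu>" using \<nu>_H H_powers by linarith
    then show "(H * \<sigma>)\<^sup>2 \<le> 1\<^sup>2"
      using H_ge_1 \<nu>_ge_1
      by (simp add: \<sigma>_def power_mult_distrib field_simps power2_eq_square power3_eq_cube)
  qed simp
  then have "K ^ 3 * (2 * (H * \<sigma>)) \<le> K ^ 3 * (2 * 1)"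
    using K_pos by (intro mult_left_mono) auto
  moreover have "\<nu> * (K * \<sigma>) ^ 3 = K ^ 3 * (\<nu> * \<sigma>\<^sup>2 * \<sigma>)"
    by (simp add: power_mult_distrib power3_eq_cube power2_eq_square)
  ultimately show "\<nu> * (K * \<sigma>) ^ 3 \<le> 2 * K ^ 3"
    by (simp add: \<sigma>_square)
qed

lemma DSBS_rounded_tilt:
  fixes \<rho> \<alpha> \<beta> :: real and n :: nat and t :: "real \<times> real \<Rightarrow> real"
  defines "t \<equiv> \<lambda>a. real n * (DSBS_weight \<rho> a * (1 + (\<alpha> * fst a + \<beta> * snd a)))"
  assumes t_ge: "\<And>a. a \<in> sign_pairs \<Longrightarrow> 4 \<le> t a"
  obtains m :: "real \<times> real \<Rightarrow> nat" where "(\<Sum>a\<in>sign_pairs. m a) = n"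
    and "\<And>a. a \<in> sign_pairs \<Longrightarrow> \<bar>m a - t a\<bar> \<le> 4"
    and "n * (\<alpha> + \<rho> * \<beta>) \<le> (\<Sum>a\<in>sign_pairs. m a * fst a)"
    and "n * (\<rho> * \<alpha> + \<beta>) \<le> (\<Sum>a\<in>sign_pairs. m a * snd a)"
proof -
  have moments: "(\<Sum>a\<in>sign_pairs. t a) = n" "(\<Sum>a\<in>sign_pairs. t a * fst a) = n * (\<alpha> + \<rho> * \<beta>)"
      "(\<Sum>a\<in>sign_pairs. t a * snd a) = n * (\<rho> * \<alpha> + \<beta>)"
    using DSBS_weight_moments(2-4)[of \<rho> \<alpha> \<beta>]
    by (simp_all add: t_def mult.assoc flip: sum_distrib_left)
  have corner: "(-1, -1) \<in> sign_pairs" by (simp add: sign_pairs_def)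
  obtain m :: "real \<times> real \<Rightarrow> nat" where rounding: "(\<Sum>a\<in>sign_pairs. m a) = n"
      "\<And>a. a \<in> sign_pairs \<Longrightarrow> \<bar>m a - t a\<bar> \<le> card sign_pairs"
    and m_ge: "\<And>f :: real \<times> real \<Rightarrow> real. (\<And>a. a \<in> sign_pairs \<Longrightarrow> f (-1, -1) \<le> f a) \<Longrightarrow>
      (\<Sum>a\<in>sign_pairs. t a * f a) \<le> (\<Sum>a\<in>sign_pairs. m a * f a)"
  proof (rule rounding_with_fixed_sum[OF finite_sign_pairs corner])
    show "0 \<le> t a" if "a \<in> sign_pairs" for a using t_ge[OF that] by simp
    show "real (card sign_pairs) \<le> t (-1, -1)" using t_ge[OF corner] by simp
  qed (use moments(1) in auto)
  have minimal: "fst (-1, -1 :: real) \<le> fst a" "snd (-1 :: real, -1) \<le> snd a"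
    if "a \<in> sign_pairs" for a
    using that by (auto simp: sign_pairs_def)
  show thesis
    using that[OF rounding(1)] rounding(2) m_ge[of fst, OF minimal(1)] m_ge[of snd, OF minimal(2)]
    by (simp add: moments)
qed

text \<open>The typical words of the source tilted by the density \<open>1 + \<alpha> x + \<beta> y\<close> lie in the joint
  tail, and they cost the relative entropy of the tilted source.\<close>

lemma DSBS_tilted_prob_ge:
  fixes \<rho> \<alpha> \<beta> \<tau> s u M :: real and I :: "'i set"
  defines "y \<equiv> \<lambda>a. \<alpha> * fst a + \<beta> * snd a"
  assumes \<rho>_bounds: "-1 < \<rho>" "\<rho> < 1" and finite_nonempty_I: "finite I" "I \<noteq> {}"
    and \<tau>_bounds: "\<And>a. a \<in> sign_pairs \<Longrightarrow> \<bar>y a\<bar> + 4 / (card I * DSBS_weight \<rho> a) \<le> \<tau>" "\<tau> \<le> 1 / 2"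
    and s_le: "s \<le> card I * (\<alpha> + \<rho> * \<beta>)" and u_le: "u \<le> card I * (\<rho> * \<alpha> + \<beta>)" and M_ge_1: "1 \<le> M"
  shows "exp (- (card I * (\<alpha>\<^sup>2 + 2 * \<rho> * \<alpha> * \<beta> + \<beta>\<^sup>2) / 2 + 16 + card I * \<tau> ^ 3)) /
      real (Suc (card I)) ^ 4 \<le>
    \<P>(\<omega> in iid (DSBS \<rho>) I. joint_tail_event s u M I \<omega>)"
proof -
  define \<nu> q where "\<nu> = real (card I)" and "q = DSBS_weight \<rho>"
  have \<nu>_pos: "0 < \<nu>" using finite_nonempty_I by (simp add: \<nu>_def card_gt_0_iff)
  have q_pos: "0 < q a" if "a \<in> sign_pairs" for a
    using that \<rho>_bounds by (auto simp: sign_pairs_def q_def DSBS_weight_def)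
  have tilt_ge: "4 \<le> \<nu> * (q a * (1 + y a))" if a_in_sign_pairs: "a \<in> sign_pairs" for a
  proof -
    have "4 / (\<nu> * q a) \<le> 1 + y a"
      using \<tau>_bounds(1)[OF a_in_sign_pairs] \<tau>_bounds(2) unfolding \<nu>_def q_def by linarith
    then show ?thesis using q_pos[OF a_in_sign_pairs] \<nu>_pos by (simp add: divide_le_eq mult_ac)
  qed
  obtain m where rounding: "(\<Sum>a\<in>sign_pairs. m a) = card I"
      "\<And>a. a \<in> sign_pairs \<Longrightarrow> \<bar>m a - \<nu> * (q a * (1 + y a))\<bar> \<le> 4"
    and means: "\<nu> * (\<alpha> + \<rho> * \<beta>) \<le> (\<Sum>a\<in>sign_pairs. m a * fst a)"
      "\<nu> * (\<rho> * \<alpha> + \<beta>) \<le> (\<Sum>a\<in>sign_pairs. m a * snd a)"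
    using DSBS_rounded_tilt[OF tilt_ge[unfolded \<nu>_def q_def y_def]]
    unfolding \<nu>_def q_def y_def by blast
  have "(\<Sum>a\<in>sign_pairs. m a * ln (m a / (\<nu> * q a))) \<le>
      \<nu> * (\<Sum>a\<in>sign_pairs. q a * (y a)\<^sup>2) / 2 + real (card sign_pairs) * 4 + \<nu> * \<tau> ^ 3"
  proof (rule tilted_relative_entropy_le)
    show "(\<Sum>a\<in>sign_pairs. q a) = 1" unfolding q_def by (rule DSBS_weight_moments(1))
    show "(\<Sum>a\<in>sign_pairs. real (m a)) = \<nu>" by (simp add: \<nu>_def flip: rounding(1))
  qed (use q_pos \<nu>_pos \<tau>_bounds rounding(2) in \<open>auto simp: \<nu>_def q_def mult.assoc\<close>)
  then have "(\<Sum>a\<in>sign_pairs. m a * ln (m a / (\<nu> * q a))) \<le>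
      \<nu> * (\<alpha>\<^sup>2 + 2 * \<rho> * \<alpha> * \<beta> + \<beta>\<^sup>2) / 2 + 16 + \<nu> * \<tau> ^ 3"
    by (simp add: q_def y_def DSBS_weight_moments(5))
  then have "exp (- (\<nu> * (\<alpha>\<^sup>2 + 2 * \<rho> * \<alpha> * \<beta> + \<beta>\<^sup>2) / 2 + 16 + \<nu> * \<tau> ^ 3)) /
      real (Suc (card I)) ^ 4 \<le>
      exp (- (\<Sum>a\<in>sign_pairs. m a * ln (m a / (\<nu> * q a)))) / real (Suc (card I)) ^ 4"
    by (intro divide_right_mono) auto
  also have "\<dots> \<le> \<P>(\<omega> in iid (DSBS \<rho>) I. joint_tail_event s u M I \<omega>)"
    using means s_le u_le unfolding \<nu>_def q_def
    by (intro DSBS_type_prob_ge \<rho>_bounds finite_nonempty_I(1) rounding(1) M_ge_1) linarith+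
  finally show ?thesis by (simp only: \<nu>_def)
qed

lemma tail_threshold_eq: "0 < n \<Longrightarrow> tail_threshold H n = real n * sqrt (2 * H / real n)"
proof -
  assume "0 < n"
  then have "tail_threshold H n = sqrt ((real n)\<^sup>2 * (2 * H / real n))"
    by (simp add: tail_threshold_def power2_eq_square mult_ac)
  also have "\<dots> = real n * sqrt (2 * H / real n)" by (simp only: real_sqrt_mult) simp
  finally show ?thesis .
qed

lemma DSBS_tilt_small:
  fixes \<alpha> \<beta> \<sigma> \<nu> :: real
  assumes \<rho>_bounds: "0 \<le> \<rho>" "\<rho> < 1" and tilt: "\<bar>\<alpha>\<bar> \<le> \<sigma>" "\<bar>\<beta>\<bar> \<le> \<sigma>" and \<nu>_bounds: "0 < \<nu>" "1 / \<nu> \<le> \<sigma>"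
    and a_in_sign_pairs: "a \<in> sign_pairs"
  shows "\<bar>\<alpha> * fst a + \<beta> * snd a\<bar> + 4 / (\<nu> * DSBS_weight \<rho> a) \<le> (2 + 16 / (1 - \<rho>)) * \<sigma>"
proof -
  have "(1 - \<rho>) / 4 \<le> DSBS_weight \<rho> a"
    using a_in_sign_pairs \<rho>_bounds by (auto simp: sign_pairs_def DSBS_weight_def)
  then have "4 / (\<nu> * DSBS_weight \<rho> a) \<le> 4 / (\<nu> * ((1 - \<rho>) / 4))"
    using \<rho>_bounds \<nu>_bounds(1) by (intro divide_left_mono mult_left_mono mult_pos_pos) auto
  also have "\<dots> = 16 / (1 - \<rho>) * (1 / \<nu>)" by simp
  also have "\<dots> \<le> 16 / (1 - \<rho>) * \<sigma>"
    using \<nu>_bounds(2) \<rho>_bounds by (intro mult_left_mono) auto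
  finally have "4 / (\<nu> * DSBS_weight \<rho> a) \<le> 16 / (1 - \<rho>) * \<sigma>" .
  moreover have "\<bar>\<alpha> * fst a + \<beta> * snd a\<bar> \<le> 2 * \<sigma>"
    using a_in_sign_pairs tilt by (auto simp: sign_pairs_def)
  ultimately show ?thesis
    unfolding distrib_right by linarith
qed

text \<open>With \<open>g = \<delta> / sqrt (1 - \<rho>\<^sup>2)\<close>, the tilt by \<open>\<sigma> (1 - \<rho> g)\<close> and \<open>\<sigma> g\<close> shifts the means of the
  two components to \<open>\<sigma>\<close> and \<open>\<phi> \<sigma>\<close>.\<close>

lemma DSBS_joint_tail_prob_ge:
  fixes \<rho> \<delta> H :: real and I :: "'i set"
  assumes \<rho>_bounds: "0 < \<rho>" "\<rho> < 1" and \<delta>_bounds: "0 \<le> \<delta>" "\<delta> \<le> sqrt (1 - \<rho>\<^sup>2)"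
  defines "K \<equiv> 2 + 16 / (1 - \<rho>)"
  assumes H_ge_1: "1 \<le> H" and card_large: "finite I" "(8 * K\<^sup>2 + 2) * H ^ 6 \<le> real (card I)"
  shows "exp (- ((1 + \<delta>\<^sup>2) * H + 16 + 2 * K ^ 3)) / real (Suc (card I)) ^ 4 \<le>
    joint_tail_prob (DSBS \<rho>) (\<rho> + \<delta> * sqrt (1 - \<rho>\<^sup>2)) H I"
proof -
  define \<nu> where "\<nu> = real (card I)"
  define \<sigma> where "\<sigma> = sqrt (2 * H / \<nu>)"
  define r g where "r = sqrt (1 - \<rho>\<^sup>2)" and "g = \<delta> / r"
  define \<alpha> \<beta> where "\<alpha> = \<sigma> * (1 - \<rho> * g)" and "\<beta> = \<sigma> * g"
  have "\<rho>\<^sup>2 < 1" using \<rho>_bounds by (simp add: power_less_one_iff)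
  then have r_props: "0 < r" "r\<^sup>2 = 1 - \<rho>\<^sup>2" by (simp_all add: r_def)
  have g_bounds: "0 \<le> g" "g \<le> 1" "\<delta> = g * r"
    using r_props \<delta>_bounds by (auto simp: g_def r_def)
  have K_pos: "0 < K" using \<rho>_bounds by (simp add: K_def add_pos_pos)
  note bounds = tail_deviation_bounds[OF H_ge_1 K_pos card_large(2), folded \<nu>_def, folded \<sigma>_def]
  have threshold: "tail_threshold H (card I) = \<nu> * \<sigma>"
    unfolding \<nu>_def \<sigma>_def using bounds(1) by (intro tail_threshold_eq) (simp add: \<nu>_def)
  have \<sigma>_nonneg: "0 \<le> \<sigma>" using H_ge_1 bounds(1) by (simp add: \<sigma>_def)
  have "0 \<le> \<rho> * g" "\<rho> * g \<le> 1" using \<rho>_bounds g_bounds by (auto intro: mult_le_one)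
  then have tilt: "\<bar>\<alpha>\<bar> \<le> \<sigma>" "\<bar>\<beta>\<bar> \<le> \<sigma>"
    using \<sigma>_nonneg g_bounds by (auto simp: \<alpha>_def \<beta>_def intro: mult_left_le)
  have small: "\<bar>\<alpha> * fst a + \<beta> * snd a\<bar> + 4 / (\<nu> * DSBS_weight \<rho> a) \<le> K * \<sigma>"
    if a_in_sign_pairs: "a \<in> sign_pairs" for a
    unfolding K_def using \<rho>_bounds bounds(1,3) by (intro DSBS_tilt_small tilt a_in_sign_pairs) auto
  have mean_fst: "\<alpha> + \<rho> * \<beta> = \<sigma>"
    by (simp add: \<alpha>_def \<beta>_def algebra_simps)
  have "\<rho> * \<alpha> + \<beta> = \<sigma> * (\<rho> + g * (1 - \<rho>\<^sup>2))"
    by (simp add: \<alpha>_def \<beta>_def algebra_simps power2_eq_square)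
  also have "\<dots> = (\<rho> + \<delta> * r) * \<sigma>"
    unfolding r_props(2)[symmetric] g_bounds(3) by (simp add: power2_eq_square)
  finally have mean_snd: "\<rho> * \<alpha> + \<beta> = (\<rho> + \<delta> * r) * \<sigma>" .
  have "\<alpha>\<^sup>2 + 2 * \<rho> * \<alpha> * \<beta> + \<beta>\<^sup>2 = \<sigma>\<^sup>2 * (1 + g\<^sup>2 * (1 - \<rho>\<^sup>2))"
    by (simp add: \<alpha>_def \<beta>_def algebra_simps power2_eq_square)
  also have "\<dots> = \<sigma>\<^sup>2 * (1 + \<delta>\<^sup>2)"
    by (simp add: g_bounds(3) power_mult_distrib flip: r_props(2))
  finally have entropy: "\<nu> * (\<alpha>\<^sup>2 + 2 * \<rho> * \<alpha> * \<beta> + \<beta>\<^sup>2) / 2 = (1 + \<delta>\<^sup>2) * H"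
    using bounds(2) by simp
  have "exp (- ((1 + \<delta>\<^sup>2) * H + 16 + 2 * K ^ 3)) / real (Suc (card I)) ^ 4 \<le>
      exp (- ((1 + \<delta>\<^sup>2) * H + 16 + \<nu> * (K * \<sigma>) ^ 3)) / real (Suc (card I)) ^ 4"
    using bounds(5) by (intro divide_right_mono) auto
  also have "\<dots> \<le> joint_tail_prob (DSBS \<rho>) (\<rho> + \<delta> * r) H I"
    unfolding joint_tail_prob_def entropy[symmetric] unfolding \<nu>_def
  proof (rule DSBS_tilted_prob_ge)
    show "tail_threshold H (card I) \<le> card I * (\<alpha> + \<rho> * \<beta>)"
      by (simp only: threshold mean_fst \<nu>_def)
    show "(\<rho> + \<delta> * r) * tail_threshold H (card I) \<le> card I * (\<rho> * \<alpha> + \<beta>)"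
      unfolding threshold mean_snd \<nu>_def by (simp add: mult.left_commute)
  qed (use \<rho>_bounds card_large(1) small bounds(1,4) in \<open>auto simp: \<nu>_def\<close>)
  finally show ?thesis by (simp only: r_def)
qed

lemma DSBS_joint_tail:
  fixes \<rho> \<delta> :: real
  assumes \<rho>_bounds: "0 < \<rho>" "\<rho> < 1" and \<delta>_bounds: "0 \<le> \<delta>" "\<delta> \<le> sqrt (1 - \<rho>\<^sup>2)"
  shows "\<exists>B b. joint_tail_bound (DSBS \<rho>) \<delta> (\<rho> + \<delta> * sqrt (1 - \<rho>\<^sup>2)) B b 4"
proof -
  define K where "K = 2 + 16 / (1 - \<rho>)"
  define c where "c = exp (16 + 2 * K ^ 3)"
  show ?thesis
  proof (rule joint_tail_boundI[of "16 * c" "8 * K\<^sup>2 + 2"])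
    fix H and I :: "nat set"
    assume H_ge_1: "1 \<le> H"
      and card_large: "finite I" "I \<noteq> {}" "(8 * K\<^sup>2 + 2) * H ^ 6 \<le> real (card I)"
    have "1 \<le> card I" using card_large by (simp add: Suc_le_eq card_gt_0_iff)
    then have "real (Suc (card I)) ^ 4 \<le> (2 * real (card I)) ^ 4" by (intro power_mono) auto
    then have "exp (- ((1 + \<delta>\<^sup>2) * H)) / (16 * c * real (card I) ^ 4) \<le>
        exp (- ((1 + \<delta>\<^sup>2) * H)) / (c * real (Suc (card I)) ^ 4)"
      using card_large
      by (intro divide_left_mono mult_pos_pos) (auto simp: c_def power_mult_distrib card_gt_0_iff)
    also have "\<dots> = exp (- ((1 + \<delta>\<^sup>2) * H + 16 + 2 * K ^ 3)) / real (Suc (card I)) ^ 4"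
    proof -
      have "exp (- ((1 + \<delta>\<^sup>2) * H)) = exp (- ((1 + \<delta>\<^sup>2) * H + 16 + 2 * K ^ 3)) * c"
        unfolding c_def exp_add[symmetric] by simp
      then show ?thesis by (simp add: c_def)
    qed
    also have "\<dots> \<le> joint_tail_prob (DSBS \<rho>) (\<rho> + \<delta> * sqrt (1 - \<rho>\<^sup>2)) H I"
      unfolding K_def
      by (rule DSBS_joint_tail_prob_ge[OF \<rho>_bounds \<delta>_bounds H_ge_1 card_large(1)])
        (use card_large in \<open>simp add: K_def\<close>)
    finally show "exp (- ((1 + \<delta>\<^sup>2) * H)) / (16 * c * real (card I) ^ 4) \<le>
        joint_tail_prob (DSBS \<rho>) (\<rho> + \<delta> * sqrt (1 - \<rho>\<^sup>2)) H I" .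
  qed (simp add: c_def)
qed

section \<open>The Gaussian source\<close>

lemma distributed_std_normal_subgaussian:
  assumes distributed_X: "distributed M lborel X std_normal_density"
  shows "subgaussian M X"
proof -
  have [measurable]: "X \<in> borel_measurable M" using distributed_measurable[OF distributed_X] by simp
  have "(\<integral>\<^sup>+x. ennreal (exp (t * X x)) \<partial>M) = ennreal (exp (t\<^sup>2 / 2))" for t
  proof -
    interpret shifted: prob_space "density lborel (\<lambda>x. ennreal (normal_density t 1 x))"
      by (rule prob_space_normal_density) simp
    have "std_normal_density x * exp (t * x) = exp (t\<^sup>2 / 2) * normal_density t 1 x" for x
      by (simp add: normal_density_def exp_add[symmetric] power2_eq_square field_simps)
    then have "(\<integral>\<^sup>+x. ennreal (std_normal_density x) * ennreal (exp (t * x)) \<partial>lborel) =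
        (\<integral>\<^sup>+x. ennreal (exp (t\<^sup>2 / 2)) * ennreal (normal_density t 1 x) \<partial>lborel)"
      by (simp flip: ennreal_mult)
    also have "\<dots> = ennreal (exp (t\<^sup>2 / 2))"
      using shifted.emeasure_space_1 by (simp add: nn_integral_cmult emeasure_density)
    finally show ?thesis
      using distributed_nn_integral[OF distributed_X, of "\<lambda>x. ennreal (exp (t * x))"] by simp
  qed
  then show ?thesis by (simp add: subgaussian_def)
qed

lemma (in prob_space) distributed_std_normal_nonneg:
  assumes distributed_X: "distributed M lborel X std_normal_density"
  shows "\<P>(x in M. 0 \<le> X x) = 1 / 2"
proof -
  have [measurable]: "X \<in> borel_measurable M" using distributed_measurable[OF distributed_X] by simp
  have distributed_uminus: "distributed M lborel (\<lambda>x. - X x) std_normal_density"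
    using normal_density_affine[OF distributed_X, of "-1" 0] by simp
  have emeasure: "emeasure M {x \<in> space M. Y x \<in> S} =
      (\<integral>\<^sup>+x. ennreal (std_normal_density x) * indicator S x \<partial>lborel)"
    if "distributed M lborel Y std_normal_density" "S \<in> sets lborel" for Y S
    using distributed_emeasure[OF that] by (simp add: vimage_def Int_def conj_commute)
  have "emeasure M {x \<in> space M. X x \<in> {0}} = 0"
    by (subst emeasure[OF distributed_X])
      (auto simp: nn_integral_0_iff_AE intro!: AE_lborel_singleton[THEN AE_mp] AE_I2)
  then have prob_zero: "prob {x \<in> space M. X x = 0} = 0" by (simp add: measure_def)
  have "emeasure M {x \<in> space M. X x \<in> {0..}} = emeasure M {x \<in> space M. - X x \<in> {0..}}"
    by (simp only: emeasure[OF distributed_X] emeasure[OF distributed_uminus] sets_lborel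
      atLeast_borel)
  then have symmetric: "prob {x \<in> space M. 0 \<le> X x} = prob {x \<in> space M. X x \<le> 0}"
    by (simp add: measure_def)
  have "prob {x \<in> space M. X x \<le> 0} = prob {x \<in> space M. X x = 0} + prob {x \<in> space M. X x < 0}"
    by (subst finite_measure_Union[symmetric]) (auto intro!: arg_cong[of _ _ prob])
  moreover have "prob {x \<in> space M. X x < 0} = 1 - prob {x \<in> space M. 0 \<le> X x}"
    by (subst prob_compl[symmetric]) (auto intro!: arg_cong[of _ _ prob])
  ultimately show ?thesis using symmetric prob_zero by simp
qed

lemma normal_density_ge:
  assumes \<sigma>_pos: "0 < \<sigma>" and \<theta>_nonneg: "0 \<le> \<theta>" and x_bounds: "\<theta> * \<sigma> \<le> x" "x \<le> \<theta> * \<sigma> + \<sigma> / (\<theta> + 1)"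
  shows "exp (- (\<theta>\<^sup>2 / 2) - 3 / 2) / (3 * \<sigma>) \<le> normal_density 0 \<sigma> x"
proof -
  have "x / \<sigma> \<le> \<theta> + 1 / (\<theta> + 1)" using x_bounds \<sigma>_pos \<theta>_nonneg by (simp add: field_simps)
  moreover have "0 \<le> x / \<sigma>"
    using x_bounds \<sigma>_pos \<theta>_nonneg
    by (meson divide_nonneg_pos mult_nonneg_nonneg less_imp_le order_trans)
  ultimately have "(x / \<sigma>)\<^sup>2 \<le> (\<theta> + 1 / (\<theta> + 1))\<^sup>2" by (intro power_mono)
  also have "\<dots> = \<theta>\<^sup>2 + 2 * (\<theta> / (\<theta> + 1)) + (1 / (\<theta> + 1))\<^sup>2"
    by (simp add: power2_sum)
  also have "\<dots> \<le> \<theta>\<^sup>2 + 2 * 1 + 1"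
    using \<theta>_nonneg by (intro add_mono mult_left_mono) (auto simp: power_le_one)
  finally have "exp (- (\<theta>\<^sup>2 / 2) - 3 / 2) \<le> exp (- ((x / \<sigma>)\<^sup>2 / 2))" by simp
  moreover have "sqrt (2 * pi * \<sigma>\<^sup>2) \<le> 3 * \<sigma>"
  proof (rule real_le_lsqrt)
    have "2 * pi * \<sigma>\<^sup>2 \<le> 9 * \<sigma>\<^sup>2" using pi_less_4 by (intro mult_right_mono) auto
    then show "2 * pi * \<sigma>\<^sup>2 \<le> (3 * \<sigma>)\<^sup>2" by (simp add: power_mult_distrib)
  qed (use \<sigma>_pos in auto)
  ultimately have "exp (- (\<theta>\<^sup>2 / 2) - 3 / 2) / (3 * \<sigma>) \<le>
      exp (- ((x / \<sigma>)\<^sup>2 / 2)) / sqrt (2 * pi * \<sigma>\<^sup>2)"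
    using \<sigma>_pos by (intro frac_le) auto
  also have "\<dots> = normal_density 0 \<sigma> x"
    by (simp add: normal_density_def power_divide)
  finally show ?thesis .
qed

definition normal_tail_bound :: "real \<Rightarrow> real" where
  "normal_tail_bound \<theta> = exp (- (\<theta>\<^sup>2 / 2) - 3 / 2) / (3 * (\<theta> + 1))"

lemma (in prob_space) distributed_normal_tail_ge:
  assumes distributed_X: "distributed M lborel X (normal_density 0 \<sigma>)" and \<sigma>_pos: "0 < \<sigma>"
    and \<theta>_nonneg: "0 \<le> \<theta>"
  shows "normal_tail_bound \<theta> \<le> \<P>(x in M. \<theta> * \<sigma> \<le> X x)"
proof -
  define w where "w = \<sigma> / (\<theta> + 1)"
  define D where "D = exp (- (\<theta>\<^sup>2 / 2) - 3 / 2) / (3 * \<sigma>)"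
  have w_D_nonneg: "0 < w" "0 \<le> D" using \<sigma>_pos \<theta>_nonneg by (simp_all add: w_def D_def)
  have "ennreal (D * w) = (\<integral>\<^sup>+x. ennreal D * indicator {\<theta> * \<sigma>..\<theta> * \<sigma> + w} x \<partial>lborel)"
    using w_D_nonneg by (simp add: nn_integral_cmult_indicator ennreal_mult)
  also have "\<dots> \<le> (\<integral>\<^sup>+x. ennreal (normal_density 0 \<sigma> x) * indicator {\<theta> * \<sigma>..} x \<partial>lborel)"
    using normal_density_ge[OF \<sigma>_pos \<theta>_nonneg]
    by (intro nn_integral_mono) (auto simp: D_def w_def indicator_def intro!: ennreal_leI)
  also have "\<dots> = emeasure M (X -` {\<theta> * \<sigma>..} \<inter> space M)"
    by (rule distributed_emeasure[OF distributed_X, symmetric]) simp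
  also have "X -` {\<theta> * \<sigma>..} \<inter> space M = {x \<in> space M. \<theta> * \<sigma> \<le> X x}" by auto
  finally have "D * w \<le> \<P>(x in M. \<theta> * \<sigma> \<le> X x)"
    by (simp add: emeasure_eq_measure)
  moreover have "D * w = normal_tail_bound \<theta>"
    using \<sigma>_pos by (simp add: D_def w_def normal_tail_bound_def)
  ultimately show ?thesis by simp
qed

lemma distributed_sum_iid_std_normal:
  fixes I :: "'i set"
  assumes finite_nonempty_I: "finite I" "I \<noteq> {}"
  shows "distributed (iid std_normal_distribution I) lborel (\<lambda>\<omega>. \<Sum>i\<in>I. \<omega> i)
      (normal_density 0 (sqrt (card I)))"
proof -
  let ?N = std_normal_distribution
  have prob_space_N: "prob_space ?N" by (rule prob_space_normal_density) simp
  interpret P: prob_space "iid ?N I" by (rule prob_space_iid[OF prob_space_N])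
  have "P.indep_vars (\<lambda>_. borel) (\<lambda>i \<omega>. \<omega> i) I"
    using P.indep_vars_compose2[OF indep_vars_iid_coordinates[OF prob_space_N],
        of "\<lambda>_ x. x" "\<lambda>_. borel"]
    by simp
  moreover have "distributed (iid ?N I) lborel (\<lambda>\<omega>. \<omega> i) std_normal_density" if "i \<in> I" for i
  proof -
    have "distr (iid ?N I) lborel (\<lambda>\<omega>. \<omega> i) = distr (iid ?N I) ?N (\<lambda>\<omega>. \<omega> i)"
      by (rule distr_cong) simp_all
    also have "\<dots> = ?N"
      using prob_space_N that by (rule distr_PiM_component)
    finally show ?thesis
      using measurable_component_singleton[OF that, of "\<lambda>_. ?N"] by (simp add: distributed_def)
  qed
  ultimately have "distributed (iid ?N I) lborel (\<lambda>\<omega>. \<Sum>i\<in>I. \<omega> i)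
      (normal_density (\<Sum>i\<in>I. 0) (sqrt (\<Sum>i\<in>I. 1\<^sup>2)))"
    by (intro P.sum_indep_normal finite_nonempty_I) auto
  then show ?thesis by simp
qed

lemma distr_pair_iid:
  assumes prob_space_M: "prob_space M" and prob_space_N: "prob_space N" and finite_I: "finite I"
  shows "distr (iid M I \<Otimes>\<^sub>M iid N I) (iid (M \<Otimes>\<^sub>M N) I) (\<lambda>(u, v). \<lambda>i\<in>I. (u i, v i)) =
      iid (M \<Otimes>\<^sub>M N) I"
    (is "?D = _")
proof -
  interpret M: product_sigma_finite "\<lambda>_. M"
    by (intro product_sigma_finite.intro prob_space_imp_sigma_finite prob_space_M)
  interpret N: product_sigma_finite "\<lambda>_. N"
    by (intro product_sigma_finite.intro prob_space_imp_sigma_finite prob_space_N)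
  interpret iid_N: sigma_finite_measure "iid N I"
    by (intro prob_space_imp_sigma_finite prob_space_iid prob_space_N)
  interpret MN: product_sigma_finite "\<lambda>_. M \<Otimes>\<^sub>M N"
    by (intro product_sigma_finite.intro prob_space_imp_sigma_finite prob_space_pair prob_space_M
      prob_space_N)
  have [measurable]: "(\<lambda>(u, v). \<lambda>i\<in>I. (u i, v i)) \<in> iid M I \<Otimes>\<^sub>M iid N I \<rightarrow>\<^sub>M iid (M \<Otimes>\<^sub>M N) I"
    unfolding case_prod_beta by measurable
  show ?thesis
  proof (rule MN.PiM_eqI[OF finite_I])
    fix A assume sets_A [measurable]: "\<And>i. i \<in> I \<Longrightarrow> A i \<in> sets (M \<Otimes>\<^sub>M N)"
    have [measurable]: "Pi\<^sub>E I A \<in> sets (iid (M \<Otimes>\<^sub>M N) I)"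
      using finite_I sets_A by (rule sets_PiM_I_finite)
    have "emeasure ?D (Pi\<^sub>E I A) = (\<integral>\<^sup>+z. indicator (Pi\<^sub>E I A) z \<partial>?D)"
      by simp
    also have "\<dots> = (\<integral>\<^sup>+z. indicator (Pi\<^sub>E I A) (\<lambda>i\<in>I. (fst z i, snd z i)) \<partial>(iid M I \<Otimes>\<^sub>M iid N I))"
      by (subst nn_integral_distr) (simp_all add: case_prod_beta)
    also have "\<dots> = (\<integral>\<^sup>+z. (\<Prod>i\<in>I. indicator (A i) (fst z i, snd z i)) \<partial>(iid M I \<Otimes>\<^sub>M iid N I))"
      using finite_I by (intro nn_integral_cong) (auto simp: indicator_def PiE_iff prod_zero_iff)
    also have "\<dots> = (\<integral>\<^sup>+u. \<integral>\<^sup>+v. (\<Prod>i\<in>I. indicator (A i) (u i, v i)) \<partial>iid N I \<partial>iid M I)"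
      by (subst iid_N.nn_integral_fst[symmetric]) simp_all
    also have "\<dots> = (\<integral>\<^sup>+u. (\<Prod>i\<in>I. \<integral>\<^sup>+y. indicator (A i) (u i, y) \<partial>N) \<partial>iid M I)"
    proof (intro nn_integral_cong N.product_nn_integral_prod finite_I)
      fix u i assume "u \<in> space (iid M I)" "i \<in> I"
      then have "u i \<in> space M" by (auto simp: space_PiM)
      then show "(\<lambda>y. indicator (A i) (u i, y)) \<in> borel_measurable N"
        using sets_A[OF \<open>i \<in> I\<close>]
        by (intro measurable_compose[OF measurable_Pair1' borel_measurable_indicator])
    qed
    also have "\<dots> = (\<Prod>i\<in>I. \<integral>\<^sup>+x. \<integral>\<^sup>+y. indicator (A i) (x, y) \<partial>N \<partial>M)"
      using finite_I by (intro M.product_nn_integral_prod) auto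
    also have "\<dots> = (\<Prod>i\<in>I. emeasure (M \<Otimes>\<^sub>M N) (A i))"
      using sets_A
      by (simp add: sigma_finite_measure.emeasure_pair_measure[OF prob_space_imp_sigma_finite[OF
        prob_space_N]])
    finally show "emeasure ?D (Pi\<^sub>E I A) = (\<Prod>i\<in>I. emeasure (M \<Otimes>\<^sub>M N) (A i))" .
  qed simp
qed

lemma iid_BGS:
  fixes \<rho> :: real and I :: "'i set"
  assumes \<rho>_bounds: "-1 \<le> \<rho>" "\<rho> \<le> 1" and finite_I: "finite I"
  defines "N \<equiv> std_normal_distribution"
  shows "iid (BGS \<rho>) I = distr (iid N I \<Otimes>\<^sub>M iid N I) (iid (BGS \<rho>) I)
    (\<lambda>(u, v). \<lambda>i\<in>I. (u i, \<rho> * u i + sqrt (1 - \<rho>\<^sup>2) * v i))"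
proof -
  define g where "g = (\<lambda>(u :: real, v). (u, \<rho> * u + sqrt (1 - \<rho>\<^sup>2) * v))"
  have prob_space_N: "prob_space N" unfolding N_def by (rule prob_space_normal_density) simp
  have [measurable_cong]: "sets N = sets borel" by (simp add: N_def)
  note BGS = BGS_source(1,2)[OF \<rho>_bounds]
  have "g \<in> N \<Otimes>\<^sub>M N \<rightarrow>\<^sub>M borel" unfolding g_def case_prod_beta' by measurable
  then have [measurable]: "g \<in> N \<Otimes>\<^sub>M N \<rightarrow>\<^sub>M BGS \<rho>" by (simp add: BGS(2) cong: measurable_cong_sets)
  have [measurable]: "(\<lambda>(u, v). \<lambda>i\<in>I. (u i, v i)) \<in> iid N I \<Otimes>\<^sub>M iid N I \<rightarrow>\<^sub>M iid (N \<Otimes>\<^sub>M N) I"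
    unfolding case_prod_beta by measurable
  have [measurable]: "compose I g \<in> iid (N \<Otimes>\<^sub>M N) I \<rightarrow>\<^sub>M iid (BGS \<rho>) I"
    unfolding compose_def by measurable
  have "BGS \<rho> = distr (N \<Otimes>\<^sub>M N) (BGS \<rho>) g"
    unfolding g_def N_def BGS_def by (rule distr_cong) simp_all
  then have "iid (BGS \<rho>) I = (\<Pi>\<^sub>M i\<in>I. distr (N \<Otimes>\<^sub>M N) (BGS \<rho>) g)"
    by simp
  also have "\<dots> = distr (iid (N \<Otimes>\<^sub>M N) I) (iid (BGS \<rho>) I) (compose I g)"
    using finite_I
    by (intro distr_PiM_finite_prob_space'[symmetric] prob_space_pair prob_space_N BGS) auto
  also have "\<dots> = distr (distr (iid N I \<Otimes>\<^sub>M iid N I) (iid (N \<Otimes>\<^sub>M N) I) (\<lambda>(u, v). \<lambda>i\<in>I. (u i, v i)))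
      (iid (BGS \<rho>) I) (compose I g)"
    by (simp only: distr_pair_iid[OF prob_space_N prob_space_N finite_I])
  also have "\<dots> = distr (iid N I \<Otimes>\<^sub>M iid N I) (iid (BGS \<rho>) I)
      (\<lambda>(u, v). \<lambda>i\<in>I. (u i, \<rho> * u i + sqrt (1 - \<rho>\<^sup>2) * v i))"
    by (subst distr_distr, measurable, rule distr_cong)
      (auto simp: compose_def g_def case_prod_beta)
  finally show ?thesis .
qed

text \<open>The second component of \<open>BGS \<rho>\<close> is \<open>\<rho>\<close> times the first one plus \<open>sqrt (1 - \<rho>\<^sup>2)\<close> times an
  independent innovation.\<close>

definition innovation_tail_event :: "real \<Rightarrow> 'i set \<Rightarrow> real \<Rightarrow> real \<Rightarrow> ('i \<Rightarrow> real \<times> real) set" where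
  "innovation_tail_event \<rho> I s t = {\<omega> \<in> space (iid (BGS \<rho>) I). s \<le> (\<Sum>i\<in>I. fst (\<omega> i)) \<and>
     \<rho> * (\<Sum>i\<in>I. fst (\<omega> i)) + sqrt (1 - \<rho>\<^sup>2) * t \<le> (\<Sum>i\<in>I. snd (\<omega> i))}"

lemma sets_innovation_tail_event:
  assumes "-1 \<le> \<rho>" "\<rho> \<le> 1"
  shows "innovation_tail_event \<rho> I s t \<in> sets (iid (BGS \<rho>) I)"
  unfolding innovation_tail_event_def
  using borel_measurable_iid_sum_fst_snd[OF BGS_source(2)[OF assms] subset_refl, of I]
  by (intro sets.sets_Collect_conj borel_measurable_le borel_measurable_const borel_measurable_add
      borel_measurable_times)

lemma innovation_tail_prob_ge:
  fixes I :: "'i set" and \<rho> :: real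
  assumes \<rho>_bounds: "-1 \<le> \<rho>" "\<rho> \<le> 1" and finite_nonempty_I: "finite I" "I \<noteq> {}"
    and thresholds_nonneg: "0 \<le> \<theta>" "0 \<le> \<eta>"
  defines "n \<equiv> real (card I)"
  shows "normal_tail_bound \<theta> * normal_tail_bound \<eta> \<le>
    measure (iid (BGS \<rho>) I) (innovation_tail_event \<rho> I (\<theta> * sqrt n) (\<eta> * sqrt n))"
    (is "_ \<le> measure _ ?E")
proof -
  let ?N = "iid std_normal_distribution I" and ?r = "sqrt (1 - \<rho>\<^sup>2)"
  have sqrt_pos: "0 < sqrt n" using finite_nonempty_I by (simp add: n_def card_gt_0_iff)
  have "\<rho>\<^sup>2 \<le> 1" using \<rho>_bounds by (simp add: abs_square_le_1 abs_le_iff)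
  interpret N: prob_space ?N
    by (intro prob_space_iid prob_space_normal_density) simp
  interpret NN: pair_prob_space ?N ?N ..
  define T where "T = (\<lambda>z. \<lambda>i\<in>I. (fst z i, \<rho> * fst z i + ?r * snd z i) :: real \<times> real)"
  have T_distr: "iid (BGS \<rho>) I = distr (?N \<Otimes>\<^sub>M ?N) (iid (BGS \<rho>) I) T"
    using iid_BGS[OF \<rho>_bounds finite_nonempty_I(1)] by (simp add: T_def case_prod_beta')
  have measurable_T [measurable]: "T \<in> ?N \<Otimes>\<^sub>M ?N \<rightarrow>\<^sub>M iid (BGS \<rho>) I"
    unfolding T_def
    by (intro measurable_restrict)
      (simp add: measurable_cong_sets[OF refl BGS_source(2)[OF \<rho>_bounds]])
  note sets_event [measurable] = sets_innovation_tail_event[OF \<rho>_bounds]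
  define S where "S \<theta> = {u \<in> space ?N. \<theta> * sqrt n \<le> (\<Sum>i\<in>I. u i)}" for \<theta>
  have sets_S: "S \<theta> \<in> sets ?N" for \<theta> unfolding S_def by measurable
  have S_ge: "normal_tail_bound \<theta> \<le> measure ?N (S \<theta>)" if "0 \<le> \<theta>" for \<theta>
    unfolding S_def
    using sqrt_pos
      N.distributed_normal_tail_ge[OF distributed_sum_iid_std_normal[OF finite_nonempty_I] _ that]
    by (simp add: n_def)
  have "normal_tail_bound \<theta> * normal_tail_bound \<eta> \<le> measure ?N (S \<theta>) * measure ?N (S \<eta>)"
    using thresholds_nonneg by (intro mult_mono S_ge) (auto simp: normal_tail_bound_def)
  also have "\<dots> = measure (?N \<Otimes>\<^sub>M ?N) (S \<theta> \<times> S \<eta>)"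
    using sets_S by (simp add: measure_def N.emeasure_pair_measure_Times enn2real_mult)
  also have "\<dots> \<le> measure (?N \<Otimes>\<^sub>M ?N) (T -` ?E \<inter> space (?N \<Otimes>\<^sub>M ?N))"
  proof (rule NN.finite_measure_mono[OF subsetI])
    fix z assume "z \<in> S \<theta> \<times> S \<eta>"
    then have in_tails: "z \<in> space (?N \<Otimes>\<^sub>M ?N)"
        "\<theta> * sqrt n \<le> (\<Sum>i\<in>I. fst z i)" "\<eta> * sqrt n \<le> (\<Sum>i\<in>I. snd z i)"
      by (auto simp: S_def space_pair_measure)
    have "?r * (\<eta> * sqrt n) \<le> ?r * (\<Sum>i\<in>I. snd z i)"
      using in_tails(3) \<open>\<rho>\<^sup>2 \<le> 1\<close> by (intro mult_left_mono) auto
    then show "z \<in> T -` ?E \<inter> space (?N \<Otimes>\<^sub>M ?N)"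
      using in_tails measurable_space[OF measurable_T in_tails(1)]
      by (simp add: innovation_tail_event_def T_def sum.distrib flip: sum_distrib_left)
  qed measurable
  also have "\<dots> = measure (iid (BGS \<rho>) I) ?E"
    using measure_distr[OF measurable_T sets_event] by (simp flip: T_distr)
  finally show ?thesis .
qed

lemma exp_sqrt_dominates:
  fixes c :: real
  assumes "0 < c"
  obtains B where "1 \<le> B"
    "\<And>H n. 1 \<le> H \<Longrightarrow> B * H ^ 6 \<le> n \<Longrightarrow> n\<^sup>2 * exp (- (sqrt n / 2)) \<le> c * exp (- 2 * H)"
proof -
  have "eventually (\<lambda>n. n\<^sup>2 * exp (- (sqrt n / 2)) \<le> c * exp (- 2 * n powr (1 / 6))) at_top"
    using assms by real_asymp
  then obtain N where small_beyond_N: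
      "\<And>n. N \<le> n \<Longrightarrow> n\<^sup>2 * exp (- (sqrt n / 2)) \<le> c * exp (- 2 * n powr (1 / 6))"
    by (auto simp: eventually_at_top_linorder)
  show ?thesis
  proof
    fix H n :: real assume H_ge_1: "1 \<le> H" and n_ge: "max 1 N * H ^ 6 \<le> n"
    have "1 \<le> H ^ 6" using H_ge_1 by simp
    then have "max 1 N * 1 \<le> max 1 N * H ^ 6" "1 * H ^ 6 \<le> max 1 N * H ^ 6"
      by (intro mult_left_mono mult_right_mono; simp)+
    then have "N \<le> n" "H ^ 6 \<le> n" using n_ge by linarith+
    have "H = (H ^ 6) powr (1 / 6)" using H_ge_1 by (simp add: powr_powr flip: powr_numeral)
    also have "\<dots> \<le> n powr (1 / 6)" using \<open>H ^ 6 \<le> n\<close> H_ge_1 by (intro powr_mono2) auto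
    finally have "c * exp (- 2 * n powr (1 / 6)) \<le> c * exp (- 2 * H)"
      using assms by simp
    then show "n\<^sup>2 * exp (- (sqrt n / 2)) \<le> c * exp (- 2 * H)"
      using small_beyond_N[OF \<open>N \<le> n\<close>] by linarith
  qed simp
qed

lemma BGS_truncation_le:
  fixes I :: "'i set"
  assumes \<rho>_bounds: "-1 \<le> \<rho>" "\<rho> \<le> 1" and i_in_I: "i \<in> I" and M_nonneg: "0 \<le> M"
  shows "\<P>(\<omega> in iid (BGS \<rho>) I. M < \<bar>fst (\<omega> i)\<bar> \<or> M < \<bar>snd (\<omega> i)\<bar>) \<le> 4 * exp (- (M\<^sup>2 / 2))"
proof -
  note BGS = BGS_source(1-4)[OF \<rho>_bounds]
  note [measurable] = borel_measurable_iid_fst_snd[OF BGS(2) i_in_I]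
  have "\<P>(\<omega> in iid (BGS \<rho>) I. M < \<bar>fst (\<omega> i)\<bar> \<or> M < \<bar>snd (\<omega> i)\<bar>) \<le>
      \<P>(\<omega> in iid (BGS \<rho>) I. M < \<bar>fst (\<omega> i)\<bar>) + \<P>(\<omega> in iid (BGS \<rho>) I. M < \<bar>snd (\<omega> i)\<bar>)"
    unfolding Collect_conj_eq Collect_disj_eq Int_Un_distrib
    by (rule measure_Un_le) (simp_all flip: Collect_conj_eq)
  also have "\<dots> \<le> 2 * exp (- (M\<^sup>2 / 2)) + 2 * exp (- (M\<^sup>2 / 2))"
    by (intro add_mono subgaussian_iid_coordinate_tail distributed_std_normal_subgaussian BGS i_in_I
      M_nonneg)
  finally show ?thesis by simp
qed

lemma BGS_truncated_prob_ge:
  fixes I :: "'i set"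
  assumes \<rho>_bounds: "-1 \<le> \<rho>" "\<rho> \<le> 1" and finite_I: "finite I" and M_nonneg: "0 \<le> M"
    and sets_A: "A \<in> sets (iid (BGS \<rho>) I)"
  shows "measure (iid (BGS \<rho>) I) A - card I * (4 * exp (- (M\<^sup>2 / 2))) \<le>
    measure (iid (BGS \<rho>) I) {\<omega> \<in> A. \<forall>i\<in>I. \<bar>fst (\<omega> i)\<bar> \<le> M \<and> \<bar>snd (\<omega> i)\<bar> \<le> M}"
proof -
  let ?P = "iid (BGS \<rho>) I"
  note BGS = BGS_source(1,2)[OF \<rho>_bounds]
  interpret P: prob_space ?P by (rule prob_space_iid[OF BGS(1)])
  define F where "F i = {\<omega> \<in> space ?P. M < \<bar>fst (\<omega> i)\<bar> \<or> M < \<bar>snd (\<omega> i)\<bar>}" for i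
  have sets_F: "F i \<in> P.events" if "i \<in> I" for i
  proof -
    note [measurable] = borel_measurable_iid_fst_snd[OF BGS(2) that]
    show ?thesis unfolding F_def by measurable
  qed
  have "P.prob (A \<inter> F i) \<le> 4 * exp (- (M\<^sup>2 / 2))" if "i \<in> I" for i
  proof -
    have "P.prob (A \<inter> F i) \<le> P.prob (F i)"
      using sets_A sets_F[OF that] by (intro P.finite_measure_mono) auto
    also have "\<dots> \<le> 4 * exp (- (M\<^sup>2 / 2))"
      unfolding F_def by (rule BGS_truncation_le[OF \<rho>_bounds that M_nonneg])
    finally show ?thesis .
  qed
  then have "P.prob A - card I * (4 * exp (- (M\<^sup>2 / 2))) \<le> P.prob A - (\<Sum>i\<in>I. P.prob (A \<inter> F i))"
    by (intro diff_left_mono sum_bounded_above)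
  also have "\<dots> \<le> P.prob (A - (\<Union>i\<in>I. F i))"
    by (intro P.measure_Diff_UN_ge finite_I sets_A sets_F)
  also have "A - (\<Union>i\<in>I. F i) = {\<omega> \<in> A. \<forall>i\<in>I. \<bar>fst (\<omega> i)\<bar> \<le> M \<and> \<bar>snd (\<omega> i)\<bar> \<le> M}"
    using sets.sets_into_space[OF sets_A] by (auto simp: F_def not_less)
  finally show ?thesis .
qed

lemma BGS_threshold_prob_ge:
  fixes \<rho> \<delta> H :: real and I :: "'i set"
  assumes \<rho>_bounds: "-1 \<le> \<rho>" "\<rho> \<le> 1" and \<delta>_bounds: "0 \<le> \<delta>" "\<delta> \<le> 1" and H_ge_1: "1 \<le> H"
    and finite_nonempty_I: "finite I" "I \<noteq> {}"
    and card_I: "H\<^sup>2 \<le> real (card I)"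
  defines "s \<equiv> tail_threshold H (card I)"
  shows "exp (- ((1 + \<delta>\<^sup>2) * H) - 3) / (81 * real (card I)) \<le>
    measure (iid (BGS \<rho>) I) (innovation_tail_event \<rho> I s (\<delta> * s))"
    (is "_ \<le> ?prob")
proof -
  define \<theta> where "\<theta> = sqrt (2 * H)"
  have card_pos: "0 < real (card I)" using finite_nonempty_I by (simp add: card_gt_0_iff)
  have \<theta>_sqrt: "0 \<le> \<theta>" "\<theta>\<^sup>2 = 2 * H" using H_ge_1 by (simp_all add: \<theta>_def)
  have "\<theta> \<le> 2 * H" unfolding \<theta>_def by (rule real_le_lsqrt)
    (use H_ge_1 in \<open>auto simp: power2_eq_square\<close>)
  moreover have "\<delta> * \<theta> \<le> 1 * \<theta>" using \<delta>_bounds \<theta>_sqrt by (intro mult_right_mono) auto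
  ultimately have "3 * (\<theta> + 1) * (3 * (\<delta> * \<theta> + 1)) \<le> 3 * (3 * H) * (3 * (3 * H))"
    using \<theta>_sqrt \<delta>_bounds H_ge_1 by (intro mult_mono) auto
  also have "\<dots> \<le> 81 * real (card I)" using card_I by (simp add: power2_eq_square)
  finally have "exp (- ((1 + \<delta>\<^sup>2) * H) - 3) / (81 * real (card I)) \<le>
      exp (- ((1 + \<delta>\<^sup>2) * H) - 3) / (3 * (\<theta> + 1) * (3 * (\<delta> * \<theta> + 1)))"
    using \<theta>_sqrt \<delta>_bounds card_pos
    by (intro divide_left_mono mult_pos_pos) (auto intro: add_nonneg_pos)
  also have "\<dots> = normal_tail_bound \<theta> * normal_tail_bound (\<delta> * \<theta>)"
    unfolding normal_tail_bound_def times_divide_times_eq exp_add[symmetric] power_mult_distrib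
      \<theta>_sqrt(2)
    by (simp add: algebra_simps)
  also have "\<dots> \<le> ?prob"
    using innovation_tail_prob_ge[OF \<rho>_bounds finite_nonempty_I \<theta>_sqrt(1), of "\<delta> * \<theta>"] \<delta>_bounds
      \<theta>_sqrt(1)
    by (simp add: s_def tail_threshold_def \<theta>_def real_sqrt_mult mult.assoc)
  finally show ?thesis .
qed

lemma BGS_joint_tail_prob_ge:
  fixes \<rho> \<delta> H :: real and I :: "'i set"
  assumes \<rho>_bounds: "0 \<le> \<rho>" "\<rho> \<le> 1" and \<delta>_bounds: "0 \<le> \<delta>" "\<delta> \<le> 1" and H_ge_1: "1 \<le> H"
    and finite_nonempty_I: "finite I" "I \<noteq> {}"
  defines "n \<equiv> real (card I)"
  assumes n_ge: "H\<^sup>2 \<le> n" and small: "n\<^sup>2 * exp (- (sqrt n / 2)) \<le> exp (-3) / 648 * exp (- 2 * H)"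
  shows "exp (- ((1 + \<delta>\<^sup>2) * H) - 3) / (162 * n) \<le>
      joint_tail_prob (BGS \<rho>) (\<rho> + \<delta> * sqrt (1 - \<rho>\<^sup>2)) H I"
proof -
  let ?P = "iid (BGS \<rho>) I"
  define s M r where "s = tail_threshold H (card I)" and "M = truncation (card I)"
    and "r = sqrt (1 - \<rho>\<^sup>2)"
  define A where "A = innovation_tail_event \<rho> I s (\<delta> * s)"
  have \<rho>_ge_minus_1: "-1 \<le> \<rho>" using \<rho>_bounds by simp
  note BGS = BGS_source(1,2)[OF \<rho>_ge_minus_1 \<rho>_bounds(2)]
  interpret P: prob_space ?P by (rule prob_space_iid[OF BGS(1)])
  have sets_A: "A \<in> P.events" unfolding A_def
    by (rule sets_innovation_tail_event[OF \<rho>_ge_minus_1 \<rho>_bounds(2)])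
  have "P.prob A - n * (4 * exp (- (sqrt n / 2))) \<le>
      P.prob {\<omega> \<in> A. \<forall>i\<in>I. \<bar>fst (\<omega> i)\<bar> \<le> M \<and> \<bar>snd (\<omega> i)\<bar> \<le> M}"
    using BGS_truncated_prob_ge[OF \<rho>_ge_minus_1 \<rho>_bounds(2) finite_nonempty_I(1) _ sets_A, of M]
    by (simp add: M_def n_def)
  also have "\<dots> \<le> \<P>(\<omega> in ?P. joint_tail_event s ((\<rho> + \<delta> * r) * s) M I \<omega>)"
  proof (rule P.finite_measure_mono[OF subsetI sets_joint_tail_event[OF BGS(2) finite_nonempty_I(1)
    subset_refl]])
    fix \<omega> assume truncated: "\<omega> \<in> {\<omega> \<in> A. \<forall>i\<in>I. \<bar>fst (\<omega> i)\<bar> \<le> M \<and> \<bar>snd (\<omega> i)\<bar> \<le> M}"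
    have "\<rho> * s \<le> \<rho> * (\<Sum>i\<in>I. fst (\<omega> i))"
      using truncated \<rho>_bounds
      by (intro mult_left_mono) (auto simp: A_def innovation_tail_event_def)
    then have "(\<rho> + \<delta> * r) * s \<le> (\<Sum>i\<in>I. snd (\<omega> i))"
      using truncated by (auto simp: A_def innovation_tail_event_def r_def algebra_simps)
    then show "\<omega> \<in> {\<omega> \<in> space ?P. joint_tail_event s ((\<rho> + \<delta> * r) * s) M I \<omega>}"
      using truncated by (auto simp: A_def innovation_tail_event_def joint_tail_event_def)
  qed
  also have "\<dots> = joint_tail_prob (BGS \<rho>) (\<rho> + \<delta> * r) H I"
    by (simp only: joint_tail_prob_def s_def M_def)
  finally have "P.prob A - n * (4 * exp (- (sqrt n / 2))) \<le>
      joint_tail_prob (BGS \<rho>) (\<rho> + \<delta> * r) H I" .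
  moreover have "n * (4 * exp (- (sqrt n / 2))) \<le> exp (- ((1 + \<delta>\<^sup>2) * H) - 3) / (162 * n)"
  proof -
    have "\<delta>\<^sup>2 * H \<le> 1 * H" using \<delta>_bounds H_ge_1
      by (intro mult_right_mono) (auto simp: power_le_one)
    then have "exp (-3) * exp (- 2 * H) \<le> exp (- ((1 + \<delta>\<^sup>2) * H) - 3)"
      unfolding exp_add[symmetric] by (simp add: algebra_simps)
    moreover have "0 < n" using finite_nonempty_I by (simp add: n_def card_gt_0_iff)
    ultimately show ?thesis
      using small by (simp add: pos_le_divide_eq power2_eq_square mult_ac)
  qed
  moreover have "exp (- ((1 + \<delta>\<^sup>2) * H) - 3) / (81 * n) \<le> P.prob A"
    unfolding A_def s_def n_def
    by (rule BGS_threshold_prob_ge[OF \<rho>_ge_minus_1 \<rho>_bounds(2) \<delta>_bounds H_ge_1 finite_nonempty_I])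
      (use n_ge in \<open>simp add: n_def\<close>)
  ultimately show ?thesis by (simp add: r_def)
qed

lemma BGS_joint_tail:
  fixes \<rho> \<delta> :: real
  assumes \<rho>_bounds: "0 \<le> \<rho>" "\<rho> \<le> 1" and \<delta>_bounds: "0 \<le> \<delta>" "\<delta> \<le> 1"
  shows "\<exists>B b. joint_tail_bound (BGS \<rho>) \<delta> (\<rho> + \<delta> * sqrt (1 - \<rho>\<^sup>2)) B b 1"
proof -
  obtain B where dominated: "1 \<le> B" "\<And>H n. 1 \<le> H \<Longrightarrow> B * H ^ 6 \<le> n \<Longrightarrow>
      n\<^sup>2 * exp (- (sqrt n / 2)) \<le> exp (-3) / 648 * exp (- 2 * H)"
    by (rule exp_sqrt_dominates[of "exp (-3) / 648"]) auto
  show ?thesis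
  proof (rule joint_tail_boundI[of "162 * exp 3" B])
    fix H and I :: "nat set"
    assume H_ge_1: "1 \<le> H" and card_large: "finite I" "I \<noteq> {}" "B * H ^ 6 \<le> real (card I)"
    have "H\<^sup>2 \<le> H ^ 6" using H_ge_1 by (intro power_increasing) auto
    also have "\<dots> \<le> B * H ^ 6" using dominated(1) H_ge_1 mult_right_mono[of 1 B "H ^ 6"] by simp
    finally have "H\<^sup>2 \<le> real (card I)" using card_large(3) by linarith
    then show "exp (- ((1 + \<delta>\<^sup>2) * H)) / (162 * exp 3 * real (card I) ^ 1) \<le>
        joint_tail_prob (BGS \<rho>) (\<rho> + \<delta> * sqrt (1 - \<rho>\<^sup>2)) H I"
      using BGS_joint_tail_prob_ge[OF \<rho>_bounds \<delta>_bounds H_ge_1 card_large(1,2) _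
          dominated(2)[OF H_ge_1 card_large(3)]]
      by (simp add: exp_diff mult_ac)
  qed simp
qed

section \<open>The scheme\<close>

definition score :: "nat \<Rightarrow> nat \<Rightarrow> (nat \<Rightarrow> real) \<Rightarrow> nat \<Rightarrow> real" where
  "score k p x c = (\<Sum>i\<in>code_support k p c. x i)"

definition sole_codeword_above :: "nat \<Rightarrow> nat \<Rightarrow> real \<Rightarrow> (nat \<Rightarrow> real) \<Rightarrow> nat \<Rightarrow> bool" where
  "sole_codeword_above k p s x c \<longleftrightarrow> s \<le> score k p x c \<and> (\<forall>d<2 ^ k. s \<le> score k p x d \<longrightarrow> d = c)"

definition alice_bit :: "nat \<Rightarrow> nat \<Rightarrow> real \<Rightarrow> (nat \<Rightarrow> real) \<Rightarrow> nat \<Rightarrow> bool" where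
  "alice_bit k p s x l \<longleftrightarrow>
     (if \<exists>c<2 ^ k. sole_codeword_above k p s x c
      then \<exists>c<2 ^ k. sole_codeword_above k p s x c \<and> bit c l
      else 0 \<le> x (p\<^sup>2 + l))"

definition bob_bit :: "nat \<Rightarrow> nat \<Rightarrow> real \<Rightarrow> nat \<Rightarrow> (nat \<Rightarrow> real) \<Rightarrow> (nat \<Rightarrow> bool) \<Rightarrow> nat \<Rightarrow> bool" where
  "bob_bit k p u m y w l \<longleftrightarrow> (\<exists>c<2 ^ k. (\<forall>t<m. bit c t = w t) \<and> u \<le> score k p y c \<and> bit c l)"

definition threshold_scheme :: "nat \<Rightarrow> nat \<Rightarrow> real \<Rightarrow> real \<Rightarrow> nat \<Rightarrow> cr_scheme" where
  "threshold_scheme k p s u m = \<lparr>num_samples = p\<^sup>2 + k, msg_len = m,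
     alice_msg = (\<lambda>x. map (alice_bit k p s x) [0..<m]),
     alice_key = (\<lambda>x. map (alice_bit k p s x) [0..<k]),
     bob_key = (\<lambda>y w. map (bob_bit k p u m y (\<lambda>t. w ! t)) [0..<k])\<rparr>"

lemma threshold_scheme_simps [simp]:
  "num_samples (threshold_scheme k p s u m) = p\<^sup>2 + k"
  "msg_len (threshold_scheme k p s u m) = m"
  "alice_msg (threshold_scheme k p s u m) x = map (alice_bit k p s x) [0..<m]"
  "alice_key (threshold_scheme k p s u m) x = map (alice_bit k p s x) [0..<k]"
  "bob_key (threshold_scheme k p s u m) y w = map (bob_bit k p u m y (\<lambda>t. w ! t)) [0..<k]"
  by (simp_all add: threshold_scheme_def)

lemma finite_bool_lists [simp]: "finite {w :: bool list. length w = n}"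
  using finite_lists_length_eq[of "UNIV :: bool set" n] by simp

lemma measurable_map_bits:
  assumes "\<And>l. l < j \<Longrightarrow> Measurable.pred M (\<lambda>x. P x l)"
  shows "(\<lambda>x. map (P x) [0..<j]) \<in> M \<rightarrow>\<^sub>M count_space {K. length K = j}"
proof (subst measurable_count_space_eq2[OF finite_bool_lists], intro conjI ballI)
  show "(\<lambda>x. map (P x) [0..<j]) \<in> space M \<rightarrow> {K. length K = j}" by simp
  fix K :: "bool list" assume length_K: "K \<in> {K. length K = j}"
  have "map (P x) [0..<j] = K \<longleftrightarrow> (\<forall>l\<in>{..<j}. P x l = K ! l)" for x
    using length_K by (simp add: list_eq_iff_nth_eq[of "map (P x) [0..<j]"] Ball_def)
  then have "(\<lambda>x. map (P x) [0..<j]) -` {K} \<inter> space M = {x \<in> space M. \<forall>l\<in>{..<j}. P x l = K ! l}"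
    by blast
  also have "\<dots> \<in> sets M"
  proof (rule sets.sets_Collect_finite_All)
    fix l assume "l \<in> {..<j}"
    then have [measurable]: "Measurable.pred M (\<lambda>x. P x l)" using assms by simp
    show "{x \<in> space M. P x l = K ! l} \<in> sets M" by (cases "K ! l") simp_all
  qed simp
  finally show "(\<lambda>x. map (P x) [0..<j]) -` {K} \<inter> space M \<in> sets M" .
qed

lemma code_support_subset_samples: "code_support k p c \<subseteq> {..<p\<^sup>2 + k}"
  using code_support_subset[of k p c] by auto

lemma borel_measurable_score:
  "(\<lambda>x. score k p x c) \<in> borel_measurable (Pi\<^sub>M {..<p\<^sup>2 + k} (\<lambda>_. borel))"
  unfolding score_def using code_support_subset_samples
  by (intro borel_measurable_sum measurable_component_singleton) blast

lemma measurable_alice_bit: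
  assumes "l < k"
  shows "Measurable.pred (Pi\<^sub>M {..<p\<^sup>2 + k} (\<lambda>_. borel)) (\<lambda>x. alice_bit k p s x l)"
proof -
  note [measurable] = borel_measurable_score
  have [measurable]: "(\<lambda>x. x (p\<^sup>2 + l)) \<in> borel_measurable (Pi\<^sub>M {..<p\<^sup>2 + k} (\<lambda>_. borel))"
    by (rule measurable_component_singleton) (use assms in simp)
  show ?thesis unfolding alice_bit_def sole_codeword_above_def by measurable
qed

lemma measurable_bob_bit:
  "Measurable.pred (Pi\<^sub>M {..<p\<^sup>2 + k} (\<lambda>_. borel)) (\<lambda>y. bob_bit k p u m y w l)"
proof -
  note [measurable] = borel_measurable_score
  show ?thesis unfolding bob_bit_def by measurable
qed

lemma one_way_threshold_scheme:
  assumes "m \<le> k"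
  shows "one_way_scheme k (threshold_scheme k p s u m)"
  unfolding one_way_scheme_def threshold_scheme_simps
  using assms
  by (intro conjI allI impI measurable_map_bits measurable_alice_bit measurable_bob_bit) auto

lemma score_eq_sum_points: "score k p x c = (\<Sum>a<p. x (code_point k p c a))"
  unfolding score_def code_support_def
  by (rule sum.reindex[OF inj_on_code_point, unfolded comp_def])

lemma elementary_score:
  assumes "elem_nat A k" "elem_nat A p" "elem_nat A c" "is_drop D"
  shows "elementary A (\<lambda>xs. score (k xs) (p xs) (nth_default 0 (D xs)) (c xs))"
proof -
  note below_binders = assms(1-3)[THEN elementary_tl]
    assms(1-3)[THEN elementary_tl, THEN elementary_tl]
    elementary_tl[OF elem_nat_head_nat]
  show ?thesis unfolding score_eq_sum_points code_point_def
    by (intro elementary_sum elementary_nth_default is_drop_tl elem_intros elem_nat_of_bool assms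
      below_binders)
qed

lemma elem_bool_alice_bit:
  assumes "elem_nat A k" "elem_nat A p" "elem_nat A l" "elementary A s" "is_drop D"
  shows "elem_bool A (\<lambda>xs. alice_bit (k xs) (p xs) (s xs) (nth_default 0 (D xs)) (l xs))"
proof -
  note below_binders = assms(1-4)[THEN elementary_tl]
    assms(1-4)[THEN elementary_tl, THEN elementary_tl]
    elementary_tl[OF elem_nat_head_nat]
  show ?thesis unfolding alice_bit_def sole_codeword_above_def if_bool_eq_disj
    by (intro elem_intros elementary_score elementary_nth_default is_drop_tl assms below_binders
      elementary_zero)
qed

lemma elem_bool_bob_bit:
  assumes "elem_nat A k" "elem_nat A p" "elem_nat A l" "elementary A u" "elem_nat A m" "is_drop D"
  shows "elem_bool A (\<lambda>xs. bob_bit (k xs) (p xs) (u xs) (m xs) (nth_default 0 (D xs))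
    (\<lambda>t. nth_default 0 (D xs) ((p xs)\<^sup>2 + k xs + t) = 1) (l xs))"
proof -
  note below_binders = assms(1-5)[THEN elementary_tl]
    assms(1-5)[THEN elementary_tl, THEN elementary_tl]
    elementary_tl[OF elem_nat_head_nat]
  show ?thesis unfolding bob_bit_def
    by (intro elem_intros elem_bool_eq elementary_score elementary_nth_default is_drop_tl assms
        below_binders elementary_one)
qed

lemma score_cong:
  assumes "\<And>j. j < p\<^sup>2 \<Longrightarrow> x j = x' j"
  shows "score k p x c = score k p x' c"
  unfolding score_def using assms code_support_subset[of k p c] by (intro sum.cong) auto

lemma alice_bit_cong:
  assumes inputs_eq: "\<And>j. j < p\<^sup>2 + k \<Longrightarrow> x j = x' j" and l_less: "l < k"
  shows "alice_bit k p s x l = alice_bit k p s x' l"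
proof -
  have "score k p x c = score k p x' c" for c by (rule score_cong) (simp add: inputs_eq)
  then have "sole_codeword_above k p s x c \<longleftrightarrow> sole_codeword_above k p s x' c" for c
    by (simp add: sole_codeword_above_def)
  moreover have "x (p\<^sup>2 + l) = x' (p\<^sup>2 + l)"
    using l_less by (intro inputs_eq) simp
  ultimately show ?thesis by (simp only: alice_bit_def)
qed

lemma bob_bit_cong:
  assumes inputs_eq: "\<And>j. j < p\<^sup>2 + k \<Longrightarrow> y j = y' j" and messages_eq: "\<And>t. t < m \<Longrightarrow> w t = w' t"
  shows "bob_bit k p u m y w l = bob_bit k p u m y' w' l"
proof -
  have "score k p y c = score k p y' c" for c by (rule score_cong) (simp add: inputs_eq)
  then show ?thesis unfolding bob_bit_def using messages_eq by simp
qed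

lemma nth_default_received:
  fixes x :: "nat \<Rightarrow> real"
  shows "j < n \<Longrightarrow> nth_default 0 (drop 2 (i # k # map x [0..<n] @ ys)) j = x j"
    and "t < length w \<Longrightarrow> nth_default 0 (drop 2 (i # k # map x [0..<n] @ map of_bool w)) (n + t) =
        of_bool (w ! t)"
  by (simp_all add: nth_default_def nth_append)

lemma ex_elementary_alice_bit:
  fixes p :: "nat \<Rightarrow> nat" and s :: "nat \<Rightarrow> real"
  assumes elem_nat_p: "\<And>f. elem_nat A f \<Longrightarrow> elem_nat A (\<lambda>xs. p (f xs))"
    and elementary_s: "\<And>f. elem_nat A f \<Longrightarrow> elementary A (\<lambda>xs. s (f xs))"
  shows "\<exists>f. elementary A f \<and> (\<forall>k x. \<forall>i<k.
    of_bool (alice_bit k (p k) (s k) x i) = f (real i # real k # map x [0..<(p k)\<^sup>2 + k]))"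
proof -
  let ?key = "\<lambda>xs. head_nat (tl xs)" and ?data = "\<lambda>xs. nth_default 0 (drop 2 xs) :: nat \<Rightarrow> real"
  define f :: "real list \<Rightarrow> real"
    where "f xs =
        of_bool (alice_bit (?key xs) (p (?key xs)) (s (?key xs)) (?data xs) (head_nat xs))" for xs
  have "elementary A f"
    unfolding f_def
    by (intro elem_bool_alice_bit elem_nat_p elementary_s elementary_tl[OF elem_nat_head_nat]
        elem_nat_head_nat is_drop_drop)
  moreover have "of_bool (alice_bit k (p k) (s k) x i) =
      f (real i # real k # map x [0..<(p k)\<^sup>2 + k])"
    if "i < k" for i k x
  proof -
    have "?data (real i # real k # map x [0..<(p k)\<^sup>2 + k]) j = x j" if "j < (p k)\<^sup>2 + k" for j
      using nth_default_received(1)[OF that, of _ _ x "[]"] by simp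
    from alice_bit_cong[OF this \<open>i < k\<close>] show ?thesis by (simp add: f_def)
  qed
  ultimately show ?thesis by blast
qed

lemma ex_elementary_bob_bit:
  fixes p m :: "nat \<Rightarrow> nat" and u :: "nat \<Rightarrow> real"
  assumes elem_nat_p: "\<And>f. elem_nat A f \<Longrightarrow> elem_nat A (\<lambda>xs. p (f xs))"
    and elementary_u: "\<And>f. elem_nat A f \<Longrightarrow> elementary A (\<lambda>xs. u (f xs))"
    and elem_nat_m: "\<And>f. elem_nat A f \<Longrightarrow> elem_nat A (\<lambda>xs. m (f xs))"
  shows "\<exists>f. elementary A f \<and> (\<forall>k y w. length w = m k \<longrightarrow> (\<forall>i<k.
    of_bool (bob_bit k (p k) (u k) (m k) y (\<lambda>t. w ! t) i) =
      f (real i # real k # map y [0..<(p k)\<^sup>2 + k] @ map of_bool w)))"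
proof -
  let ?key = "\<lambda>xs. head_nat (tl xs)" and ?data = "\<lambda>xs. nth_default 0 (drop 2 xs) :: nat \<Rightarrow> real"
  define f :: "real list \<Rightarrow> real"
    where "f xs = of_bool (bob_bit (?key xs) (p (?key xs)) (u (?key xs)) (m (?key xs)) (?data xs)
      (\<lambda>t. ?data xs ((p (?key xs))\<^sup>2 + ?key xs + t) = 1) (head_nat xs))" for xs
  have "elementary A f"
    unfolding f_def
    by (intro elem_bool_bob_bit elem_nat_p elementary_u elem_nat_m
        elementary_tl[OF elem_nat_head_nat] elem_nat_head_nat is_drop_drop)
  moreover have "of_bool (bob_bit k (p k) (u k) (m k) y (\<lambda>t. w ! t) i) =
      f (real i # real k # map y [0..<(p k)\<^sup>2 + k] @ map of_bool w)"
    if length_w: "length w = m k" for i k y w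
  proof -
    let ?xs = "real i # real k # map y [0..<(p k)\<^sup>2 + k] @ map of_bool w"
    have "bob_bit k (p k) (u k) (m k) (?data ?xs) (\<lambda>t. ?data ?xs ((p k)\<^sup>2 + k + t) = 1) i =
        bob_bit k (p k) (u k) (m k) y (\<lambda>t. w ! t) i"
      by (rule bob_bit_cong) (simp_all only: nth_default_received length_w of_bool_eq_1_iff)
    then show ?thesis by (simp add: f_def)
  qed
  ultimately show ?thesis by blast
qed

lemma explicit_family_threshold_scheme:
  fixes p m :: "nat \<Rightarrow> nat" and s u :: "nat \<Rightarrow> real"
  assumes elem_nat_p: "\<And>f. elem_nat A f \<Longrightarrow> elem_nat A (\<lambda>xs. p (f xs))"
    and elem_nat_m: "\<And>f. elem_nat A f \<Longrightarrow> elem_nat A (\<lambda>xs. m (f xs))"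
    and elementary_s: "\<And>f. elem_nat A f \<Longrightarrow> elementary A (\<lambda>xs. s (f xs))"
    and elementary_u: "\<And>f. elem_nat A f \<Longrightarrow> elementary A (\<lambda>xs. u (f xs))"
    and m_le: "\<And>k. m k \<le> k"
  shows "explicit_family A (\<lambda>k. threshold_scheme k (p k) (s k) (u k) (m k))"
  unfolding explicit_family_def threshold_scheme_simps
proof (intro conjI)
  let ?n = "\<lambda>k. (p k)\<^sup>2 + k"
  have "elem_nat A (\<lambda>xs. ?n (head_nat xs))"
    by (intro elem_intros elem_nat_p)
  then show "\<exists>f. elementary A f \<and> (\<forall>k. real (?n k) = f [real k])"
    by (intro exI[of _ "\<lambda>xs. real (?n (head_nat xs))"]) simp
  show "\<exists>f. elementary A f \<and> (\<forall>k. real (m k) = f [real k])"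
    by (rule exI[of _ "\<lambda>xs. real (m (head_nat xs))"]) (use elem_nat_m[OF elem_nat_head_nat] in auto)
  obtain f where alice_formula: "elementary A f" "\<And>k x i. i < k \<Longrightarrow>
      of_bool (alice_bit k (p k) (s k) x i) = f (real i # real k # map x [0..<?n k])"
    using ex_elementary_alice_bit[where p = p and s = s, OF elem_nat_p elementary_s] by blast
  show "\<exists>f. elementary A f \<and> (\<forall>k x. \<forall>i<m k.
      of_bool (map (alice_bit k (p k) (s k) x) [0..<m k] ! i) =
        f (real i # real k # map x [0..<?n k]))"
    using alice_formula less_le_trans[OF _ m_le] by (intro exI[of _ f]) simp
  show "\<exists>f. elementary A f \<and> (\<forall>k x. \<forall>i<k. of_bool (map (alice_bit k (p k) (s k) x) [0..<k] ! i) =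
      f (real i # real k # map x [0..<?n k]))"
    using alice_formula by (intro exI[of _ f]) simp
  show "\<exists>f. elementary A f \<and> (\<forall>k y w. length w = m k \<longrightarrow> (\<forall>i<k.
      of_bool (map (bob_bit k (p k) (u k) (m k) y (\<lambda>t. w ! t)) [0..<k] ! i) =
        f (real i # real k # map y [0..<?n k] @ map of_bool w)))"
    using ex_elementary_bob_bit[where p = p and u = u and m = m,
        OF elem_nat_p elementary_u elem_nat_m] by simp
qed

section \<open>Min-entropy of the key\<close>

lemma min_entropy_ge:
  fixes h :: real
  assumes prob_space_M: "prob_space M" and measurable_V: "V \<in> M \<rightarrow>\<^sub>M count_space S"
    and finite_S: "finite S"
    and prob_le: "\<And>v. \<P>(\<omega> in M. V \<omega> = v) \<le> 2 powr (- h)"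
  shows "h \<le> min_entropy M V"
proof -
  interpret prob_space M by (rule prob_space_M)
  let ?q = "\<lambda>v. \<P>(\<omega> in M. V \<omega> = v)"
  have bdd: "bdd_above (range ?q)" by (rule bdd_aboveI[of _ 1]) auto
  have sets_value: "{\<omega> \<in> space M. V \<omega> = v} \<in> sets M" if "v \<in> S" for v
    using measurable_sets[OF measurable_V, of "{v}"] that
    by (simp add: vimage_def Int_def conj_commute)
  have "space M = (\<Union>v\<in>S. {\<omega> \<in> space M. V \<omega> = v})"
    using measurable_space[OF measurable_V] by auto
  then have "1 = prob (\<Union>v\<in>S. {\<omega> \<in> space M. V \<omega> = v})" using prob_space by simp
  also have "\<dots> \<le> (\<Sum>v\<in>S. ?q v)" by (rule measure_UNION_le[OF finite_S sets_value])
  also have "\<dots> \<le> (\<Sum>v\<in>S. SUP v. ?q v)" by (intro sum_mono cSUP_upper bdd) simp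
  finally have "0 < real (card S) * (SUP v. ?q v)"
    by simp
  then have "0 < (SUP v. ?q v)"
    by (simp add: zero_less_mult_iff)
  moreover have "(SUP v. ?q v) \<le> 2 powr (- h)"
    by (rule cSUP_least) (use prob_le in auto)
  ultimately have "log 2 (SUP v. ?q v) \<le> - h"
    by (simp add: log_le_iff)
  then show ?thesis by (simp add: min_entropy_def)
qed

lemma measurable_inputs:
  assumes "sets \<mu> = sets borel"
  shows "alice_input n \<in> iid_samples \<mu> n \<rightarrow>\<^sub>M Pi\<^sub>M {..<n} (\<lambda>_. borel)"
    and "bob_input n \<in> iid_samples \<mu> n \<rightarrow>\<^sub>M Pi\<^sub>M {..<n} (\<lambda>_. borel)"
  unfolding iid_samples_def alice_input_def bob_input_def
  by (rule measurable_restrict, rule borel_measurable_iid_fst_snd[OF assms], assumption)+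

lemma measurable_keys:
  assumes one_way: "one_way_scheme k S" and sets_\<mu>: "sets \<mu> = sets borel"
  defines "n \<equiv> num_samples S"
  shows "(\<lambda>\<omega>. alice_key S (alice_input n \<omega>)) \<in> iid_samples \<mu> n \<rightarrow>\<^sub>M count_space {K. length K = k}"
    and "(\<lambda>\<omega>. bob_key S (bob_input n \<omega>) (alice_msg S (alice_input n \<omega>))) \<in>
      iid_samples \<mu> n \<rightarrow>\<^sub>M count_space {K. length K = k}"
proof -
  note inputs = measurable_inputs[OF sets_\<mu>, of n]
  show "(\<lambda>\<omega>. alice_key S (alice_input n \<omega>)) \<in> iid_samples \<mu> n \<rightarrow>\<^sub>M count_space {K. length K = k}"
    by (rule measurable_compose[OF inputs(1)]) (use one_way in \<open>simp add: one_way_scheme_def n_def\<close>)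
  have measurable_msg: "(\<lambda>\<omega>. alice_msg S (alice_input n \<omega>)) \<in>
      iid_samples \<mu> n \<rightarrow>\<^sub>M count_space {m. length m = msg_len S}"
    by (rule measurable_compose[OF inputs(1)]) (use one_way in \<open>simp add: one_way_scheme_def n_def\<close>)
  show "(\<lambda>\<omega>. bob_key S (bob_input n \<omega>) (alice_msg S (alice_input n \<omega>))) \<in>
      iid_samples \<mu> n \<rightarrow>\<^sub>M count_space {K. length K = k}"
  proof (rule measurable_compose_countable'[OF _ measurable_msg])
    fix m :: "bool list" assume length_m: "m \<in> {m. length m = msg_len S}"
    show "(\<lambda>\<omega>. bob_key S (bob_input n \<omega>) m) \<in> iid_samples \<mu> n \<rightarrow>\<^sub>M count_space {K. length K = k}"
      by (rule measurable_compose[OF inputs(2)])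
        (use one_way length_m in \<open>simp add: one_way_scheme_def n_def\<close>)
  qed (simp add: countable_finite)
qed

lemma sets_agreement:
  assumes one_way: "one_way_scheme k S" and sets_\<mu>: "sets \<mu> = sets borel"
  defines "n \<equiv> num_samples S"
  shows "{\<omega> \<in> space (iid_samples \<mu> n). alice_key S (alice_input n \<omega>) =
    bob_key S (bob_input n \<omega>) (alice_msg S (alice_input n \<omega>))} \<in> sets (iid_samples \<mu> n)"
proof -
  let ?P = "iid_samples \<mu> n" and ?alice = "\<lambda>\<omega>. alice_key S (alice_input n \<omega>)"
    and ?bob = "\<lambda>\<omega>. bob_key S (bob_input n \<omega>) (alice_msg S (alice_input n \<omega>))"
  note keys = measurable_keys[OF one_way sets_\<mu>, folded n_def]
  have "Measurable.pred ?P (\<lambda>\<omega>. ?alice \<omega> = ?bob \<omega>)"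
  proof (rule measurable_compose_countable'[OF _ keys(1)])
    fix K :: "bool list"
    have "?bob \<in> ?P \<rightarrow>\<^sub>M count_space UNIV"
      by (rule measurable_compose[OF keys(2) measurable_count_space])
    then show "Measurable.pred ?P (\<lambda>\<omega>. K = ?bob \<omega>)"
      by (rule pred_count_space_const2)
  qed (simp add: countable_finite)
  then show ?thesis by (simp only: pred_def)
qed

lemma tail_threshold_nonneg: "0 \<le> H \<Longrightarrow> 0 \<le> tail_threshold H n"
  and tail_threshold_square: "0 \<le> H \<Longrightarrow> (tail_threshold H n)\<^sup>2 = 2 * H * real n"
  by (simp_all add: tail_threshold_def)

lemma alice_bit_eq_bit:
  assumes sole_c: "c < 2 ^ k" "sole_codeword_above k p s x c"
  shows "alice_bit k p s x l \<longleftrightarrow> bit c l"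
proof -
  have "d = c" if "d < 2 ^ k" "sole_codeword_above k p s x d" for d
    using that sole_c unfolding sole_codeword_above_def by blast
  then show ?thesis
    unfolding alice_bit_def using sole_c by metis
qed

lemma alice_key_cases:
  assumes key_eq: "map (alice_bit k p s x) [0..<k] = v"
  obtains (codeword) c where "c < 2 ^ k" "\<And>l. l < k \<Longrightarrow> bit c l = v ! l" "s \<le> score k p x c"
  | (signs) "\<And>l. l < k \<Longrightarrow> (0 \<le> x (p\<^sup>2 + l)) = v ! l"
proof (cases "\<exists>c<2 ^ k. sole_codeword_above k p s x c")
  case True
  then obtain c where sole_c: "c < 2 ^ k" "sole_codeword_above k p s x c" by blast
  have "bit c l = v ! l" if "l < k" for l
    using that alice_bit_eq_bit[OF sole_c, of l] unfolding key_eq[symmetric] by simp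
  then show ?thesis
    using sole_c unfolding sole_codeword_above_def by (intro codeword[of c]) blast+
next
  case False
  then have "alice_bit k p s x l \<longleftrightarrow> 0 \<le> x (p\<^sup>2 + l)" for l
    by (simp only: alice_bit_def if_False)
  then have "(0 \<le> x (p\<^sup>2 + l)) = v ! l" if "l < k" for l
    using that unfolding key_eq[symmetric] by simp
  then show ?thesis by (rule signs)
qed

locale key_source =
  fixes \<mu> :: "(real \<times> real) measure"
  assumes prob_space_source: "prob_space \<mu>" and sets_source: "sets \<mu> = sets borel"
    and subgaussian_fst: "subgaussian \<mu> fst" and subgaussian_snd: "subgaussian \<mu> snd"
    and fst_nonneg_half: "\<P>(x in \<mu>. 0 \<le> fst x) = 1 / 2"
begin

lemma sets_sign: "{x \<in> space \<mu>. (0 \<le> fst x) = b} \<in> sets \<mu>"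
proof -
  have [measurable]: "fst \<in> borel_measurable \<mu>"
    by (rule borel_measurable_fst_snd(1)[OF sets_source])
  show ?thesis by (cases b) simp_all
qed

lemma prob_sign: "\<P>(x in \<mu>. (0 \<le> fst x) = b) = 1 / 2"
proof (cases b)
  case False
  interpret prob_space \<mu> by (rule prob_space_source)
  have "\<P>(x in \<mu>. (0 \<le> fst x) = b) = prob (space \<mu> - {x \<in> space \<mu>. 0 \<le> fst x})"
    using False by (auto intro!: arg_cong[of _ _ prob])
  then show ?thesis using prob_compl[OF sets_sign[of True]] fst_nonneg_half by simp
qed (use fst_nonneg_half in simp)

lemma sets_signs:
  assumes finite_subset_J: "finite J" "J \<subseteq> K"
  shows "{\<omega> \<in> space (iid \<mu> K). \<forall>j\<in>J. (0 \<le> fst (\<omega> j)) = b j} \<in> sets (iid \<mu> K)"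
proof (rule sets.sets_Collect_finite_All[OF _ finite_subset_J(1)])
  fix j assume "j \<in> J"
  then have j_in_K: "j \<in> K" using finite_subset_J(2) by blast
  have "{\<omega> \<in> space (iid \<mu> K). (0 \<le> fst (\<omega> j)) = b j} =
      (\<lambda>\<omega>. \<omega> j) -` {x \<in> space \<mu>. (0 \<le> fst x) = b j} \<inter> space (iid \<mu> K)"
    using j_in_K by (auto simp: space_PiM)
  also have "\<dots> \<in> sets (iid \<mu> K)"
    by (rule measurable_sets[OF measurable_component_singleton[OF j_in_K] sets_sign])
  finally show "{\<omega> \<in> space (iid \<mu> K). (0 \<le> fst (\<omega> j)) = b j} \<in> sets (iid \<mu> K)" .
qed

lemma prob_signs:
  assumes finite_subset_J: "finite J" "J \<subseteq> K"
  shows "\<P>(\<omega> in iid \<mu> K. \<forall>j\<in>J. (0 \<le> fst (\<omega> j)) = b j) = (1 / 2) ^ card J"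
proof -
  interpret \<mu>: prob_space \<mu> by (rule prob_space_source)
  interpret product_prob_space "\<lambda>_. \<mu>" K by (rule product_prob_spaceI) (rule prob_space_source)
  have "{\<omega> \<in> space (iid \<mu> K). \<forall>j\<in>J. (0 \<le> fst (\<omega> j)) = b j} =
      {\<omega> \<in> space (iid \<mu> K). \<forall>j\<in>J. \<omega> j \<in> {x \<in> space \<mu>. (0 \<le> fst x) = b j}}"
    using finite_subset_J(2) by (auto simp: space_PiM)
  then have "emeasure (iid \<mu> K) {\<omega> \<in> space (iid \<mu> K). \<forall>j\<in>J. (0 \<le> fst (\<omega> j)) = b j} =
      ennreal ((1 / 2) ^ card J)"
    using emeasure_PiM_Collect[OF finite_subset_J(2,1) sets_sign, of b]
    by (simp only: \<mu>.emeasure_eq_measure prob_sign prod_constant ennreal_power)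
  then show ?thesis by (simp add: emeasure_eq_measure)
qed

lemma score_inputs:
  shows "score k p (alice_input (p\<^sup>2 + k) \<omega>) c = (\<Sum>i\<in>code_support k p c. fst (\<omega> i))"
    and "score k p (bob_input (p\<^sup>2 + k) \<omega>) c = (\<Sum>i\<in>code_support k p c. snd (\<omega> i))"
proof -
  have "i < p\<^sup>2 + k" if "i \<in> code_support k p c" for i
    using that code_support_subset_samples[of k p c] by blast
  then show "score k p (alice_input (p\<^sup>2 + k) \<omega>) c = (\<Sum>i\<in>code_support k p c. fst (\<omega> i))"
    and "score k p (bob_input (p\<^sup>2 + k) \<omega>) c = (\<Sum>i\<in>code_support k p c. snd (\<omega> i))"
    unfolding score_def alice_input_def bob_input_def by (simp_all cong: sum.cong)
qed

lemma prob_codeword_above_le: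
  assumes p_pos: "0 < p" and H_nonneg: "0 \<le> H" and support_subset: "code_support k p c \<subseteq> K"
  shows "\<P>(\<omega> in iid \<mu> K. tail_threshold H p \<le> (\<Sum>i\<in>code_support k p c. fst (\<omega> i))) \<le> exp (- H)"
proof -
  let ?s = "tail_threshold H p"
  have "\<P>(\<omega> in iid \<mu> K. ?s \<le> (\<Sum>i\<in>code_support k p c. fst (\<omega> i))) \<le>
      exp (real (card (code_support k p c)) * ((?s / p)\<^sup>2 / 2) - ?s / p * ?s)"
    using support_subset tail_threshold_nonneg[OF H_nonneg]
    by (intro subgaussian_iid_sum_tail[OF prob_space_source subgaussian_fst]) auto
  also have "real (card (code_support k p c)) * ((?s / p)\<^sup>2 / 2) - ?s / p * ?s = - (?s\<^sup>2 / (2 * p))"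
    using p_pos by (simp add: power2_eq_square field_simps)
  finally show ?thesis
    using p_pos by (simp add: tail_threshold_square[OF H_nonneg])
qed

definition codeword_tail_event :: "nat \<Rightarrow> nat \<Rightarrow> real \<Rightarrow> bool list \<Rightarrow> (nat \<Rightarrow> real \<times> real) set" where
  "codeword_tail_event k p H v = {\<omega> \<in> space (iid \<mu> {..<p\<^sup>2 + k}).
     \<exists>c<2 ^ k. (\<forall>l<k. bit c l = v ! l) \<and> tail_threshold H p \<le> (\<Sum>i\<in>code_support k p c. fst (\<omega> i))}"

definition sign_event :: "nat \<Rightarrow> nat \<Rightarrow> bool list \<Rightarrow> (nat \<Rightarrow> real \<times> real) set" where
  "sign_event k p v = {\<omega> \<in> space (iid \<mu> {..<p\<^sup>2 + k}). \<forall>l<k. (0 \<le> fst (\<omega> (p\<^sup>2 + l))) = v ! l}"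

lemma codeword_tail_event_cases:
  obtains "codeword_tail_event k p H v = {}"
  | c where "codeword_tail_event k p H v =
      {\<omega> \<in> space (iid \<mu> {..<p\<^sup>2 + k}). tail_threshold H p \<le> (\<Sum>i\<in>code_support k p c. fst (\<omega> i))}"
proof (cases "\<exists>c :: nat. c < 2 ^ k \<and> (\<forall>l<k. bit c l = v ! l)")
  case True
  then obtain c :: nat where matching_c: "c < 2 ^ k" "\<forall>l<k. bit c l = v ! l" by blast
  have "d = c" if "d < 2 ^ k" "\<forall>l<k. bit d l = v ! l" for d
    using that matching_c by (intro codeword_eqI) auto
  then show thesis
    using matching_c by (intro that(2)[of c]) (unfold codeword_tail_event_def, blast)
next
  case False
  then show thesis by (intro that(1)) (auto simp: codeword_tail_event_def)
qed

lemma prob_codeword_tail_event_le: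
  assumes "0 < p" "0 \<le> H"
  shows "codeword_tail_event k p H v \<in> sets (iid \<mu> {..<p\<^sup>2 + k})"
    and "measure (iid \<mu> {..<p\<^sup>2 + k}) (codeword_tail_event k p H v) \<le> exp (- H)"
proof -
  have "{\<omega> \<in> space (iid \<mu> {..<p\<^sup>2 + k}). tail_threshold H p \<le> (\<Sum>i\<in>code_support k p c. fst (\<omega> i))}
      \<in> sets (iid \<mu> {..<p\<^sup>2 + k})" for c
    by (intro borel_measurable_le borel_measurable_const
        borel_measurable_iid_sum_fst_snd(1)[OF sets_source code_support_subset_samples])
  then show "codeword_tail_event k p H v \<in> sets (iid \<mu> {..<p\<^sup>2 + k})"
    by (cases rule: codeword_tail_event_cases[of k p H v]) simp_all
  show "measure (iid \<mu> {..<p\<^sup>2 + k}) (codeword_tail_event k p H v) \<le> exp (- H)"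
    using prob_codeword_above_le[OF assms code_support_subset_samples]
    by (cases rule: codeword_tail_event_cases[of k p H v]) simp_all
qed

lemma prob_sign_event:
  "sign_event k p v \<in> sets (iid \<mu> {..<p\<^sup>2 + k})"
  "measure (iid \<mu> {..<p\<^sup>2 + k}) (sign_event k p v) = (1 / 2) ^ k"
proof -
  let ?J = "{p\<^sup>2..<p\<^sup>2 + k}" and ?b = "\<lambda>j. v ! (j - p\<^sup>2)"
  have sign_event_eq: "sign_event k p v =
      {\<omega> \<in> space (iid \<mu> {..<p\<^sup>2 + k}). \<forall>j\<in>?J. (0 \<le> fst (\<omega> j)) = ?b j}"
    by (auto simp: sign_event_def le_iff_add)
  have finite_subset_J: "finite ?J" "?J \<subseteq> {..<p\<^sup>2 + k}" by auto
  show "sign_event k p v \<in> sets (iid \<mu> {..<p\<^sup>2 + k})"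
    unfolding sign_event_eq by (rule sets_signs[OF finite_subset_J])
  show "measure (iid \<mu> {..<p\<^sup>2 + k}) (sign_event k p v) = (1 / 2) ^ k"
    unfolding sign_event_eq prob_signs[OF finite_subset_J] by simp
qed

lemma key_event_subset:
  "{\<omega> \<in> space (iid \<mu> {..<p\<^sup>2 + k}).
      map (alice_bit k p (tail_threshold H p) (alice_input (p\<^sup>2 + k) \<omega>)) [0..<k] = v}
    \<subseteq> codeword_tail_event k p H v \<union> sign_event k p v"
proof clarify
  fix \<omega> assume \<omega>_in_space: "\<omega> \<in> space (iid \<mu> {..<p\<^sup>2 + k})"
    and no_signs: "\<omega> \<notin> sign_event k p
      (map (alice_bit k p (tail_threshold H p) (alice_input (p\<^sup>2 + k) \<omega>)) [0..<k])"
  show "\<omega> \<in> codeword_tail_event k p H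
      (map (alice_bit k p (tail_threshold H p) (alice_input (p\<^sup>2 + k) \<omega>)) [0..<k])"
  proof (cases rule:
      alice_key_cases[OF refl, of k p "tail_threshold H p" "alice_input (p\<^sup>2 + k) \<omega>"])
    case (1 c)
    then show ?thesis
      unfolding codeword_tail_event_def score_inputs using \<omega>_in_space by blast
  next
    case 2
    then show ?thesis
      using \<omega>_in_space no_signs by (simp add: sign_event_def alice_input_def)
  qed
qed

lemma prob_key_le:
  fixes k p :: nat
  assumes p_pos: "0 < p" and H_ge: "real k * ln 2 \<le> H"
  defines "n \<equiv> p\<^sup>2 + k"
  shows "\<P>(\<omega> in iid_samples \<mu> n.
      map (alice_bit k p (tail_threshold H p) (alice_input n \<omega>)) [0..<k] = v)
    \<le> 2 powr (- (real k - 1))"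
proof -
  interpret P: prob_space "iid \<mu> {..<n}" by (rule prob_space_iid[OF prob_space_source])
  let ?A = "codeword_tail_event k p H v" and ?B = "sign_event k p v"
  have "0 \<le> real k * ln 2" by simp
  then have "0 \<le> H" using H_ge by linarith
  note codeword = prob_codeword_tail_event_le[OF p_pos \<open>0 \<le> H\<close>, of k v, folded n_def]
  note sign = prob_sign_event[where k = k and p = p and v = v, folded n_def]
  have "\<P>(\<omega> in iid \<mu> {..<n}.
        map (alice_bit k p (tail_threshold H p) (alice_input n \<omega>)) [0..<k] = v) \<le>
      P.prob (?A \<union> ?B)"
    by (rule P.finite_measure_mono[OF key_event_subset[where k = k and p = p, folded n_def]
          sets.Un[OF codeword(1) sign(1)]])
  also have "\<dots> \<le> P.prob ?A + P.prob ?B"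
    using codeword(1) sign(1) by (rule measure_Un_le)
  also have "\<dots> \<le> exp (- (real k * ln 2)) + (1 / 2) ^ k"
    using codeword(2) sign(2) H_ge exp_le_cancel_iff[of "- H" "- (real k * ln 2)"] by linarith
  also have "exp (- (real k * ln 2)) = (1 / 2) ^ k"
    by (simp add: exp_minus exp_of_nat_mult power_one_over inverse_eq_divide)
  also have "(1 / 2) ^ k + (1 / 2) ^ k = 2 powr (- (real k - 1))"
    by (simp add: powr_diff powr_realpow power_one_over powr_minus_divide)
  finally show ?thesis by (simp only: iid_samples_def)
qed

lemma key_min_entropy_ge:
  assumes p_pos: "0 < p" and H_ge: "real k * ln 2 \<le> H" and m_le: "m \<le> k"
  shows "real k - 1 \<le> key_min_entropy \<mu> (threshold_scheme k p (tail_threshold H p) u m)"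
  unfolding key_min_entropy_def
proof (rule min_entropy_ge)
  let ?S = "threshold_scheme k p (tail_threshold H p) u m"
  show "prob_space (iid_samples \<mu> (num_samples ?S))"
    unfolding iid_samples_def by (rule prob_space_iid[OF prob_space_source])
  show "(\<lambda>\<omega>. alice_key ?S (alice_input (num_samples ?S) \<omega>)) \<in>
      iid_samples \<mu> (num_samples ?S) \<rightarrow>\<^sub>M count_space {K. length K = k}"
    by (rule measurable_keys(1)[OF one_way_threshold_scheme[OF m_le] sets_source])
  show "\<P>(\<omega> in iid_samples \<mu> (num_samples ?S). alice_key ?S (alice_input (num_samples ?S) \<omega>) = v)
      \<le> 2 powr (- (real k - 1))" for v
    using prob_key_le[OF p_pos H_ge] by simp
qed simp

end

section \<open>Agreement of the keys\<close>

lemma take_bit_eq_iff_bits: "take_bit m d = take_bit m c \<longleftrightarrow> (\<forall>t<m. bit d t = bit c t)"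
  for c d :: nat
  by (auto simp: bit_eq_iff bit_take_bit_iff)

lemma bob_bit_eq_bit:
  assumes c_above: "c < 2 ^ k" "u \<le> score k p y c" and prefix: "\<And>t. t < m \<Longrightarrow> w t = bit c t"
    and below: "\<And>d. d < 2 ^ k \<Longrightarrow> d \<noteq> c \<Longrightarrow> take_bit m d = take_bit m c \<Longrightarrow> score k p y d < u"
  shows "bob_bit k p u m y w l \<longleftrightarrow> bit c l"
proof -
  have "d = c" if "d < 2 ^ k" "\<forall>t<m. bit d t = w t" "u \<le> score k p y d" for d
  proof (rule ccontr)
    assume "d \<noteq> c"
    moreover have "take_bit m d = take_bit m c"
      using that(2) prefix by (simp add: take_bit_eq_iff_bits)
    ultimately show False using below[of d] that(1,3) by simp
  qed
  moreover have "\<forall>t<m. bit c t = w t" using prefix by simp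
  ultimately show ?thesis
    unfolding bob_bit_def using c_above by blast
qed

lemma keys_agree:
  assumes c_less: "c < 2 ^ k"
    and alice_sole: "s \<le> score k p x c" "\<And>d. d < 2 ^ k \<Longrightarrow> d \<noteq> c \<Longrightarrow> score k p x d < s"
    and bob_sole: "u \<le> score k p y c"
      "\<And>d. d < 2 ^ k \<Longrightarrow> d \<noteq> c \<Longrightarrow> take_bit m d = take_bit m c \<Longrightarrow> score k p y d < u"
  defines "S \<equiv> threshold_scheme k p s u m"
  shows "alice_key S x = bob_key S y (alice_msg S x)"
proof -
  have "d = c" if "d < 2 ^ k" "s \<le> score k p x d" for d
    using alice_sole(2)[of d] that by linarith
  then have "sole_codeword_above k p s x c"
    using alice_sole(1) by (simp add: sole_codeword_above_def)
  then have alice_bit_eq: "alice_bit k p s x l = bit c l" for l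
    using c_less by (intro alice_bit_eq_bit)
  have "bob_bit k p u m y (\<lambda>t. map (alice_bit k p s x) [0..<m] ! t) l = bit c l" for l
    using c_less bob_sole by (intro bob_bit_eq_bit) (simp_all add: alice_bit_eq)
  then show ?thesis
    by (simp add: S_def alice_bit_eq)
qed

lemma joint_tail_event_restrict [simp]:
  "joint_tail_event s u M I (restrict \<omega> I) = joint_tail_event s u M I \<omega>"
  by (simp add: joint_tail_event_def cong: sum.cong)

locale threshold_code = key_source +
  fixes k p m :: nat and H \<phi> :: real
  assumes prime_p: "prime p" and m_le: "m \<le> k" and H_nonneg: "0 \<le> H" and \<phi>_nonneg: "0 \<le> \<phi>"
    and \<phi>_le_1: "\<phi> \<le> 1"
    and overlap_small: "tail_threshold H p / p * (k * truncation p) \<le> ln 2"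
    and few_codewords: "2 ^ k * (2 * exp (- H)) \<le> 1 / 4"
    and few_candidates: "2 ^ (k - m) * (2 * exp (- (\<phi>\<^sup>2 * H))) \<le> 1 / 4"
begin

abbreviation P :: "(nat \<Rightarrow> real \<times> real) measure" where "P \<equiv> iid \<mu> {..<p\<^sup>2 + k}"
abbreviation supp :: "nat \<Rightarrow> nat set" where "supp c \<equiv> code_support k p c"
abbreviation threshold :: real where "threshold \<equiv> tail_threshold H p"

definition above :: "(real \<times> real \<Rightarrow> real) \<Rightarrow> real \<Rightarrow> nat \<Rightarrow> (nat \<Rightarrow> real \<times> real) set" where
  "above f u c = {\<omega> \<in> space P. u \<le> (\<Sum>i\<in>supp c. f (\<omega> i))}"

definition joint_event :: "nat \<Rightarrow> (nat \<Rightarrow> real \<times> real) set" where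
  "joint_event c =
     {\<omega> \<in> space P. joint_tail_event threshold (\<phi> * threshold) (truncation p) (supp c) \<omega>}"

definition rivals :: "nat \<Rightarrow> nat set" where
  "rivals c = {d. d < 2 ^ k \<and> take_bit m d = take_bit m c} - {c}"

definition agreement_event :: "nat \<Rightarrow> (nat \<Rightarrow> real \<times> real) set" where
  "agreement_event c = joint_event c - (\<Union>d\<in>{..<2 ^ k} - {c}. above fst threshold d)
     - (\<Union>d\<in>rivals c. above snd (\<phi> * threshold) d)"

lemma finite_rivals: "finite (rivals c)"
  by (simp add: rivals_def)

lemma sets_above:
  "above fst u c \<in> sets P" "above snd u c \<in> sets P"
  unfolding above_def
  by (intro borel_measurable_le borel_measurable_const
      borel_measurable_iid_sum_fst_snd[OF sets_source code_support_subset_samples])+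

lemma sets_joint_event: "joint_event c \<in> sets P"
  unfolding joint_event_def
  by (rule sets_joint_tail_event[OF sets_source finite_code_support code_support_subset_samples])

lemma sets_agreement_event: "agreement_event c \<in> sets P"
  unfolding agreement_event_def
  using sets_joint_event sets_above finite_rivals by (intro sets.Diff sets.finite_UN) auto

definition support_event :: "nat \<Rightarrow> (nat \<Rightarrow> real \<times> real) set" where
  "support_event c = {\<omega> \<in> space (iid \<mu> (supp c)).
     joint_tail_event threshold (\<phi> * threshold) (truncation p) (supp c) \<omega>}"

lemma sets_support_event: "support_event c \<in> sets (iid \<mu> (supp c))"
  unfolding support_event_def by (rule sets_joint_tail_event[OF sets_source]) auto

lemma joint_event_eq_restrict:
  "joint_event c = {\<omega> \<in> space P. restrict \<omega> (supp c) \<in> support_event c}"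
proof -
  have "restrict \<omega> (supp c) \<in> space (iid \<mu> (supp c))" if "\<omega> \<in> space P" for \<omega>
    using that
    by (rule measurable_space[OF measurable_restrict_subset[OF code_support_subset_samples]])
  then show ?thesis by (auto simp: joint_event_def support_event_def)
qed

lemma prob_joint_event_eq_support:
  "measure P (joint_event c) = measure (iid \<mu> (supp c)) (support_event c)"
  unfolding joint_event_eq_restrict
  by (rule measure_iid_restrict[OF prob_space_source _ code_support_subset_samples
    sets_support_event])
    simp

lemma prob_joint_event: "measure P (joint_event c) = joint_tail_prob \<mu> \<phi> H (supp c)"
  by (simp add: prob_joint_event_eq_support joint_tail_prob_def support_event_def)

lemma prob_interference_le:
  assumes c_less: "c < 2 ^ k" and rival_d: "d < 2 ^ k" "d \<noteq> c" and component: "f \<in> {fst, snd}"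
    and \<psi>_bounds: "0 \<le> \<psi>" "\<psi> \<le> 1"
  shows "measure P (joint_event c \<inter> above f (\<psi> * threshold) d)
    \<le> measure P (joint_event c) * (2 * exp (- (\<psi>\<^sup>2 * H)))"
proof -
  let ?s = threshold and ?M = "truncation p"
  have p_pos: "0 < p" using prime_p by (rule prime_gt_0_nat)
  have threshold_nonneg: "0 \<le> ?s" by (rule tail_threshold_nonneg[OF H_nonneg])
  let ?T = "support_event c"
  have "measure P (joint_event c \<inter> above f (\<psi> * ?s) d) =
      \<P>(\<omega> in P. restrict \<omega> (supp c) \<in> ?T \<and> \<psi> * ?s \<le> (\<Sum>i\<in>supp d. f (\<omega> i)))"
    unfolding joint_event_eq_restrict above_def by (intro arg_cong[of _ _ "measure P"]) auto
  also have "\<dots> \<le> measure (iid \<mu> (supp c)) ?T *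
      exp (real (card (supp d)) * ((\<psi> * ?s / p)\<^sup>2 / 2) - \<psi> * ?s / p * (\<psi> * ?s - k * ?M))"
  proof (rule subgaussian_overlapping_sum_tail[OF prob_space_source _ _ code_support_subset_samples
    code_support_subset_samples sets_support_event])
    show "subgaussian \<mu> f" using component subgaussian_fst subgaussian_snd by auto
    show "f (\<omega> i) \<le> ?M" if "\<omega> \<in> ?T" "i \<in> supp c" for \<omega> i
      using that component by (auto simp: support_event_def joint_tail_event_def)
    show "real (card (supp d \<inter> supp c)) \<le> real k"
      using card_code_support_Int[OF prime_p rival_d(1) c_less rival_d(2)] by simp
  qed (use threshold_nonneg \<psi>_bounds in auto)
  also have "real (card (supp d)) * ((\<psi> * ?s / p)\<^sup>2 / 2) - \<psi> * ?s / p * (\<psi> * ?s - k * ?M) =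
      - (\<psi>\<^sup>2 * (?s\<^sup>2 / (2 * p))) + \<psi> * (?s / p * (k * ?M))"
    using p_pos by (simp add: power2_eq_square field_simps)
  also have "?s\<^sup>2 / (2 * p) = H" using p_pos by (simp add: tail_threshold_square[OF H_nonneg])
  also have "measure (iid \<mu> (supp c)) ?T * exp (- (\<psi>\<^sup>2 * H) + \<psi> * (?s / p * (k * ?M))) \<le>
      measure (iid \<mu> (supp c)) ?T * exp (- (\<psi>\<^sup>2 * H) + ln 2)"
  proof -
    have "\<psi> * (?s / p * (k * ?M)) \<le> 1 * (?s / p * (k * ?M))"
      using \<psi>_bounds threshold_nonneg by (intro mult_right_mono) auto
    then show ?thesis using overlap_small by (intro mult_left_mono) auto
  qed
  also have "exp (- (\<psi>\<^sup>2 * H) + ln 2) = 2 * exp (- (\<psi>\<^sup>2 * H))" by (simp only: exp_add) simp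
  finally show ?thesis by (simp only: prob_joint_event_eq_support)
qed

lemma prob_above_others_le:
  assumes c_less: "c < 2 ^ k"
  shows "(\<Sum>d\<in>{..<2 ^ k} - {c}. measure P (joint_event c \<inter> above fst threshold d)) \<le>
      measure P (joint_event c) / 4"
proof -
  let ?D = "{..<2 ^ k} - {c}" and ?e = "measure P (joint_event c)"
  have "(\<Sum>d\<in>?D. measure P (joint_event c \<inter> above fst threshold d)) \<le>
      card ?D * (?e * (2 * exp (- H)))"
    using prob_interference_le[OF c_less, of _ fst 1] by (intro sum_bounded_above) auto
  also have "\<dots> \<le> 2 ^ k * (?e * (2 * exp (- H)))"
    by (intro mult_right_mono) (auto simp: card_Diff_singleton_if)
  also have "\<dots> = ?e * (2 ^ k * (2 * exp (- H)))" by (simp only: ac_simps)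
  also have "\<dots> \<le> ?e * (1 / 4)" using few_codewords by (intro mult_left_mono) auto
  finally show ?thesis by simp
qed

lemma prob_above_rivals_le:
  assumes c_less: "c < 2 ^ k"
  shows "(\<Sum>d\<in>rivals c. measure P (joint_event c \<inter> above snd (\<phi> * threshold) d)) \<le>
      measure P (joint_event c) / 4"
proof -
  let ?e = "measure P (joint_event c)" and ?q = "2 * exp (- (\<phi>\<^sup>2 * H))"
  have "card (rivals c) \<le> 2 ^ (k - m)"
    using card_Diff1_le card_take_bit_eq_le[OF m_le, of c] unfolding rivals_def
    by (rule order_trans)
  then have card_rivals: "real (card (rivals c)) \<le> 2 ^ (k - m)"
    by (simp flip: of_nat_le_iff)
  have "(\<Sum>d\<in>rivals c. measure P (joint_event c \<inter> above snd (\<phi> * threshold) d)) \<le>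
      card (rivals c) * (?e * ?q)"
    by (intro sum_bounded_above prob_interference_le c_less \<phi>_nonneg \<phi>_le_1) (auto simp: rivals_def)
  also have "\<dots> \<le> 2 ^ (k - m) * (?e * ?q)" using card_rivals by (intro mult_right_mono) auto
  also have "\<dots> = ?e * (2 ^ (k - m) * ?q)" by (simp only: ac_simps)
  also have "\<dots> \<le> ?e * (1 / 4)" using few_candidates by (intro mult_left_mono) auto
  finally show ?thesis by simp
qed

lemma prob_agreement_event_ge:
  assumes c_less: "c < 2 ^ k"
  shows "measure P (joint_event c) / 2 \<le> measure P (agreement_event c)"
proof -
  interpret P: prob_space P by (rule prob_space_iid[OF prob_space_source])
  define E where "E = joint_event c - (\<Union>d\<in>{..<2 ^ k} - {c}. above fst threshold d)"
  have sets_E: "E \<in> P.events"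
    unfolding E_def using sets_joint_event sets_above by (intro sets.Diff sets.finite_UN) auto
  have "P.prob (joint_event c) - P.prob (joint_event c) / 4 \<le> P.prob E"
    using P.measure_Diff_UN_ge[of "{..<2 ^ k} - {c}" "joint_event c" "above fst threshold"]
      prob_above_others_le[OF c_less] sets_joint_event sets_above unfolding E_def by fastforce
  moreover have "(\<Sum>d\<in>rivals c. P.prob (E \<inter> above snd (\<phi> * threshold) d)) \<le>
      (\<Sum>d\<in>rivals c. P.prob (joint_event c \<inter> above snd (\<phi> * threshold) d))"
    using sets_joint_event sets_above by (intro sum_mono P.finite_measure_mono) (auto simp: E_def)
  moreover have "P.prob E - (\<Sum>d\<in>rivals c. P.prob (E \<inter> above snd (\<phi> * threshold) d)) \<le>
      P.prob (agreement_event c)"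
    unfolding agreement_event_def E_def[symmetric]
    by (rule P.measure_Diff_UN_ge[OF finite_rivals sets_E sets_above(2)])
  ultimately show ?thesis using prob_above_rivals_le[OF c_less] by linarith
qed

lemma disjoint_agreement_events: "disjoint_family_on agreement_event {..<2 ^ k}"
proof (unfold disjoint_family_on_def, intro ballI impI equals0I)
  fix c d \<omega> assume c_neq_d: "c \<in> {..<2 ^ k}" "c \<noteq> d"
    and in_both: "\<omega> \<in> agreement_event c \<inter> agreement_event d"
  have "\<omega> \<in> above fst threshold c"
    using in_both by (auto simp: agreement_event_def joint_event_def joint_tail_event_def above_def)
  then show False
    using in_both c_neq_d by (auto simp: agreement_event_def)
qed

lemma keys_agree_on_agreement_event:
  assumes c_less: "c < 2 ^ k" and in_agreement_event: "\<omega> \<in> agreement_event c"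
  defines "S \<equiv> threshold_scheme k p threshold (\<phi> * threshold) m" and "n \<equiv> p\<^sup>2 + k"
  shows "alice_key S (alice_input n \<omega>) = bob_key S (bob_input n \<omega>) (alice_msg S (alice_input n \<omega>))"
  unfolding S_def n_def
proof (rule keys_agree[OF c_less])
  have \<omega>_in_space: "\<omega> \<in> space P" and in_joint_event: "\<omega> \<in> joint_event c"
    using in_agreement_event by (auto simp: agreement_event_def joint_event_def)
  show "threshold \<le> score k p (alice_input (p\<^sup>2 + k) \<omega>) c"
    "\<phi> * threshold \<le> score k p (bob_input (p\<^sup>2 + k) \<omega>) c"
    using in_joint_event by (simp_all add: score_inputs joint_event_def joint_tail_event_def)
  show "score k p (alice_input (p\<^sup>2 + k) \<omega>) d < threshold" if "d < 2 ^ k" "d \<noteq> c" for d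
    using in_agreement_event \<omega>_in_space that
    by (auto simp: score_inputs agreement_event_def above_def not_le)
  show "score k p (bob_input (p\<^sup>2 + k) \<omega>) d < \<phi> * threshold"
    if "d < 2 ^ k" "d \<noteq> c" "take_bit m d = take_bit m c" for d
    using in_agreement_event \<omega>_in_space that
    by (auto simp: score_inputs agreement_event_def above_def rivals_def not_le)
qed

lemma agreement_prob_ge:
  assumes \<epsilon>_le: "\<And>c. \<epsilon> \<le> joint_tail_prob \<mu> \<phi> H (supp c)"
  shows "2 ^ k * (\<epsilon> / 2) \<le> agreement_prob \<mu> (threshold_scheme k p threshold (\<phi> * threshold) m)"
proof -
  interpret P: prob_space P by (rule prob_space_iid[OF prob_space_source])
  let ?S = "threshold_scheme k p threshold (\<phi> * threshold) m" and ?n = "p\<^sup>2 + k"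
  define A where "A = {\<omega> \<in> space P. alice_key ?S (alice_input ?n \<omega>) =
      bob_key ?S (bob_input ?n \<omega>) (alice_msg ?S (alice_input ?n \<omega>))}"
  have sets_A: "A \<in> P.events"
    using sets_agreement[OF one_way_threshold_scheme[OF m_le] sets_source,
        of p threshold "\<phi> * threshold"]
    by (simp only: A_def iid_samples_def threshold_scheme_simps)
  have "2 ^ k * (\<epsilon> / 2) = (\<Sum>c<2 ^ k :: nat. \<epsilon> / 2)" by simp
  also have "\<dots> \<le> (\<Sum>c<2 ^ k. P.prob (agreement_event c))"
  proof (rule sum_mono)
    fix c :: nat assume "c \<in> {..<2 ^ k}"
    then show "\<epsilon> / 2 \<le> P.prob (agreement_event c)"
      using prob_agreement_event_ge[of c] \<epsilon>_le[of c] by (simp add: prob_joint_event)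
  qed
  also have "\<dots> = P.prob (\<Union>c<2 ^ k. agreement_event c)"
    by (intro P.finite_measure_finite_Union[symmetric] disjoint_agreement_events)
      (auto intro: sets_agreement_event)
  also have "\<dots> \<le> P.prob A"
  proof (rule P.finite_measure_mono[OF UN_least sets_A])
    fix c :: nat assume "c \<in> {..<2 ^ k}"
    moreover have "agreement_event c \<subseteq> space P"
      by (rule sets.sets_into_space[OF sets_agreement_event])
    ultimately show "agreement_event c \<subseteq> A"
      using keys_agree_on_agreement_event unfolding A_def by blast
  qed
  also have "P.prob A = agreement_prob \<mu> ?S"
    by (simp only: agreement_prob_def Let_def A_def iid_samples_def threshold_scheme_simps)
  finally show ?thesis .
qed

end

section \<open>Choice of the parameters\<close>

lemma key_source_DSBS: "-1 \<le> \<rho> \<Longrightarrow> \<rho> \<le> 1 \<Longrightarrow> key_source (DSBS \<rho>)"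
  by (intro key_source.intro DSBS_source DSBS_marginals)

lemma key_source_BGS:
  assumes "-1 \<le> \<rho>" "\<rho> \<le> 1"
  shows "key_source (BGS \<rho>)"
proof -
  note BGS = BGS_source[OF assms]
  show ?thesis
    by (intro key_source.intro BGS(1,2) distributed_std_normal_subgaussian BGS(3,4)
        prob_space.distributed_std_normal_nonneg[OF BGS(1,3)])
qed

lemma correlation_gap_bounds:
  fixes \<rho> \<delta> :: real
  assumes \<rho>_bounds: "0 \<le> \<rho>" "\<rho> < 1" and \<delta>_bounds: "0 \<le> \<delta>" "\<delta> \<le> sqrt ((1 - \<rho>) / (1 + \<rho>))"
  shows "\<delta> \<le> sqrt (1 - \<rho>\<^sup>2)" "\<delta> \<le> 1" "\<rho> + \<delta> * sqrt (1 - \<rho>\<^sup>2) \<le> 1"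
proof -
  define r where "r = sqrt (1 - \<rho>\<^sup>2)"
  have factor: "1 - \<rho>\<^sup>2 = (1 - \<rho>) * (1 + \<rho>)" by (simp add: power2_eq_square algebra_simps)
  have r_bounds: "0 \<le> r" "r \<le> 1" using \<rho>_bounds by (simp_all add: r_def power_le_one)
  have r_square: "r * r = (1 - \<rho>) * (1 + \<rho>)" using \<rho>_bounds by (simp add: r_def factor)
  have "\<delta> * (1 + \<rho>) \<le> sqrt ((1 - \<rho>) / (1 + \<rho>)) * (1 + \<rho>)"
    using \<delta>_bounds(2) \<rho>_bounds by (intro mult_right_mono) auto
  also have "\<dots> = sqrt ((1 - \<rho>) / (1 + \<rho>) * (1 + \<rho>)\<^sup>2)"
    unfolding real_sqrt_mult using \<rho>_bounds by simp
  also have "(1 - \<rho>) / (1 + \<rho>) * (1 + \<rho>)\<^sup>2 = 1 - \<rho>\<^sup>2"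
    unfolding factor using \<rho>_bounds by (simp add: power2_eq_square)
  finally have gap: "\<delta> * (1 + \<rho>) \<le> r" by (simp add: r_def)
  then have "\<delta> \<le> r" using mult_left_mono[of 1 "1 + \<rho>" \<delta>] \<rho>_bounds \<delta>_bounds(1) by simp
  then show "\<delta> \<le> sqrt (1 - \<rho>\<^sup>2)" "\<delta> \<le> 1" using r_bounds unfolding r_def by linarith+
  have "\<delta> * r * (1 + \<rho>) \<le> (1 - \<rho>) * (1 + \<rho>)"
    using mult_right_mono[OF gap r_bounds(1)] by (simp add: r_square mult_ac)
  then show "\<rho> + \<delta> * sqrt (1 - \<rho>\<^sup>2) \<le> 1" using \<rho>_bounds by (simp add: r_def)
qed

locale joint_tail_source = key_source +
  fixes \<delta> \<phi> :: real and B b e :: nat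
  assumes \<delta>_bounds: "0 \<le> \<delta>" "\<delta> \<le> 1" and \<phi>_bounds: "0 < \<phi>" "\<phi> \<le> 1"
    and tail_bound: "joint_tail_bound \<mu> \<delta> \<phi> B b e"
begin

text \<open>The slack keeps each of the two union bounds of \<open>threshold_code\<close> below \<open>1 / 4\<close>; the summand
  \<open>64\<close> in the support size makes the overlap of two supports contribute at most \<open>ln 2\<close>.\<close>

definition slack :: nat where
  "slack = nat \<lceil>4 / \<phi>\<^sup>2\<rceil> + 4"

definition exponent :: "nat \<Rightarrow> real" where
  "exponent k = ln 2 * real (k + slack)"

definition support_size :: "nat \<Rightarrow> nat" where
  "support_size k = least_prime_above ((B + 64) * (k + slack) ^ 6 + 4)"

definition prefix_len :: "nat \<Rightarrow> nat" where
  "prefix_len k = nat \<lfloor>(1 - \<phi>\<^sup>2) * real k\<rfloor>"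

definition alice_threshold :: "nat \<Rightarrow> real" where
  "alice_threshold k = tail_threshold (exponent k) (support_size k)"

definition scheme :: "nat \<Rightarrow> cr_scheme" where
  "scheme k =
     threshold_scheme k (support_size k) (alice_threshold k) (\<phi> * alice_threshold k) (prefix_len k)"

lemma \<phi>_square_bounds: "0 < \<phi>\<^sup>2" "\<phi>\<^sup>2 \<le> 1"
  using \<phi>_bounds by (simp_all add: power_le_one)

lemma slack_ge: "4 \<le> slack" "4 \<le> \<phi>\<^sup>2 * real slack"
proof -
  have "4 / \<phi>\<^sup>2 \<le> real slack" unfolding slack_def by linarith
  then show "4 \<le> \<phi>\<^sup>2 * real slack" using \<phi>_square_bounds by (simp add: field_simps)
qed (simp add: slack_def)

lemma prefix_len_eq_floor: "real (prefix_len k) = of_int \<lfloor>(1 - \<phi>\<^sup>2) * real k\<rfloor>"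
  using \<phi>_square_bounds by (simp add: prefix_len_def)

lemma prefix_len_bounds:
  "real (prefix_len k) \<le> (1 - \<phi>\<^sup>2) * real k" "(1 - \<phi>\<^sup>2) * real k - 1 \<le> real (prefix_len k)"
  unfolding prefix_len_eq_floor by linarith+

lemma prefix_len_le: "prefix_len k \<le> k"
proof -
  have "(1 - \<phi>\<^sup>2) * real k \<le> 1 * real k" using \<phi>_square_bounds by (intro mult_right_mono) auto
  then show ?thesis using prefix_len_bounds(1)[of k] by linarith
qed

lemma prime_support_size: "prime (support_size k)"
  unfolding support_size_def by (rule least_prime_above) simp

lemma support_size_ge: "(real B + 64) * real (k + slack) ^ 6 \<le> real (support_size k)"
proof -
  have "(B + 64) * (k + slack) ^ 6 \<le> support_size k"
    using least_prime_above(2)[of "(B + 64) * (k + slack) ^ 6 + 4"] by (simp add: support_size_def)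
  then have "real ((B + 64) * (k + slack) ^ 6) \<le> real (support_size k)" by (rule of_nat_mono)
  then show ?thesis by simp
qed

definition support_factor :: nat where
  "support_factor = 2 * ((B + 68) * (1 + slack) ^ 6) ^ 3"

lemma support_size_le:
  assumes k_ge_1: "1 \<le> k"
  shows "support_size k \<le> support_factor * k ^ 18"
proof -
  let ?N = "(B + 64) * (k + slack) ^ 6 + 4"
  have "1 \<le> (k + slack) ^ 6" using k_ge_1 by simp
  then have "?N \<le> (B + 68) * (k + slack) ^ 6" unfolding add_mult_distrib by linarith
  also have "\<dots> \<le> (B + 68) * ((1 + slack) * k) ^ 6"
    using k_ge_1 by (intro mult_le_mono power_mono) (auto simp: add_mult_distrib)
  finally have "?N ^ 3 \<le> ((B + 68) * ((1 + slack) * k) ^ 6) ^ 3" by (intro power_mono) auto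
  moreover have "support_size k \<le> 2 * ?N ^ 3"
    unfolding support_size_def by (rule least_prime_above(3)) simp
  ultimately have "support_size k \<le> 2 * ((B + 68) * ((1 + slack) * k) ^ 6) ^ 3" by linarith
  also have "\<dots> = support_factor * k ^ 18"
    unfolding support_factor_def power_mult_distrib by (simp flip: power_mult)
  finally show ?thesis .
qed

lemma num_samples_le:
  assumes k_ge_1: "1 \<le> k"
  shows "num_samples (scheme k) \<le> (support_factor\<^sup>2 + 1) * k ^ 36"
proof -
  have "(support_size k)\<^sup>2 \<le> (support_factor * k ^ 18)\<^sup>2"
    using support_size_le[OF k_ge_1] by (rule power_mono) simp
  also have "\<dots> = support_factor\<^sup>2 * k ^ 36" by (simp add: power_mult_distrib flip: power_mult)
  finally have "(support_size k)\<^sup>2 \<le> support_factor\<^sup>2 * k ^ 36" .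
  moreover have "k \<le> k ^ 36" using k_ge_1 power_increasing[of 1 36 k] by simp
  ultimately show ?thesis by (simp add: scheme_def add_mult_distrib)
qed

lemma explicit_family_scheme:
  assumes elementary_\<phi>: "elementary A (\<lambda>_. \<phi>)"
  shows "explicit_family A scheme"
  unfolding scheme_def
proof (rule explicit_family_threshold_scheme)
  fix f assume elem_nat_f: "elem_nat A f"
  show elem_nat_support_size: "elem_nat A (\<lambda>xs. support_size (f xs))"
    unfolding support_size_def by (intro elem_nat_least_prime_above elem_intros elem_nat_f) simp
  show "elem_nat A (\<lambda>xs. prefix_len (f xs))"
    unfolding prefix_len_eq_floor power2_eq_square
    by (intro elementary.floor elementary.mult elementary.diff elementary_one elementary_\<phi>
      elem_nat_f)
  show threshold: "elementary A (\<lambda>xs. alice_threshold (f xs))"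
    unfolding alice_threshold_def tail_threshold_def exponent_def
    by (intro elementary.sqrt elementary.mult elementary.ln elementary_numeral elem_nat_support_size
      elem_intros elem_nat_f)
  show "elementary A (\<lambda>xs. \<phi> * alice_threshold (f xs))"
    by (intro elementary.mult elementary_\<phi> threshold)
qed (rule prefix_len_le)

lemma scheme_one_way: "one_way_scheme k (scheme k)"
  unfolding scheme_def by (rule one_way_threshold_scheme[OF prefix_len_le])

lemma scheme_min_entropy_ge: "real k - 1 \<le> key_min_entropy \<mu> (scheme k)"
  unfolding scheme_def alice_threshold_def
proof (rule key_min_entropy_ge[OF _ _ prefix_len_le])
  show "0 < support_size k" by (rule prime_gt_0_nat[OF prime_support_size])
  have "real k * ln 2 \<le> real (k + slack) * ln 2" by (intro mult_right_mono) auto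
  then show "real k * ln 2 \<le> exponent k" by (simp add: exponent_def mult.commute)
qed

lemma exponent_bounds: "1 \<le> exponent k" "exponent k \<le> real (k + slack)"
proof -
  have "1 / 2 * 4 \<le> ln 2 * real (k + slack)"
    using slack_ge(1) ln2_ge_two_thirds by (intro mult_mono) auto
  then show "1 \<le> exponent k" by (simp add: exponent_def)
  have "ln (2 :: real) \<le> 1" using ln_le_minus_one[of "2 :: real"] by simp
  then show "exponent k \<le> real (k + slack)"
    unfolding exponent_def by (intro mult_left_le_one_le) auto
qed

lemma exp_exponent: "exp (- (\<psi> * exponent k)) = 2 powr (- (\<psi> * real (k + slack)))"
  by (simp add: powr_def exponent_def mult_ac)

lemma scheme_overlap_small:
  "alice_threshold k / support_size k * (k * truncation (support_size k)) \<le> ln 2"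
proof -
  define q K where "q = real (support_size k)" and "K = real (k + slack)"
  have q_pos: "0 < q" using prime_gt_0_nat[OF prime_support_size] by (simp add: q_def)
  have K_bounds: "4 \<le> K" "real k \<le> K" using slack_ge(1) by (auto simp: K_def)
  have "0 \<le> real B * K ^ 6" using K_bounds by simp
  then have "64 * K ^ 6 \<le> q"
    using support_size_ge[of k] unfolding q_def K_def distrib_right by linarith
  then have sqrt_q: "8 * K ^ 3 \<le> sqrt q"
    by (intro real_le_rsqrt) (simp add: power_mult_distrib flip: power_mult)
  have "alice_threshold k / q * (k * sqrt (sqrt q)) \<le> 1 / 2"
  proof (rule power2_le_imp_le)
    have "(alice_threshold k / q * (k * sqrt (sqrt q)))\<^sup>2 =
        2 * exponent k * q / q\<^sup>2 * ((real k)\<^sup>2 * sqrt q)"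
      using q_pos exponent_bounds(1)[of k]
      by (simp add: power_mult_distrib power_divide alice_threshold_def tail_threshold_def q_def)
    also have "\<dots> = 2 * exponent k * (real k)\<^sup>2 * (sqrt q / q)"
      using q_pos by (simp add: power2_eq_square)
    also have "sqrt q / q = 1 / sqrt q" using q_pos by (simp add: field_simps)
    also have "2 * exponent k * (real k)\<^sup>2 * (1 / sqrt q) \<le> 2 * K * K\<^sup>2 * (1 / (8 * K ^ 3))"
      using exponent_bounds[of k] K_bounds sqrt_q q_pos
      by (intro mult_mono power_mono divide_left_mono) (auto simp: K_def)
    also have "\<dots> = (1 / 2)\<^sup>2" using K_bounds by (simp add: power2_eq_square power3_eq_cube)
    finally show "(alice_threshold k / q * (k * sqrt (sqrt q)))\<^sup>2 \<le> (1 / 2)\<^sup>2" .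
  qed simp
  then show ?thesis using ln2_ge_two_thirds unfolding q_def by linarith
qed

lemma scheme_few_codewords: "2 ^ k * (2 * exp (- exponent k)) \<le> 1 / 4"
proof -
  have "2 ^ k * (2 * exp (- exponent k)) = 2 powr real k * (2 powr 1 * 2 powr (- real (k + slack)))"
    using exp_exponent[of 1 k] by (simp add: powr_realpow)
  also have "\<dots> = 2 powr (1 - real slack)"
    unfolding powr_add[symmetric] by simp
  also have "\<dots> \<le> 2 powr (- 2)" using slack_ge(1) by (intro powr_mono) auto
  finally show ?thesis by (simp add: powr_minus_divide)
qed

lemma scheme_few_candidates: "2 ^ (k - prefix_len k) * (2 * exp (- (\<phi>\<^sup>2 * exponent k))) \<le> 1 / 4"
proof -
  have "2 ^ (k - prefix_len k) * (2 * exp (- (\<phi>\<^sup>2 * exponent k))) =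
      2 powr real (k - prefix_len k) * (2 powr 1 * 2 powr (- (\<phi>\<^sup>2 * real (k + slack))))"
    by (simp add: powr_realpow exp_exponent)
  also have "\<dots> = 2 powr (real (k - prefix_len k) + 1 - \<phi>\<^sup>2 * real (k + slack))"
    unfolding powr_add[symmetric] by (simp add: algebra_simps)
  also have "\<dots> \<le> 2 powr (- 2)"
  proof (rule powr_mono)
    have "real (k - prefix_len k) \<le> \<phi>\<^sup>2 * real k + 1"
      using prefix_len_bounds(2)[of k] prefix_len_le[of k] by (simp add: of_nat_diff algebra_simps)
    then show "real (k - prefix_len k) + 1 - \<phi>\<^sup>2 * real (k + slack) \<le> - 2"
      using slack_ge(2) by (simp add: algebra_simps)
  qed simp
  finally show ?thesis by (simp add: powr_minus_divide)
qed

lemma threshold_code_scheme: "threshold_code \<mu> k (support_size k) (prefix_len k) (exponent k) \<phi>"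
proof unfold_locales
  show "0 \<le> exponent k" using exponent_bounds(1)[of k] by simp
  show "0 \<le> \<phi>" "\<phi> \<le> 1" using \<phi>_bounds by simp_all
qed (rule prime_support_size prefix_len_le scheme_overlap_small[unfolded alice_threshold_def]
    scheme_few_codewords scheme_few_candidates)+

lemma agreement_prob_scheme_ge:
  "2 ^ k * (exp (- ((1 + \<delta>\<^sup>2) * exponent k)) / (real b * real (support_size k) ^ e) / 2) \<le>
      agreement_prob \<mu> (scheme k)"
proof -
  interpret threshold_code \<mu> k "support_size k" "prefix_len k" "exponent k" \<phi>
    by (rule threshold_code_scheme)
  have "real B * exponent k ^ 6 \<le> (real B + 64) * real (k + slack) ^ 6"
    using exponent_bounds[of k] by (intro mult_mono power_mono) auto
  also note support_size_ge
  finally have support_large: "real B * exponent k ^ 6 \<le> real (card (supp c))" for c by simp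
  show ?thesis
    unfolding scheme_def alice_threshold_def
  proof (rule agreement_prob_ge)
    show "exp (- ((1 + \<delta>\<^sup>2) * exponent k)) / (real b * real (support_size k) ^ e) \<le>
        joint_tail_prob \<mu> \<phi> (exponent k) (supp c)" for c
      using tail_bound exponent_bounds(1)[of k] support_large[of c]
        finite_code_support[of k "support_size k" c]
      unfolding joint_tail_bound_def by (metis card_code_support)
  qed
qed

lemma ex_agreement_prob_scheme_ge:
  "\<exists>b d :: nat. 0 < b \<and>
    (\<forall>k\<ge>1. 2 powr (- (\<delta>\<^sup>2 * real k)) / (real b * real k ^ d) \<le> agreement_prob \<mu> (scheme k))"
proof (intro exI conjI allI impI)
  let ?b = "2 ^ (2 * slack + 1) * b * support_factor ^ e"
  show "0 < ?b"
    using tail_bound by (simp add: support_factor_def joint_tail_bound_def)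
  fix k :: nat assume k_ge_1: "1 \<le> k"
  define p where "p = real (support_size k)"
  have p_pos: "0 < p" using prime_gt_0_nat[OF prime_support_size] by (simp add: p_def)
  have b_pos: "0 < real b" using tail_bound by (simp add: joint_tail_bound_def)
  have "\<delta>\<^sup>2 * real slack \<le> 1 * real slack"
    using \<delta>_bounds by (intro mult_right_mono) (auto simp: power_le_one)
  then have "2 powr (- (\<delta>\<^sup>2 * real k) - 2 * real slack) \<le>
      2 powr (real k + - ((1 + \<delta>\<^sup>2) * real (k + slack)))"
    by (intro powr_mono) (simp_all add: algebra_simps)
  also have "\<dots> = 2 ^ k * exp (- ((1 + \<delta>\<^sup>2) * exponent k))"
    unfolding powr_add exp_exponent by (simp add: powr_realpow)
  finally have numerator_le: "2 powr (- (\<delta>\<^sup>2 * real k) - 2 * real slack) \<le>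
      2 ^ k * exp (- ((1 + \<delta>\<^sup>2) * exponent k))" .
  have "p \<le> real (support_factor * k ^ 18)"
    unfolding p_def using support_size_le[OF k_ge_1] by (rule of_nat_mono)
  then have "p ^ e \<le> real (support_factor * k ^ 18) ^ e" using p_pos by (intro power_mono) auto
  also have "\<dots> = real support_factor ^ e * real k ^ (18 * e)"
    by (simp add: power_mult_distrib power_mult)
  finally have denominator_le: "p ^ e \<le> real support_factor ^ e * real k ^ (18 * e)" .
  have "2 powr (2 * real slack) = (2 :: real) ^ (2 * slack)"
    using powr_realpow[of 2 "2 * slack"] by simp
  then have "2 powr (- (\<delta>\<^sup>2 * real k)) / (real ?b * real k ^ (18 * e)) =
      2 powr (- (\<delta>\<^sup>2 * real k) - 2 * real slack) /
        (2 * real b * (real support_factor ^ e * real k ^ (18 * e)))"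
    by (simp add: powr_diff field_simps)
  also have "\<dots> \<le> 2 ^ k * exp (- ((1 + \<delta>\<^sup>2) * exponent k)) / (2 * real b * p ^ e)"
    using numerator_le denominator_le b_pos p_pos by (intro frac_le mult_left_mono) auto
  also have "\<dots> \<le> agreement_prob \<mu> (scheme k)"
    using agreement_prob_scheme_ge[of k] by (simp add: p_def mult_ac)
  finally show "2 powr (- (\<delta>\<^sup>2 * real k)) / (real ?b * real k ^ (18 * e)) \<le>
      agreement_prob \<mu> (scheme k)" .
qed

end

lemma joint_tail_source_DSBS_BGS:
  assumes \<rho>_bounds: "0 < \<rho>" "\<rho> < 1" and \<delta>_bounds: "0 \<le> \<delta>" "\<delta> \<le> sqrt ((1 - \<rho>) / (1 + \<rho>))"
    and \<mu>_cases: "\<mu> \<in> {DSBS \<rho>, BGS \<rho>}"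
  obtains B b e where "joint_tail_source \<mu> \<delta> (\<rho> + \<delta> * sqrt (1 - \<rho>\<^sup>2)) B b e"
proof -
  note gap = correlation_gap_bounds[OF less_imp_le[OF \<rho>_bounds(1)] \<rho>_bounds(2) \<delta>_bounds]
  have "key_source \<mu>"
    using \<mu>_cases key_source_DSBS[of \<rho>] key_source_BGS[of \<rho>] \<rho>_bounds by auto
  moreover obtain B b e where "joint_tail_bound \<mu> \<delta> (\<rho> + \<delta> * sqrt (1 - \<rho>\<^sup>2)) B b e"
    using \<mu>_cases \<rho>_bounds \<delta>_bounds(1) gap(2)
      DSBS_joint_tail[OF \<rho>_bounds \<delta>_bounds(1) gap(1)] BGS_joint_tail[of \<rho> \<delta>] by auto
  moreover have "0 < \<rho> + \<delta> * sqrt (1 - \<rho>\<^sup>2)"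
    using \<rho>_bounds \<delta>_bounds(1) by (intro add_pos_nonneg) (auto simp: power_le_one)
  ultimately show thesis
    using \<delta>_bounds(1) gap that by (simp add: joint_tail_source_def joint_tail_source_axioms_def)
qed

theorem theorem1p2:
  shows "\<exists>C>0. \<forall>\<rho> \<delta> \<phi> :: real.
    0 < \<rho> \<longrightarrow> \<rho> < 1 \<longrightarrow> 0 \<le> \<delta> \<longrightarrow> \<delta> \<le> sqrt ((1 - \<rho>) / (1 + \<rho>)) \<longrightarrow>
    \<phi> = \<rho> + \<delta> * sqrt (1 - \<rho>\<^sup>2) \<longrightarrow>
    (\<forall>\<mu> \<in> {DSBS \<rho>, BGS \<rho>}. \<exists>S :: nat \<Rightarrow> cr_scheme.
      explicit_family {\<rho>, \<delta>} S \<and>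
      (\<forall>k. one_way_scheme k (S k)) \<and>
      (\<exists>a d :: nat. \<forall>k\<ge>1. num_samples (S k) \<le> a * k ^ d) \<and>
      (\<exists>e \<in> o(\<lambda>k. real k). \<forall>k\<ge>1. key_min_entropy \<mu> (S k) \<ge> real k - e k) \<and>
      (\<exists>b d :: nat. b > 0 \<and>
        (\<forall>k\<ge>1. agreement_prob \<mu> (S k) \<ge> 2 powr (- (\<delta>\<^sup>2 * real k)) / (real b * real k ^ d))) \<and>
      (\<forall>k\<ge>1. real (msg_len (S k)) \<le> C * (1 - \<phi>\<^sup>2) * real k))"
proof (rule exI[of _ 1], intro conjI[OF zero_less_one] allI impI ballI)
  fix \<rho> \<delta> \<phi> :: real and \<mu>
  assume \<rho>_bounds: "0 < \<rho>" "\<rho> < 1" and \<delta>_bounds: "0 \<le> \<delta>" "\<delta> \<le> sqrt ((1 - \<rho>) / (1 + \<rho>))"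
    and \<phi>_eq: "\<phi> = \<rho> + \<delta> * sqrt (1 - \<rho>\<^sup>2)" and \<mu>_cases: "\<mu> \<in> {DSBS \<rho>, BGS \<rho>}"
  obtain B b e where "joint_tail_source \<mu> \<delta> \<phi> B b e"
    using joint_tail_source_DSBS_BGS[OF \<rho>_bounds \<delta>_bounds \<mu>_cases] \<phi>_eq by blast
  then interpret joint_tail_source \<mu> \<delta> \<phi> B b e .
  have "elementary {\<rho>, \<delta>} (\<lambda>_. \<phi>)"
    unfolding \<phi>_eq power2_eq_square by (intro elementary.intros elementary_one) auto
  then have "explicit_family {\<rho>, \<delta>} scheme" by (rule explicit_family_scheme)
  moreover have "\<exists>e \<in> o(\<lambda>k. real k). \<forall>k\<ge>1. key_min_entropy \<mu> (scheme k) \<ge> real k - e k"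
    using scheme_min_entropy_ge by (intro bexI[of _ "\<lambda>_. 1"]) (auto, real_asymp)
  moreover have "real (msg_len (scheme k)) \<le> 1 * (1 - \<phi>\<^sup>2) * real k" for k
    using prefix_len_bounds(1)[of k] by (simp add: scheme_def)
  ultimately show "\<exists>S :: nat \<Rightarrow> cr_scheme.
      explicit_family {\<rho>, \<delta>} S \<and>
      (\<forall>k. one_way_scheme k (S k)) \<and>
      (\<exists>a d :: nat. \<forall>k\<ge>1. num_samples (S k) \<le> a * k ^ d) \<and>
      (\<exists>e \<in> o(\<lambda>k. real k). \<forall>k\<ge>1. key_min_entropy \<mu> (S k) \<ge> real k - e k) \<and>
      (\<exists>b d :: nat. b > 0 \<and>
        (\<forall>k\<ge>1. agreement_prob \<mu> (S k) \<ge> 2 powr (- (\<delta>\<^sup>2 * real k)) / (real b * real k ^ d))) \<and>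
      (\<forall>k\<ge>1. real (msg_len (S k)) \<le> 1 * (1 - \<phi>\<^sup>2) * real k)"
    using scheme_one_way num_samples_le ex_agreement_prob_scheme_ge by blast
qed

end
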